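(* Let $d\ge 2$, let $|\psi\rangle$ be a pure fermionic Gaussian state on $d$ modes (equivalently, $d$ qubits) with definite parity $\sigma\in\{+1,-1\}$, and let $$L=\Pi_\sigma\Omega_0\Pi_\sigma=\binom d2^{-1}\sum_{k}\sum_{\mathbf z^{(k)}}|\mathbf z^{(k)}\rangle\langle \mathbf z^{(k)}|\otimes|\psi_{\mathbf z^{(k)}}\rangle\langle\psi_{\mathbf z^{(k)}}|$$ be the parity-projected operator of the correlation test for the target $|\psi\rangle$. Then its spectral gap satisfies $$\gamma(L)\ \ge\ \frac{2}{d(d-1)}.$$ Consequently, for $0<\epsilon<1$ and $0<\delta<1$, the sample complexity $N(\epsilon,\delta,d)=\left\lceil \frac{\ln\delta}{\ln(1-\gamma(\Omega)\epsilon)}\right\rceil$ of the certification protocol, with verification operator $\Omega=(\Pi_\sigma+\Omega_0)/2$, satisfies $$N(\epsilon,\delta,d)\ \le\ \left\lceil \frac{d(d-1)}{\epsilon}\ln\delta^{-1}\right\rceil .$$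
   Context: **Gaussian states.** On $(\mathbb C^2)^{\otimes d}$ with computational basis $|\mathbf x\rangle$, $\mathbf x\in\{0,1\}^d$, let $a_j=Z^{\otimes (j-1)}\otimes|0\rangle\langle1|\otimes \mathbb 1^{\otimes(d-j)}$ (Jordan--Wigner) and define the Majorana operators $c_j=a_j+a_j^\dagger$, $c_{d+j}=(a_j-a_j^\dagger)/i$ for $j=1,\dots,d$. A Gaussian unitary is $e^{-iH}$ with $H=\frac i4\sum_{j,k=1}^{2d}h_{jk}c_jc_k$, $h$ real antisymmetric. A pure fermionic Gaussian state is any state $|\psi\rangle=e^{-iH}|\mathbf x\rangle$ (up to global phase). The parity operator is $Z^{\otimes d}$; a state has definite parity $\sigma\in\{\pm1\}$ if it is an eigenvector of $Z^{\otimes d}$ with eigenvalue $\sigma$; $\Pi_\sigma$ is the projector onto the $\sigma$-eigenspace of $Z^{\otimes d}$. **Tests.** For a two-element subset $k=\{k_1<k_2\}\subset[d]=\{1,\dots,d\}$ and $\mathbf z^{(k)}\in\{0,1\}^{d-2}$ indexed by $[d]\setminus k$, let $|\psi_{\mathbf z^{(k)}}\rangle$ be the normalized conditional state of $|\psi\rangle$ on qubits $k_1,k_2$ after the qubits in $[d]\setminus k$ are found in $|\mathbf z^{(k)}\rangle$. Since $|\psi\rangle$ has definite parity it has the form $|\psi_{\mathbf z^{(k)}}\rangle=\alpha|b_1b_2\rangle+\beta|\overline b_1\overline b_2\rangle$ with $b_1=0$, $b_2\in\{0,1\}$, $\overline b=b\oplus1$. For $x\in\{+,-\}$ let $|\psi'_{(\mathbf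 z^{(k)},x)}\rangle=\alpha|b_2\rangle\pm\beta|\overline b_2\rangle$ be the conditional state of qubit $k_2$ after qubit $k_1$ is further found in the $X$-eigenstate $|x\rangle$. Define $$E_k=\sum_{\mathbf z^{(k)}}|\mathbf z^{(k)}\rangle\langle\mathbf z^{(k)}|\otimes\sum_{x\in\{+,-\}}|x\rangle\langle x|_{k_1}\otimes|\psi'_{(\mathbf z^{(k)},x)}\rangle\langle\psi'_{(\mathbf z^{(k)},x)}|_{k_2},\qquad \Omega_0=\binom d2^{-1}\sum_kE_k .$$ All sums over $\mathbf z^{(k)}$ run only over branches with nonzero probability under $|\psi\rangle$ (other branches contribute nothing; they are rejected). The protocol, on each copy of the lab state, applies with probability $1/2$ the parity test (accept operator $\Pi_\sigma$) and with probability $1/2$ the correlation test (accept operator $\Omega_0$), so its single-copy accept operator is $\Omega=(\Pi_\sigma+\Omega_0)/2$, which satisfies $\Omega|\psi\rangle=|\psi\rangle$. The protocol outputs ACCEPT iff all $N$ copies pass. **Spectral gap.** For a positive semidefinite operator $A\le\mathbb 1$ with $A|\psi\rangle=|\psi\rangle$, and eigenvalues in decreasing order with multiplicity $1=\lambda_1(A)\ge\lambda_2(A)\ge\cdots$, $\gamma(A)=1-\lambda_2(A)$. **Sample complexity.** If the lab produces independent states $\rho_1,\dots,\rho_N$ with average infidelity $\frac1N\sum_j(1-\langle\psi|\rho_j|\psi\rangle)\ge\epsilon$, the probability of ACCEPT is at most $(1-\gamma(\Omega)\epsilon)^N$; $N(\epsilon,\delta,d)$ is the number of copies that makes this at most $\delta$,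 i.e. $\lceil \ln\delta/\ln(1-\gamma(\Omega)\epsilon)\rceil$. *)

theory Defs
  imports "Jordan_Normal_Form.Schur_Decomposition"
begin

text \<open>
  Conventions: qubits are numbered \<open>0, \<dots>, d - 1\<close>.  The computational basis vector
  \<open>|x\<rangle>\<close> of \<open>(\<complex>\<^sup>2)\<^sup>\<otimes>\<^sup>d\<close> is \<open>unit_vec (2 ^ d) x\<close>, where qubit \<open>j\<close> is in the state
  given by the binary digit of weight \<open>2 ^ j\<close> of the natural number \<open>x < 2 ^ d\<close>.
\<close>

definition qbit :: "nat \<Rightarrow> nat \<Rightarrow> nat" where
  "qbit x j = (x div 2 ^ j) mod 2"

definition basis_index :: "nat \<Rightarrow> (nat \<Rightarrow> nat) \<Rightarrow> nat" where
  "basis_index d b = (\<Sum>j<d. b j * 2 ^ j)"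

definition ketbra :: "complex vec \<Rightarrow> complex vec \<Rightarrow> complex mat" where
  "ketbra u v = mat (dim_vec u) (dim_vec v) (\<lambda>(i, j). u $ i * cnj (v $ j))"

text \<open>A finite family of \<open>n \<times> n\<close> matrices is summed entrywise, because \<open>mat\<close> has no zero
  of indefinite dimension.\<close>

definition msum :: "nat \<Rightarrow> 'b set \<Rightarrow> ('b \<Rightarrow> complex mat) \<Rightarrow> complex mat" where
  "msum n S F = mat n n (\<lambda>(i, j). \<Sum>s\<in>S. F s $$ (i, j))"

text \<open>\<open>tensor_op d F\<close> is the tensor product of the \<open>2 \<times> 2\<close> matrices \<open>F 0, \<dots>, F (d - 1)\<close>,
  with \<open>F j\<close> acting on qubit \<open>j\<close>.\<close>

definition tensor_op :: "nat \<Rightarrow> (nat \<Rightarrow> complex mat) \<Rightarrow> complex mat" where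
  "tensor_op d F =
     mat (2 ^ d) (2 ^ d) (\<lambda>(x, y). \<Prod>j<d. F j $$ (qbit x j, qbit y j))"

definition pauli_Z :: "complex mat" where
  "pauli_Z = mat_of_rows_list 2 [[1, 0], [0, - 1]]"

text \<open>\<open>x_ket 1\<close> and \<open>x_ket (- 1)\<close> are the Pauli-X eigenstates \<open>|+\<rangle>\<close> and \<open>|-\<rangle>\<close>.\<close>

definition x_ket :: "complex \<Rightarrow> complex vec" where
  "x_ket s = complex_of_real (1 / sqrt 2) \<cdot>\<^sub>v vec_of_list [1, s]"

definition mat_exp :: "complex mat \<Rightarrow> complex mat" where
  "mat_exp A =
     mat (dim_row A) (dim_row A) (\<lambda>(i, j). \<Sum>k. (A ^\<^sub>m k) $$ (i, j) / fact k)"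


subsection \<open>Fermionic Gaussian states\<close>

definition annihilation :: "nat \<Rightarrow> nat \<Rightarrow> complex mat" where
  "annihilation d j =
     tensor_op d (\<lambda>l. if l < j then pauli_Z
                      else if l = j then ketbra (unit_vec 2 0) (unit_vec 2 1)
                      else 1\<^sub>m 2)"

definition majorana :: "nat \<Rightarrow> nat \<Rightarrow> complex mat" where
  "majorana d j =
     (if j < d then annihilation d j + mat_adjoint (annihilation d j)
      else (1 / \<i>) \<cdot>\<^sub>m (annihilation d (j - d) - mat_adjoint (annihilation d (j - d))))"

definition quadratic_hamiltonian :: "nat \<Rightarrow> (nat \<Rightarrow> nat \<Rightarrow> real) \<Rightarrow> complex mat" where
  "quadratic_hamiltonian d h =
     (\<i> / 4) \<cdot>\<^sub>m msum (2 ^ d) ({..<2 * d} \<times> {..<2 * d})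
        (\<lambda>(j, k). complex_of_real (h j k) \<cdot>\<^sub>m (majorana d j * majorana d k))"

definition gaussian_state :: "nat \<Rightarrow> complex vec \<Rightarrow> bool" where
  "gaussian_state d \<psi> \<longleftrightarrow>
     (\<exists>h c x. (\<forall>j<2 * d. \<forall>k<2 * d. h j k = - h k j) \<and> cmod c = 1 \<and> x < 2 ^ d \<and>
        \<psi> = c \<cdot>\<^sub>v (mat_exp ((- \<i>) \<cdot>\<^sub>m quadratic_hamiltonian d h) *\<^sub>v unit_vec (2 ^ d) x))"


subsection \<open>Parity\<close>

definition parity_op :: "nat \<Rightarrow> complex mat" where
  "parity_op d = tensor_op d (\<lambda>_. pauli_Z)"

definition has_parity :: "nat \<Rightarrow> complex \<Rightarrow> complex vec \<Rightarrow> bool" where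
  "has_parity d \<sigma> \<psi> \<longleftrightarrow> \<sigma> \<in> {1, - 1} \<and> eigenvector (parity_op d) \<psi> \<sigma>"

definition is_orth_projector :: "nat \<Rightarrow> complex vec set \<Rightarrow> complex mat \<Rightarrow> bool" where
  "is_orth_projector n S P \<longleftrightarrow>
     P \<in> carrier_mat n n \<and> mat_adjoint P = P \<and> P * P = P \<and>
     (\<lambda>v. P *\<^sub>v v) ` carrier_vec n = S"

definition parity_projector :: "nat \<Rightarrow> complex \<Rightarrow> complex mat" where
  "parity_projector d \<sigma> =
     (THE P. is_orth_projector (2 ^ d)
        {v \<in> carrier_vec (2 ^ d). parity_op d *\<^sub>v v = \<sigma> \<cdot>\<^sub>v v} P)"

lemma is_orth_projector_unique:
  assumes P: "is_orth_projector n S P" and Q: "is_orth_projector n S Q"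
  shows "P = Q"
proof -
  have adj: "mat_adjoint A $$ (i, j) = cnj (A $$ (j, i))"
    if "A \<in> carrier_mat n n" "i < n" "j < n" for A :: "complex mat" and i j
    using that by (auto simp: mat_adjoint_def mat_of_rows_index)
  have absorb: "B * A = A" if A: "is_orth_projector n S A" and B: "is_orth_projector n S B" for A B
  proof -
    have cA: "A \<in> carrier_mat n n" and cB: "B \<in> carrier_mat n n"
      using A B by (auto simp: is_orth_projector_def)
    have *: "B *\<^sub>v (A *\<^sub>v v) = A *\<^sub>v v" if v: "v \<in> carrier_vec n" for v
    proof -
      have "A *\<^sub>v v \<in> (\<lambda>v. B *\<^sub>v v) ` carrier_vec n"
        using A B v unfolding is_orth_projector_def by blast
      then obtain w where w: "w \<in> carrier_vec n" "A *\<^sub>v v = B *\<^sub>v w" by blast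
      have "B *\<^sub>v (B *\<^sub>v w) = (B * B) *\<^sub>v w" using cB w by simp
      then show ?thesis using B w by (simp add: is_orth_projector_def)
    qed
    show ?thesis
    proof (rule mat_col_eqI)
      fix j assume "j < dim_col A"
      then have j: "j < n" using cA by simp
      have "col (B * A) j = B *\<^sub>v col A j" using col_mult2[OF cB cA j] .
      also have unit: "col A j = A *\<^sub>v unit_vec n j"
        using col_mult2[OF cA one_carrier_mat j] cA j by simp
      also have "B *\<^sub>v (A *\<^sub>v unit_vec n j) = A *\<^sub>v unit_vec n j" by (rule *) simp
      finally show "col (B * A) j = col A j" using unit by simp
    qed (use cA cB in auto)
  qed
  have cP: "P \<in> carrier_mat n n" and cQ: "Q \<in> carrier_mat n n"
    using P Q by (auto simp: is_orth_projector_def)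
  have hP: "P $$ (i, j) = cnj (P $$ (j, i))" and hQ: "Q $$ (i, j) = cnj (Q $$ (j, i))"
    if "i < n" "j < n" for i j
  proof -
    have "mat_adjoint P = P" "mat_adjoint Q = Q"
      using P Q unfolding is_orth_projector_def by blast+
    then show "P $$ (i, j) = cnj (P $$ (j, i))" "Q $$ (i, j) = cnj (Q $$ (j, i))"
      using adj[OF cP that] adj[OF cQ that] by (simp_all only:)
  qed
  show ?thesis
  proof (rule eq_matI)
    fix i j assume ij: "i < dim_row Q" "j < dim_col Q"
    then have i: "i < n" and j: "j < n" using cQ by auto
    have "P $$ (i, j) = (Q * P) $$ (i, j)" using absorb[OF P Q] by simp
    also have "\<dots> = (\<Sum>l<n. Q $$ (i, l) * P $$ (l, j))"
      using i j cP cQ by (simp add: scalar_prod_def atLeast0LessThan)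
    also have "\<dots> = cnj (\<Sum>l<n. P $$ (j, l) * Q $$ (l, i))"
      unfolding cnj_sum
    proof (rule sum.cong[OF refl])
      fix l assume "l \<in> {..<n}"
      then have l: "l < n" by simp
      show "Q $$ (i, l) * P $$ (l, j) = cnj (P $$ (j, l) * Q $$ (l, i))"
        by (subst hQ[OF i l], subst hP[OF l j]) simp
    qed
    also have "(\<Sum>l<n. P $$ (j, l) * Q $$ (l, i)) = (P * Q) $$ (j, i)"
      using i j cP cQ by (simp add: scalar_prod_def atLeast0LessThan)
    also have "P * Q = Q" by (rule absorb[OF Q P])
    also have "cnj (Q $$ (j, i)) = Q $$ (i, j)" by (rule hQ[OF i j, symmetric])
    finally show "P $$ (i, j) = Q $$ (i, j)" .
  qed (use cP cQ in auto)
qed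

lemma parity_op_diag:
  assumes "x < 2 ^ d" "y < 2 ^ d"
  shows "parity_op d $$ (x, y) = (if x = y then \<Prod>j<d. (- 1) ^ qbit x j else 0)"
proof -
  have Z: "pauli_Z $$ (a, b) = (if a = b then (- 1) ^ a else 0)" if "a < 2" "b < 2" for a b
    using that by (auto simp: pauli_Z_def mat_of_rows_list_def less_2_cases_iff)
  have lt: "qbit u j < 2" for u j by (simp add: qbit_def)
  have eq: "x = y" if "\<And>j. j < d \<Longrightarrow> qbit x j = qbit y j"
  proof -
    have "bit x j = bit y j" for j
    proof (cases "j < d")
      case True
      then show ?thesis using that[of j] by (simp add: qbit_def bit_iff_odd odd_iff_mod_2_eq_one)
    next
      case False
      then have "x < 2 ^ j" "y < 2 ^ j"
        using assms by (auto intro: less_le_trans[OF _ power_increasing])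
      then show ?thesis by (simp add: bit_iff_odd)
    qed
    then show ?thesis by (simp add: bit_eq_iff)
  qed
  have "parity_op d $$ (x, y) = (\<Prod>j<d. if qbit x j = qbit y j then (- 1) ^ qbit x j else 0)"
    using assms by (simp add: parity_op_def tensor_op_def Z lt)
  also have "\<dots> = (if x = y then \<Prod>j<d. (- 1) ^ qbit x j else 0)"
    using eq by (auto simp: prod_zero_iff)
  finally show ?thesis .
qed

lemma parity_projector_eq:
  assumes s: "\<sigma> \<in> {1, - 1}"
  shows "parity_projector d \<sigma> =
           mat (2 ^ d) (2 ^ d)
             (\<lambda>(x, y). if x = y \<and> (\<Prod>j<d. (- 1) ^ qbit x j) = \<sigma> then 1 else 0)" (is "_ = ?P")
    and "is_orth_projector (2 ^ d)
           {v \<in> carrier_vec (2 ^ d). parity_op d *\<^sub>v v = \<sigma> \<cdot>\<^sub>v v} (parity_projector d \<sigma>)"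
proof -
  let ?n = "2 ^ d :: nat"
  let ?S = "{v \<in> carrier_vec ?n. parity_op d *\<^sub>v v = \<sigma> \<cdot>\<^sub>v v}"
  let ?p = "\<lambda>x. (\<Prod>j<d. (- 1) ^ qbit x j) :: complex"
  have cZ: "parity_op d \<in> carrier_mat ?n ?n" by (simp add: parity_op_def tensor_op_def)
  have diag: "(A *\<^sub>v v) $ i = f i * v $ i"
    if "A \<in> carrier_mat ?n ?n" "v \<in> carrier_vec ?n" "i < ?n"
      and "\<And>i j. i < ?n \<Longrightarrow> j < ?n \<Longrightarrow> A $$ (i, j) = (if i = j then f i else 0)"
    for A :: "complex mat" and v i f
  proof -
    have "(A *\<^sub>v v) $ i = (\<Sum>l\<in>{0..<?n}. (if i = l then f i else 0) * v $ l)"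
      using that by (auto simp: scalar_prod_def intro!: sum.cong)
    also have "\<dots> = (\<Sum>l\<in>{0..<?n}. if i = l then f i * v $ l else 0)"
      by (intro sum.cong) auto
    also have "\<dots> = f i * v $ i" using that(3) by simp
    finally show ?thesis .
  qed
  have Pv: "(?P *\<^sub>v v) $ i = (if ?p i = \<sigma> then 1 else 0) * v $ i"
    if "v \<in> carrier_vec ?n" "i < ?n" for v i
    by (rule diag) (use that in auto)
  have Zv: "(parity_op d *\<^sub>v v) $ i = ?p i * v $ i" if "v \<in> carrier_vec ?n" "i < ?n" for v i
    by (rule diag) (use that cZ in \<open>auto simp: parity_op_diag\<close>)
  have range: "(\<lambda>v. ?P *\<^sub>v v) ` carrier_vec ?n = ?S"
  proof (intro equalityI subsetI)
    fix w assume "w \<in> (\<lambda>v. ?P *\<^sub>v v) ` carrier_vec ?n"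
    then obtain v where v: "v \<in> carrier_vec ?n" and w: "w = ?P *\<^sub>v v" by blast
    have cw: "w \<in> carrier_vec ?n" unfolding w by (rule mult_mat_vec_carrier[OF _ v]) simp
    have "parity_op d *\<^sub>v w = \<sigma> \<cdot>\<^sub>v w"
    proof (rule eq_vecI)
      fix i assume "i < dim_vec (\<sigma> \<cdot>\<^sub>v w)"
      then have i: "i < ?n" using cw by simp
      show "(parity_op d *\<^sub>v w) $ i = (\<sigma> \<cdot>\<^sub>v w) $ i"
        using i cw Zv[OF cw i] Pv[OF v i] by (simp add: w)
    qed (use cw cZ in auto)
    then show "w \<in> ?S" using cw by simp
  next
    fix v assume "v \<in> ?S"
    then have v: "v \<in> carrier_vec ?n" and ev: "parity_op d *\<^sub>v v = \<sigma> \<cdot>\<^sub>v v" by auto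
    have "?P *\<^sub>v v = v"
    proof (rule eq_vecI)
      fix i assume "i < dim_vec v"
      then have i: "i < ?n" using v by simp
      have "?p i * v $ i = (\<sigma> \<cdot>\<^sub>v v) $ i" using Zv[OF v i] ev by simp
      also have "\<dots> = \<sigma> * v $ i" using i v by simp
      finally have "?p i * v $ i = \<sigma> * v $ i" .
      show "(?P *\<^sub>v v) $ i = v $ i"
      proof (cases "?p i = \<sigma>")
        case True
        then show ?thesis using Pv[OF v i] by (simp only: simp_thms if_True mult_1)
      next
        case False
        then have "v $ i = 0"
          using \<open>?p i * v $ i = \<sigma> * v $ i\<close> by (simp only: mult_cancel_right simp_thms)
        then show ?thesis using Pv[OF v i] by (simp only: mult_zero_right)
      qed
    qed (use v in auto)
    then show "v \<in> (\<lambda>v. ?P *\<^sub>v v) ` carrier_vec ?n" using imageI[OF v, of "\<lambda>v. ?P *\<^sub>v v"] by (simp only:)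
  qed
  have idem: "?P * ?P = ?P"
  proof -
    have col: "col (P * P) j = col P j"
      if P: "P \<in> carrier_mat ?n ?n" and j: "j < ?n"
        and e: "\<And>v. v \<in> carrier_vec ?n \<Longrightarrow> P *\<^sub>v (P *\<^sub>v v) = P *\<^sub>v v" for P :: "complex mat" and j
    proof -
      have "col P j = P *\<^sub>v unit_vec ?n j" using col_mult2[OF P one_carrier_mat j] P j by simp
      then show ?thesis using col_mult2[OF P P j] e[of "unit_vec ?n j"] by simp
    qed
    have c: "?P \<in> carrier_mat ?n ?n" by simp
    have e: "?P *\<^sub>v (?P *\<^sub>v v) = ?P *\<^sub>v v" if v: "v \<in> carrier_vec ?n" for v
    proof (rule eq_vecI)
      have cv: "?P *\<^sub>v v \<in> carrier_vec ?n" by (rule mult_mat_vec_carrier[OF c v])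
      fix i assume "i < dim_vec (?P *\<^sub>v v)"
      then have i: "i < ?n" by simp
      show "(?P *\<^sub>v (?P *\<^sub>v v)) $ i = (?P *\<^sub>v v) $ i"
        by (simp only: Pv[OF cv i] Pv[OF v i] split: if_split) simp
    qed simp
    show ?thesis
    proof (rule mat_col_eqI)
      fix j assume "j < dim_col ?P"
      then have j: "j < ?n" by simp
      show "col (?P * ?P) j = col ?P j" by (rule col[OF c j e])
    qed simp_all
  qed
  have herm: "mat_adjoint ?P = ?P"
    by (rule eq_matI) (auto simp: mat_adjoint_def mat_of_rows_index)
  have P: "is_orth_projector ?n ?S ?P"
    unfolding is_orth_projector_def by (intro conjI mat_carrier idem herm range)
  then show "parity_projector d \<sigma> = ?P"
    unfolding parity_projector_def by (rule the_equality) (rule is_orth_projector_unique[OF _ P])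
  then show "is_orth_projector ?n ?S (parity_projector d \<sigma>)" using P by (simp only:)
qed


subsection \<open>Conditional states and the correlation test\<close>

text \<open>A two-element subset of the qubits is a pair \<open>(k1, k2)\<close> with \<open>k1 < k2 < d\<close>; an outcome on
  the remaining qubits is an extensional function on their set.\<close>

definition qubit_pairs :: "nat \<Rightarrow> (nat \<times> nat) set" where
  "qubit_pairs d = {(k1, k2). k1 < k2 \<and> k2 < d}"

definition outcomes :: "nat \<Rightarrow> nat \<times> nat \<Rightarrow> (nat \<Rightarrow> nat) set" where
  "outcomes d = (\<lambda>(k1, k2). PiE ({..<d} - {k1, k2}) (\<lambda>_. {0, 1}))"

text \<open>The amplitude of \<open>\<psi>\<close> at the basis vector with digits \<open>z\<close> off \<open>k\<close> and \<open>b1\<close>, \<open>b2\<close> at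
  \<open>k1\<close>, \<open>k2\<close>.\<close>

definition amplitude ::
  "nat \<Rightarrow> complex vec \<Rightarrow> nat \<times> nat \<Rightarrow> (nat \<Rightarrow> nat) \<Rightarrow> nat \<Rightarrow> nat \<Rightarrow> complex" where
  "amplitude d \<psi> = (\<lambda>(k1, k2) z b1 b2. \<psi> $ basis_index d (z(k1 := b1, k2 := b2)))"

definition branch_prob ::
  "nat \<Rightarrow> complex vec \<Rightarrow> nat \<times> nat \<Rightarrow> (nat \<Rightarrow> nat) \<Rightarrow> real" where
  "branch_prob d \<psi> k z = (\<Sum>b1\<in>{0, 1}. \<Sum>b2\<in>{0, 1}. (cmod (amplitude d \<psi> k z b1 b2))\<^sup>2)"

definition branches :: "nat \<Rightarrow> complex vec \<Rightarrow> nat \<times> nat \<Rightarrow> (nat \<Rightarrow> nat) set" where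
  "branches d \<psi> k = {z \<in> outcomes d k. branch_prob d \<psi> k z \<noteq> 0}"

text \<open>The normalized conditional state \<open>\<psi>\<^sub>z\<close> of the qubits \<open>k1\<close>, \<open>k2\<close>, given by its amplitudes
  in the basis \<open>|b1 b2\<rangle>\<close>.\<close>

definition cond_pair ::
  "nat \<Rightarrow> complex vec \<Rightarrow> nat \<times> nat \<Rightarrow> (nat \<Rightarrow> nat) \<Rightarrow> nat \<Rightarrow> nat \<Rightarrow> complex" where
  "cond_pair d \<psi> k z b1 b2 =
     amplitude d \<psi> k z b1 b2 / complex_of_real (sqrt (branch_prob d \<psi> k z))"

text \<open>The state of qubit \<open>k2\<close> after the X-measurement of \<open>k1\<close> with outcome \<open>s = \<plusminus>1\<close>, that is,
  \<open>\<surd>2 (\<langle>x| \<otimes> 1) |\<psi>\<^sub>z\<rangle>\<close>.  When \<open>\<psi>\<close> has definite parity, \<open>\<psi>\<^sub>z\<close> is of the form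
  \<open>\<alpha>|0 b\<rangle> + \<beta>|1 (1 - b)\<rangle>\<close> and this is the unit vector \<open>\<alpha>|b\<rangle> + s \<beta>|1 - b\<rangle>\<close>.\<close>

definition cond_single ::
  "nat \<Rightarrow> complex vec \<Rightarrow> nat \<times> nat \<Rightarrow> (nat \<Rightarrow> nat) \<Rightarrow> complex \<Rightarrow> complex vec" where
  "cond_single d \<psi> k z s =
     vec 2 (\<lambda>b. cond_pair d \<psi> k z 0 b + s * cond_pair d \<psi> k z 1 b)"

definition E_test :: "nat \<Rightarrow> complex vec \<Rightarrow> nat \<times> nat \<Rightarrow> complex mat" where
  "E_test d \<psi> k =
     msum (2 ^ d) (branches d \<psi> k \<times> {1, - 1})
       (\<lambda>(z, s). tensor_op d (\<lambda>j.
          if j = fst k then ketbra (x_ket s) (x_ket s)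
          else if j = snd k then ketbra (cond_single d \<psi> k z s) (cond_single d \<psi> k z s)
          else ketbra (unit_vec 2 (z j)) (unit_vec 2 (z j))))"

definition Omega0 :: "nat \<Rightarrow> complex vec \<Rightarrow> complex mat" where
  "Omega0 d \<psi> = (1 / of_nat (d choose 2)) \<cdot>\<^sub>m msum (2 ^ d) (qubit_pairs d) (E_test d \<psi>)"

definition Omega :: "nat \<Rightarrow> complex \<Rightarrow> complex vec \<Rightarrow> complex mat" where
  "Omega d \<sigma> \<psi> = (1 / 2) \<cdot>\<^sub>m (parity_projector d \<sigma> + Omega0 d \<psi>)"

definition L_op :: "nat \<Rightarrow> complex \<Rightarrow> complex vec \<Rightarrow> complex mat" where
  "L_op d \<sigma> \<psi> = parity_projector d \<sigma> * Omega0 d \<psi> * parity_projector d \<sigma>"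

text \<open>The vector \<open>|z\<rangle> \<otimes> |\<psi>\<^sub>z\<rangle>\<close>, with the second factor on the qubits \<open>k1\<close>, \<open>k2\<close>.\<close>

definition branch_vec ::
  "nat \<Rightarrow> complex vec \<Rightarrow> nat \<times> nat \<Rightarrow> (nat \<Rightarrow> nat) \<Rightarrow> complex vec" where
  "branch_vec d \<psi> k z =
     vec (2 ^ d) (\<lambda>x. if \<forall>j\<in>{..<d} - {fst k, snd k}. qbit x j = z j
                      then cond_pair d \<psi> k z (qbit x (fst k)) (qbit x (snd k)) else 0)"


subsection \<open>Spectral gap and sample complexity\<close>

text \<open>The eigenvalues in decreasing order with multiplicity; this is meaningful only for matrices
  with real spectrum, in particular for Hermitian ones.\<close>

definition eigvals_desc :: "complex mat \<Rightarrow> real list" where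
  "eigvals_desc A =
     (THE es. sorted_wrt (\<ge>) es \<and> char_poly A = (\<Prod>e\<leftarrow>es. [:- complex_of_real e, 1:]))"

lemma eigvals_desc_eqI:
  assumes "sorted_wrt (\<ge>) es" and "char_poly A = (\<Prod>e\<leftarrow>es. [:- complex_of_real e, 1:])"
  shows "eigvals_desc A = es"
  unfolding eigvals_desc_def
proof (rule the_equality)
  have ord: "order c (\<Prod>e\<leftarrow>fs. [:- complex_of_real e, 1:])
      = count (image_mset complex_of_real (mset fs)) c" for c fs
  proof (induction fs)
    case Nil
    then show ?case by simp
  next
    case (Cons f fs)
    have nz: "(\<Prod>e\<leftarrow>fs. [:- complex_of_real e, 1:]) \<noteq> 0"
      by (auto simp: prod_list_zero_iff)
    have "order c [:- complex_of_real f, 1:] = (if c = complex_of_real f then 1 else 0)"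
      using order_linear_power'[of c "- complex_of_real f" 0] by auto
    moreover have "order c ([:- complex_of_real f, 1:] * (\<Prod>e\<leftarrow>fs. [:- complex_of_real e, 1:]))
        = order c [:- complex_of_real f, 1:] + order c (\<Prod>e\<leftarrow>fs. [:- complex_of_real e, 1:])"
      by (rule order_mult, rule no_zero_divisors[OF _ nz]) simp
    ultimately show ?case using Cons by (simp only: list.map prod_list.Cons) auto
  qed
  fix fs assume fs: "sorted_wrt (\<ge>) fs \<and> char_poly A = (\<Prod>e\<leftarrow>fs. [:- complex_of_real e, 1:])"
  have "image_mset complex_of_real (mset fs) = image_mset complex_of_real (mset es)"
    by (rule multiset_eqI) (metis ord fs assms(2))
  then have "image_mset Re (image_mset complex_of_real (mset fs))
      = image_mset Re (image_mset complex_of_real (mset es))" by simp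
  then have "mset (rev fs) = mset (rev es)" by (simp add: image_mset.compositionality o_def)
  moreover have "sorted (rev fs)" "sorted (rev es)"
    using fs assms(1) by (auto simp: sorted_wrt_rev)
  ultimately have "rev fs = rev es" by (metis properties_for_sort sorted_sort_id)
  then show "fs = es" by simp
qed (use assms in blast)

definition spectral_gap :: "complex mat \<Rightarrow> real" where
  "spectral_gap A = 1 - eigvals_desc A ! 1"

definition sample_complexity :: "real \<Rightarrow> real \<Rightarrow> real \<Rightarrow> int" where
  "sample_complexity \<gamma> \<epsilon> \<delta> = \<lceil>ln \<delta> / ln (1 - \<gamma> * \<epsilon>)\<rceil>"

end

theory Submission
  imports Defs "HOL-Library.Nat_Bijection"
begin

text \<open>
  Identify computational basis states with subsets of the set of modes. A Gaussian vector
  \<open>\<psi>\<close> satisfies the Wick relations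
  \<open>\<Sum>\<^sub>j \<plusminus>\<psi>(x \<triangle> {j}) \<psi>(y \<triangle> {j}) = 0\<close>, the sum running over \<open>j \<in> x \<triangle> y\<close>: the
  operator \<open>\<Sum>\<^sub>l c\<^sub>l \<otimes> c\<^sub>l\<close> commutes with \<open>H \<otimes> 1 + 1 \<otimes> H\<close> and kills \<open>|x\<rangle> \<otimes> |x\<rangle>\<close>. The
  relations survive conditioning on occupation numbers. Multiplied by the conjugate of
  \<open>\<psi>(x) \<psi>(y)\<close> and summed, they give \<open>\<Sum>\<^sub>j \<bar>Cov(n\<^sub>i, n\<^sub>j)\<bar> \<le> Var(n\<^sub>i)\<close> (sum over \<open>j \<noteq> i\<close>) for the
  distribution \<open>\<bar>\<psi>\<bar>\<^sup>2\<close>, hence the correlation matrix of the occupation numbers has norm at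
  most 2, in every conditional state. This is the local-to-global input of an induction over
  the number of unmeasured modes: passing from \<open>n - 1\<close> to \<open>n\<close> modes loses the factor
  \<open>(n - 2) / (n - 2) = 1\<close>, so that \<open>\<Sum>\<^sub>k (1 - P\<^sub>k) \<ge> 1\<close> on the orthogonal complement of \<open>\<psi>\<close>,
  where \<open>P\<^sub>k\<close> projects onto the branches of the pair \<open>k\<close>. As \<open>L\<close> is the average of the
  \<open>P\<^sub>k\<close>, its gap is at least the inverse of the number of pairs.
\<close>

section \<open>Wick relations and the covariance bound\<close>

text \<open>Pairs are the natural stopping point. In a two-mode state of definite parity with both
  branches present, the occupation numbers determine each other, so their correlation matrix has
  norm exactly 2 and no smaller constant is available. Norm 2 leaves the factor n - 2 when one of n
  modes is conditioned on; n - 2 is also the number of modes outside a given pair, hence the number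
  of times each pair is counted. The two cancel at every level, and at n = 2 the factor is 0, so the
  induction starts there. The norm bound is Gershgorin: 1 from the diagonal and at most 1 from the
  rest of a row. A row of absolute values is within reach because each covariance is a difference of
  two squared moduli, a pairing amplitude minus a hopping amplitude, while their sums over j add up
  to the variance. For the protocol, vectors of the wrong parity are accepted with weight at most
  1/2, and those of the right parity orthogonal to the target lose half of what \<open>L_op\<close>
  loses; so the gap bound is half of that of \<open>L_op\<close>.\<close>

definition toggle :: "nat \<Rightarrow> nat set \<Rightarrow> nat set" where
  "toggle j x = (if j \<in> x then x - {j} else insert j x)"

text \<open>The eigenvalue at x of the Jordan-Wigner string, the product of Z over the modes below
  j. For x inside \<open>{..<d}\<close>, \<open>jw_sign d x\<close> is the parity of x, and it is
  used in this role later.\<close>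

definition jw_sign :: "nat \<Rightarrow> nat set \<Rightarrow> complex" where
  "jw_sign j x = (- 1) ^ card (x \<inter> {..<j})"

text \<open>In coordinates, the equation of pure spinors: the sum over l of c_l f (x) c_l f
  vanishes. Where x and y agree, the two Majorana operators of a mode cancel, which leaves the
  symmetric difference; see \<open>bilinear_invariant_self\<close>.\<close>

definition wick_relations :: "nat \<Rightarrow> (nat set \<Rightarrow> complex) \<Rightarrow> bool" where
  "wick_relations d f \<longleftrightarrow>
     (\<forall>x y. x \<subseteq> {..<d} \<longrightarrow> y \<subseteq> {..<d} \<longrightarrow>
        (\<Sum>j\<in>sym_diff x y. jw_sign j x * jw_sign j y * f (toggle j x) * f (toggle j y)) = 0)"

text \<open>The basis states compatible with finding the modes outside I in the configuration
  \<tau>. A conditional state is f restricted to this set, without normalization, so the relations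
  for f apply to it directly.\<close>

definition sector :: "nat set \<Rightarrow> nat set \<Rightarrow> nat set set" where
  "sector I \<tau> = {x. x - I = \<tau>}"

lemma in_toggle_iff: "i \<in> toggle j x \<longleftrightarrow> (if i = j then j \<notin> x else i \<in> x)"
  by (auto simp: toggle_def)

lemma toggle_toggle [simp]: "toggle j (toggle j x) = x"
  by (auto simp: toggle_def)

lemma toggle_commute: "toggle i (toggle j x) = toggle j (toggle i x)"
  by (auto simp: toggle_def)

lemma toggle_subset_iff: "j \<in> A \<Longrightarrow> toggle j x \<subseteq> A \<longleftrightarrow> x \<subseteq> A"
  by (auto simp: toggle_def)

lemma jw_sign_square [simp]: "jw_sign j x * jw_sign j x = 1"
  by (simp add: jw_sign_def flip: power_mult_distrib)

lemma jw_sign_square_left [simp]: "jw_sign j x * (jw_sign j x * a) = a"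
  by (simp flip: mult.assoc)

lemma cnj_jw_sign [simp]: "cnj (jw_sign j x) = jw_sign j x"
  by (simp add: jw_sign_def)

lemma jw_sign_toggle: "jw_sign j (toggle i x) = (if i < j then - jw_sign j x else jw_sign j x)"
proof (cases "i < j")
  case True
  show ?thesis
  proof (cases "i \<in> x")
    case in_x: True
    have "x \<inter> {..<j} = insert i (toggle i x \<inter> {..<j})"
      using True in_x by (auto simp: toggle_def)
    moreover have "i \<notin> toggle i x \<inter> {..<j}" using in_x by (auto simp: toggle_def)
    ultimately have "card (x \<inter> {..<j}) = Suc (card (toggle i x \<inter> {..<j}))" by simp
    then show ?thesis using True by (simp add: jw_sign_def)
  next
    case False
    have "toggle i x \<inter> {..<j} = insert i (x \<inter> {..<j})"
      using True False by (auto simp: toggle_def)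
    then show ?thesis using True False by (simp add: jw_sign_def)
  qed
next
  case False
  then have "toggle i x \<inter> {..<j} = x \<inter> {..<j}" by (auto simp: toggle_def)
  then show ?thesis using False by (simp add: jw_sign_def)
qed

lemma finite_sector: "finite I \<Longrightarrow> finite (sector I \<tau>)"
proof (rule finite_subset)
  show "sector I \<tau> \<subseteq> (\<lambda>A. \<tau> \<union> A) ` Pow I"
  proof
    fix x assume "x \<in> sector I \<tau>"
    then have "x = \<tau> \<union> (x \<inter> I)" by (auto simp: sector_def)
    then show "x \<in> (\<lambda>A. \<tau> \<union> A) ` Pow I" by blast
  qed
qed simp

lemma toggle_in_sector_iff: "j \<in> I \<Longrightarrow> toggle j x \<in> sector I \<tau> \<longleftrightarrow> x \<in> sector I \<tau>"
  by (auto simp: sector_def toggle_def)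

text \<open>The relation is taken at x and y with i toggled in both, which keeps their symmetric
  difference. Its term j = i is f x * f y up to sign; solving for it leaves double toggles, which
  stay inside any sector whose free modes contain i and j.\<close>

lemma wick_exchange:
  assumes wick: "wick_relations d f" and x: "x \<subseteq> {..<d}" and y: "y \<subseteq> {..<d}"
    and i: "i \<in> x" "i \<notin> y"
  shows "f x * f y = (\<Sum>j\<in>sym_diff x y - {i}.
    - (jw_sign i x * jw_sign j x) * (jw_sign i y * jw_sign j y)
      * f (toggle i (toggle j x)) * f (toggle i (toggle j y)))"
proof -
  let ?S = "sym_diff x y"
  let ?g = "\<lambda>j. jw_sign j x * jw_sign j y * f (toggle i (toggle j x)) * f (toggle i (toggle j y))"
  have S: "sym_diff (toggle i x) (toggle i y) = ?S" using i by (auto simp: toggle_def)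
  have fin: "finite ?S" using x y by (auto intro: finite_subset)
  have "toggle i x \<subseteq> {..<d}" "toggle i y \<subseteq> {..<d}"
    using x y i by (auto simp: toggle_def)
  then have "0 = (\<Sum>j\<in>?S. jw_sign j (toggle i x) * jw_sign j (toggle i y)
      * f (toggle j (toggle i x)) * f (toggle j (toggle i y)))"
    using wick[unfolded wick_relations_def, rule_format, of "toggle i x" "toggle i y"]
    by (simp only: S)
  also have "\<dots> = (\<Sum>j\<in>?S. ?g j)"
    by (intro sum.cong refl) (simp add: jw_sign_toggle toggle_commute[of i])
  also have "\<dots> = ?g i + (\<Sum>j\<in>?S - {i}. ?g j)"
    using fin i by (intro sum.remove) auto
  finally have "jw_sign i x * jw_sign i y * (f x * f y) = - (\<Sum>j\<in>?S - {i}. ?g j)"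
    by (simp add: algebra_simps eq_neg_iff_add_eq_0)
  then have "jw_sign i x * jw_sign i y * (jw_sign i x * jw_sign i y * (f x * f y))
      = jw_sign i x * jw_sign i y * - (\<Sum>j\<in>?S - {i}. ?g j)" by (simp only:)
  then have "f x * f y = - (jw_sign i x * jw_sign i y * (\<Sum>j\<in>?S - {i}. ?g j))"
    by (simp add: algebra_simps)
  then show ?thesis
    by (simp add: sum_distrib_left sum_negf algebra_simps)
qed

text \<open>For two independent draws x, y with weight \<open>(cmod (f x))\<^sup>2\<close> on the
  sector, the sums over Z are Cov(n_i, n_j) and Var(n_i), both times the square of the total weight.
  This form contains the products f x * f y that \<open>wick_exchange\<close> expands. In the
  expansion of the covariance with j only the exchange partner l = j survives in the real part, and
  its modulus is at most the contribution \<open>K j\<close> of the same partner to the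
  variance.\<close>

lemma wick_covariance_row_bound:
  assumes wick: "wick_relations d f" and I: "I \<subseteq> {..<d}" and \<tau>: "\<tau> \<subseteq> {..<d}" and i: "i \<in> I"
  defines "Z \<equiv> {(x, y) \<in> sector I \<tau> \<times> sector I \<tau>. i \<in> x \<and> i \<notin> y}"
  shows "(\<Sum>j\<in>I - {i}. \<bar>\<Sum>(x, y)\<in>Z. (of_bool (j \<in> x) - of_bool (j \<in> y)) * ((cmod (f x))\<^sup>2 * (cmod (f y))\<^sup>2)\<bar>)
    \<le> (\<Sum>(x, y)\<in>Z. (cmod (f x))\<^sup>2 * (cmod (f y))\<^sup>2)"
proof -
  let ?C = "sector I \<tau>"
  define ps where "ps l x = jw_sign i x * jw_sign l x" for l x
  define q where "q l x = toggle i (toggle l x)" for l x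
  define t where "t l x y = - (ps l x * ps l y) * cnj (f x * f y) * f (q l x) * f (q l y)" for l x y
  define \<pi> where "\<pi> x = (cmod (f x))\<^sup>2" for x
  define sg :: "nat \<Rightarrow> nat set \<Rightarrow> nat set \<Rightarrow> complex"
    where "sg j x y = of_bool (j \<in> x) - of_bool (j \<in> y)" for j x y
  have finI: "finite I" using I by (rule finite_subset) simp
  have finC: "finite ?C" using finI by (rule finite_sector)
  have finZ: "finite Z" unfolding Z_def using finC by (auto intro: finite_subset[of _ "?C \<times> ?C"])
  have C_sub: "x \<subseteq> {..<d}" if "x \<in> ?C" for x using that I \<tau> by (auto simp: sector_def)
  have qq: "q l (q l x) = x" for l x by (simp add: q_def toggle_commute[of l])
  have qC: "q l x \<in> ?C \<longleftrightarrow> x \<in> ?C" if "l \<in> I" for l x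
    using that i by (simp add: q_def toggle_in_sector_iff)
  have psq: "ps l (q l x) = - ps l x" if "l \<noteq> i" for l x
    using that by (auto simp: ps_def q_def jw_sign_toggle)
  have cnj_ps: "cnj (ps l x) = ps l x" for l x by (simp add: ps_def)
  have expand: "complex_of_real (\<pi> x * \<pi> y) = (\<Sum>l\<in>I - {i}. of_bool (l \<in> sym_diff x y) * t l x y)"
    if "(x, y) \<in> Z" for x y
  proof -
    have xy: "x \<in> ?C" "y \<in> ?C" "i \<in> x" "i \<notin> y" using that by (auto simp: Z_def)
    have sub: "sym_diff x y - {i} \<subseteq> I - {i}" using xy by (auto simp: sector_def)
    have "complex_of_real (\<pi> x * \<pi> y) = cnj (f x * f y) * (f x * f y)"
      by (simp add: \<pi>_def complex_norm_square mult_ac del: of_real_power)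
    also have "\<dots> = (\<Sum>l\<in>sym_diff x y - {i}. t l x y)"
      by (subst (2) wick_exchange[OF wick C_sub[OF xy(1)] C_sub[OF xy(2)] xy(3,4)])
        (simp add: sum_distrib_left t_def ps_def q_def algebra_simps)
    also have "\<dots> = (\<Sum>l\<in>sym_diff x y - {i}. of_bool (l \<in> sym_diff x y) * t l x y)"
      by (rule sum.cong) auto
    also have "\<dots> = (\<Sum>l\<in>I - {i}. of_bool (l \<in> sym_diff x y) * t l x y)"
      using finI sub by (intro sum.mono_neutral_left) auto
    finally show ?thesis .
  qed
  define T where "T j l = (\<Sum>(x, y)\<in>Z. sg j x y * of_bool (l \<in> sym_diff x y) * t l x y)" for j l
  \<comment> \<open>Replacing \<open>(x, y)\<close> by \<open>(q l y, q l x)\<close> conjugates \<open>t l x y\<close> and flips \<open>sg j x y\<close>.\<close>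
  have off_diag: "Re (T j l) = 0" if l: "l \<in> I" "l \<noteq> i" "l \<noteq> j" and j: "j \<noteq> i" for j l
  proof -
    have mem: "l \<in> q l x \<longleftrightarrow> l \<notin> x" "i \<in> q l x \<longleftrightarrow> i \<notin> x"
      "j \<in> q l x \<longleftrightarrow> j \<in> x" for x
      using l j by (auto simp: q_def in_toggle_iff)
    define h where "h a = (case a of (x, y) \<Rightarrow> if l \<in> sym_diff x y then (q l y, q l x) else (x, y))" for a
    have hh: "h (h a) = a" for a
      by (cases a) (auto simp: h_def qq mem)
    have hZ: "h a \<in> Z" if "a \<in> Z" for a
      using that l by (cases a) (auto simp: h_def mem qC Z_def)
    have "T j l = (\<Sum>(x, y)\<in>Z. - cnj (sg j x y * of_bool (l \<in> sym_diff x y) * t l x y))"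
      unfolding T_def
    proof (rule sum.reindex_bij_witness[where i = h and j = h], goal_cases)
      case (5 a)
      obtain x y where a: "a = (x, y)" by force
      have "sg j (q l y) (q l x) = - sg j x y" by (simp add: sg_def mem)
      moreover have "t l (q l y) (q l x) = cnj (t l x y)"
        using l by (simp add: t_def psq qq cnj_ps mult_ac)
      moreover have "l \<in> sym_diff (q l y) (q l x) \<longleftrightarrow> l \<in> sym_diff x y"
        by (auto simp: mem)
      moreover have "cnj (sg j x y) = sg j x y" by (simp add: sg_def)
      ultimately show ?case by (simp add: a h_def)
    qed (simp_all add: hh hZ)
    also have "\<dots> = - cnj (T j l)"
      by (simp add: T_def sum_negf split_def)
    finally have "Re (T j l) = Re (- cnj (T j l))" by (rule arg_cong)
    then show ?thesis by simp
  qed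
  \<comment> \<open>On a product the summand factors as minus g x times g y. Since
    \<open>q j\<close> exchanges A and B and flips the sign \<open>ps j\<close>, the sum of g over B
    is minus the conjugate of its sum over A, and a squared modulus results.\<close>
  have block: "(\<Sum>(x, y)\<in>A \<times> B. t j x y) = complex_of_real ((cmod (\<Sum>x\<in>A. ps j x * cnj (f x) * f (q j x)))\<^sup>2)"
    if "j \<noteq> i" and img: "\<And>x. x \<in> A \<Longrightarrow> q j x \<in> B" "\<And>y. y \<in> B \<Longrightarrow> q j y \<in> A" for j A B
  proof -
    let ?g = "\<lambda>x. ps j x * cnj (f x) * f (q j x)"
    have "(\<Sum>y\<in>B. ?g y) = (\<Sum>x\<in>A. - cnj (?g x))"
      by (rule sum.reindex_bij_witness[where i = "q j" and j = "q j"])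
        (use img that(1) in \<open>auto simp: qq psq cnj_ps\<close>)
    then have B: "(\<Sum>y\<in>B. ?g y) = - cnj (\<Sum>x\<in>A. ?g x)" by (simp add: sum_negf)
    have "(\<Sum>(x, y)\<in>A \<times> B. t j x y) = (\<Sum>x\<in>A. \<Sum>y\<in>B. - (?g x * ?g y))"
      by (simp add: sum.cartesian_product t_def algebra_simps)
    also have "\<dots> = - ((\<Sum>x\<in>A. ?g x) * (\<Sum>y\<in>B. ?g y))"
      by (simp add: sum_product sum_negf)
    finally show ?thesis by (simp add: B complex_norm_square del: of_real_power)
  qed
  define K where "K j = (\<Sum>(x, y)\<in>Z. of_bool (j \<in> sym_diff x y) * t j x y)" for j
  \<comment> \<open>The case of j in x is pair creation or annihilation at i and j, the case of j in
    y is hopping between them. Both sums are nonnegative reals; the sign \<open>sg\<close> makes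
    \<open>T j j\<close> their difference, whereas \<open>K j\<close> is their sum.\<close>
  have diag: "\<bar>Re (T j j)\<bar> \<le> Re (K j)" if j: "j \<in> I" "j \<noteq> i" for j
  proof -
    let ?A = "\<lambda>P. {x \<in> ?C. i \<in> x \<and> (j \<in> x \<longleftrightarrow> P)}"
    let ?B = "\<lambda>P. {x \<in> ?C. i \<notin> x \<and> (j \<in> x \<longleftrightarrow> P)}"
    let ?s = "\<lambda>P. (\<Sum>(x, y)\<in>?A P \<times> ?B (\<not> P). t j x y)"
    have s: "\<exists>r\<ge>0. ?s P = complex_of_real r" for P
    proof -
      have "?s P = complex_of_real ((cmod (\<Sum>x\<in>?A P. ps j x * cnj (f x) * f (q j x)))\<^sup>2)"
        by (rule block) (use j qC in \<open>auto simp: q_def in_toggle_iff\<close>)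
      then show ?thesis using zero_le_power2 by blast
    qed
    have split: "(\<Sum>(x, y)\<in>Z. c (x,y) * of_bool (j \<in> sym_diff x y) * t j x y)
        = (\<Sum>(x, y)\<in>?A True \<times> ?B False. c (x,y) * t j x y)
          + (\<Sum>(x, y)\<in>?A False \<times> ?B True. c (x,y) * t j x y)" (is "?l = ?r") for c
    proof -
      have "?l = (\<Sum>(x, y)\<in>?A True \<times> ?B False \<union> ?A False \<times> ?B True. c (x,y) * of_bool (j \<in> sym_diff x y) * t j x y)"
        by (rule sum.mono_neutral_right[OF finZ]) (auto simp: Z_def)
      also have "\<dots> = (\<Sum>(x, y)\<in>?A True \<times> ?B False \<union> ?A False \<times> ?B True. c (x,y) * t j x y)"
        by (rule sum.cong) auto
      also have "\<dots> = ?r"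
        by (rule sum.union_disjoint) (use finC in auto)
      finally show ?thesis .
    qed
    have "T j j = ?s True + (\<Sum>(x, y)\<in>?A False \<times> ?B True. - t j x y)"
      unfolding T_def using split[of "\<lambda>(x, y). sg j x y"]
      by (auto simp: sg_def intro!: arg_cong2[of _ _ _ _ "(+)"] sum.cong)
    then have T: "T j j = ?s True - ?s False"
      by (simp add: sum_negf split_def)
    have K: "K j = ?s True + ?s False"
      unfolding K_def using split[of "\<lambda>_. 1"] by simp
    obtain r1 r2 where "r1 \<ge> 0" "?s True = complex_of_real r1" "r2 \<ge> 0" "?s False = complex_of_real r2"
      using s[of True] s[of False] by blast
    then show ?thesis unfolding T K by simp
  qed
  have cov: "(\<Sum>(x, y)\<in>Z. (of_bool (j \<in> x) - of_bool (j \<in> y)) * (\<pi> x * \<pi> y)) = Re (T j j)"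
    (is "?c = _") if j: "j \<in> I - {i}" for j
  proof -
    have "complex_of_real ?c = (\<Sum>(x, y)\<in>Z. sg j x y * complex_of_real (\<pi> x * \<pi> y))"
      by (auto simp: sg_def split_def of_bool_def intro!: sum.cong)
    also have "\<dots> = (\<Sum>(x, y)\<in>Z. \<Sum>l\<in>I - {i}. sg j x y * of_bool (l \<in> sym_diff x y) * t l x y)"
      by (rule sum.cong) (auto simp: expand sum_distrib_left mult.assoc simp del: of_real_mult)
    also have "\<dots> = (\<Sum>l\<in>I - {i}. T j l)"
      unfolding T_def split_def by (rule sum.swap)
    finally have "Re (complex_of_real ?c) = Re (\<Sum>l\<in>I - {i}. T j l)" by (rule arg_cong)
    then have "?c = Re (\<Sum>l\<in>I - {i}. T j l)" by (simp only: Re_complex_of_real)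
    also have "\<dots> = (\<Sum>l\<in>I - {i}. Re (T j l))" by simp
    also have "\<dots> = (\<Sum>l\<in>{j}. Re (T j l))"
      using finI j off_diag by (intro sum.mono_neutral_right) auto
    finally show ?thesis by simp
  qed
  have "complex_of_real (\<Sum>(x, y)\<in>Z. \<pi> x * \<pi> y)
      = (\<Sum>(x, y)\<in>Z. complex_of_real (\<pi> x * \<pi> y))"
    by (simp add: split_def)
  also have "\<dots> = (\<Sum>(x, y)\<in>Z. \<Sum>l\<in>I - {i}. of_bool (l \<in> sym_diff x y) * t l x y)"
    by (rule sum.cong) (auto simp: expand simp del: of_real_mult)
  also have "\<dots> = (\<Sum>l\<in>I - {i}. K l)"
    unfolding K_def split_def by (rule sum.swap)
  finally have "Re (complex_of_real (\<Sum>(x, y)\<in>Z. \<pi> x * \<pi> y)) = Re (\<Sum>l\<in>I - {i}. K l)"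
    by (rule arg_cong)
  then have "(\<Sum>(x, y)\<in>Z. \<pi> x * \<pi> y) = (\<Sum>l\<in>I - {i}. Re (K l))"
    by (simp only: Re_complex_of_real Re_sum)
  moreover have "(\<Sum>j\<in>I - {i}. \<bar>\<Sum>(x, y)\<in>Z. (of_bool (j \<in> x) - of_bool (j \<in> y)) * (\<pi> x * \<pi> y)\<bar>)
      \<le> (\<Sum>l\<in>I - {i}. Re (K l))"
    by (rule sum_mono) (use cov diag in auto)
  ultimately show ?thesis by (simp add: \<pi>_def)
qed

section \<open>Tensorization of the projection defect\<close>

definition ip :: "('a \<Rightarrow> complex) \<Rightarrow> ('a \<Rightarrow> complex) \<Rightarrow> 'a set \<Rightarrow> complex" where
  "ip f g C = (\<Sum>x\<in>C. cnj (f x) * g x)"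

definition nsq :: "('a \<Rightarrow> complex) \<Rightarrow> 'a set \<Rightarrow> real" where
  "nsq f C = (\<Sum>x\<in>C. (cmod (f x))\<^sup>2)"

text \<open>If \<open>f\<close> vanishes on \<open>C\<close>, the quotient is 0 and the defect is the full squared norm of \<open>v\<close>:
  this is the contribution of a rejected branch.\<close>

definition defect :: "('a \<Rightarrow> complex) \<Rightarrow> ('a \<Rightarrow> complex) \<Rightarrow> 'a set \<Rightarrow> real" where
  "defect f v C = nsq v C - (cmod (ip f v C))\<^sup>2 / nsq f C"

lemma nsq_nonneg: "0 \<le> nsq f C"
  by (simp add: nsq_def sum_nonneg)

lemma ip_self: "ip f f C = complex_of_real (nsq f C)"
  by (simp add: ip_def nsq_def complex_norm_square mult.commute del: of_real_power)

lemma cnj_ip: "cnj (ip f g C) = ip g f C"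
  by (simp add: ip_def mult.commute)

lemma ip_add_right: "ip f (\<lambda>x. g x + h x) C = ip f g C + ip f h C"
  by (simp add: ip_def distrib_left sum.distrib)

lemma ip_scale_right: "ip f (\<lambda>x. c * g x) C = c * ip f g C"
  by (simp add: ip_def sum_distrib_left mult_ac)

lemma ip_scale_left: "ip (\<lambda>x. c * f x) g C = cnj c * ip f g C"
  by (simp add: ip_def sum_distrib_left mult_ac)

lemma ip_sum_right: "ip f (\<lambda>x. \<Sum>j\<in>J. g j x) C = (\<Sum>j\<in>J. ip f (g j) C)"
  unfolding ip_def sum_distrib_left by (rule sum.swap)

lemma ip_sum_left: "ip (\<lambda>x. \<Sum>j\<in>J. g j x) f C = (\<Sum>j\<in>J. ip (g j) f C)"
  unfolding ip_def cnj_sum sum_distrib_right by (rule sum.swap)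

lemma nsq_scale: "nsq (\<lambda>x. c * f x) C = (cmod c)\<^sup>2 * nsq f C"
  by (simp add: nsq_def norm_mult power_mult_distrib sum_distrib_left)

lemma cmod_add_sq: "(cmod (a + b))\<^sup>2 = (cmod a)\<^sup>2 + (cmod b)\<^sup>2 + 2 * Re (cnj a * b)"
  by (simp only: cmod_power2 complex_add_cnj) (simp add: power2_eq_square algebra_simps)

lemma nsq_add: "nsq (\<lambda>x. f x + g x) C = nsq f C + nsq g C + 2 * Re (ip f g C)"
  by (simp add: nsq_def ip_def cmod_add_sq sum.distrib sum_distrib_left)

lemma ip_eq_0:
  assumes "finite C" "nsq f C = 0"
  shows "ip f g C = 0"
  using assms by (simp add: nsq_def ip_def sum_nonneg_eq_0_iff)

lemma nsq_disjoint_union: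
  "finite C \<Longrightarrow> finite D \<Longrightarrow> C \<inter> D = {} \<Longrightarrow> nsq f (C \<union> D) = nsq f C + nsq f D"
  by (simp add: nsq_def sum.union_disjoint)

lemma ip_disjoint_union:
  "finite C \<Longrightarrow> finite D \<Longrightarrow> C \<inter> D = {} \<Longrightarrow> ip f g (C \<union> D) = ip f g C + ip f g D"
  by (simp add: ip_def sum.union_disjoint)

text \<open>Bessel's inequality with constant 2. By AM-GM and the symmetry of the Gram matrix
  (Schur's test), the row bound gives \<open>nsq w C \<le> 2 * S\<close> for the combination w with
  coefficients \<open>a j\<close>, while the inner product of w with v is S. As w is orthogonal to
  f, expanding the squared norm of v minus its f-component minus w / 2 yields S at most defect + S /
  2. A \<open>u j\<close> of norm zero contributes nothing, since its quotient is 0.\<close>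

lemma near_orthogonal_bessel:
  fixes u :: "'b \<Rightarrow> 'a \<Rightarrow> complex"
  assumes C: "finite C" and J: "finite J"
    and orth: "\<And>j. j \<in> J \<Longrightarrow> ip f (u j) C = 0"
    and row: "\<And>i. i \<in> J \<Longrightarrow> (\<Sum>j\<in>J. cmod (ip (u i) (u j) C)) \<le> 2 * nsq (u i) C"
  shows "(\<Sum>j\<in>J. (cmod (ip (u j) v C))\<^sup>2 / nsq (u j) C) \<le> 2 * defect f v C"
proof -
  define a where "a j = ip (u j) v C / nsq (u j) C" for j
  define w where "w x = (\<Sum>j\<in>J. a j * u j x)" for x
  define S where "S = (\<Sum>j\<in>J. (cmod (ip (u j) v C))\<^sup>2 / nsq (u j) C)"
  define g where "g i j = cmod (ip (u i) (u j) C)" for i j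
  have g_sym: "g i j = g j i" for i j
    unfolding g_def by (metis cnj_ip complex_mod_cnj)
  have cnj_sq: "cnj z * z = complex_of_real ((cmod z)\<^sup>2)" for z
    by (metis complex_norm_square mult.commute)
  have "ip w v C = (\<Sum>j\<in>J. cnj (a j) * ip (u j) v C)"
    unfolding w_def by (simp add: ip_sum_left ip_scale_left)
  also have "\<dots> = (\<Sum>j\<in>J. complex_of_real ((cmod (ip (u j) v C))\<^sup>2 / nsq (u j) C))"
    by (rule sum.cong) (simp_all only: a_def complex_cnj_divide complex_cnj_complex_of_real
        times_divide_eq_left cnj_sq of_real_divide)
  finally have wv: "ip w v C = complex_of_real S" by (simp add: S_def)
  then have vw: "ip v w C = complex_of_real S" by (metis cnj_ip complex_cnj_complex_of_real)
  have fw: "ip f w C = 0"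
    unfolding w_def by (simp add: ip_sum_right ip_scale_right orth)
  have "nsq w C = cmod (ip w w C)" by (simp add: ip_self nsq_nonneg)
  also have "ip w w C = (\<Sum>i\<in>J. \<Sum>j\<in>J. cnj (a i) * (a j * ip (u i) (u j) C))"
    unfolding w_def by (simp add: ip_sum_left ip_sum_right ip_scale_left ip_scale_right sum_distrib_left)
  also have "cmod \<dots> \<le> (\<Sum>i\<in>J. \<Sum>j\<in>J. cmod (cnj (a i) * (a j * ip (u i) (u j) C)))"
    by (intro order_trans[OF norm_sum] sum_mono) simp
  also have "\<dots> \<le> (\<Sum>i\<in>J. \<Sum>j\<in>J. (cmod (a i))\<^sup>2 * g i j / 2 + (cmod (a j))\<^sup>2 * g i j / 2)"
  proof (intro sum_mono)
    fix i j
    have "2 * (cmod (a i) * cmod (a j)) \<le> (cmod (a i))\<^sup>2 + (cmod (a j))\<^sup>2"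
      using sum_squares_bound[of "cmod (a i)" "cmod (a j)"] by (simp add: mult.assoc)
    then have "2 * (cmod (a i) * cmod (a j)) * g i j \<le> ((cmod (a i))\<^sup>2 + (cmod (a j))\<^sup>2) * g i j"
      by (rule mult_right_mono) (simp add: g_def)
    then show "cmod (cnj (a i) * (a j * ip (u i) (u j) C))
        \<le> (cmod (a i))\<^sup>2 * g i j / 2 + (cmod (a j))\<^sup>2 * g i j / 2"
      by (simp add: norm_mult g_def algebra_simps)
  qed
  also have "\<dots> = (\<Sum>i\<in>J. \<Sum>j\<in>J. (cmod (a i))\<^sup>2 * g i j / 2) + (\<Sum>i\<in>J. \<Sum>j\<in>J. (cmod (a j))\<^sup>2 * g i j / 2)"
    by (simp add: sum.distrib)
  also have "(\<Sum>i\<in>J. \<Sum>j\<in>J. (cmod (a j))\<^sup>2 * g i j / 2) = (\<Sum>i\<in>J. \<Sum>j\<in>J. (cmod (a i))\<^sup>2 * g i j / 2)"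
    by (subst sum.swap) (simp add: g_sym)
  also have "(\<Sum>i\<in>J. \<Sum>j\<in>J. (cmod (a i))\<^sup>2 * g i j / 2) + (\<Sum>i\<in>J. \<Sum>j\<in>J. (cmod (a i))\<^sup>2 * g i j / 2)
      = (\<Sum>i\<in>J. (cmod (a i))\<^sup>2 * (\<Sum>j\<in>J. g i j))"
    unfolding sum.distrib[symmetric] sum_distrib_left by (intro sum.cong refl) simp
  also have "\<dots> \<le> (\<Sum>i\<in>J. (cmod (a i))\<^sup>2 * (2 * nsq (u i) C))"
    by (intro sum_mono mult_left_mono) (simp_all add: row g_def)
  also have "\<dots> = 2 * S"
    unfolding S_def sum_distrib_left
    by (intro sum.cong refl) (simp add: a_def norm_divide nsq_nonneg power2_eq_square)
  finally have w_le: "nsq w C \<le> 2 * S" .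
  define c where "c = ip f v C / nsq f C"
  have c: "(cmod c)\<^sup>2 * nsq f C = (cmod (ip f v C))\<^sup>2 / nsq f C"
    by (simp add: c_def norm_divide nsq_nonneg power2_eq_square)
  have "Re (ip v (\<lambda>x. - c * f x) C) = - Re (c * cnj (ip f v C))"
    by (simp add: cnj_ip ip_scale_right[of v "- c"] del: mult_minus_left)
  also have "c * cnj (ip f v C) = complex_of_real ((cmod (ip f v C))\<^sup>2 / nsq f C)"
    unfolding c_def using cnj_sq[of "ip f v C"] by (simp add: mult.commute)
  finally have vcf: "Re (ip v (\<lambda>x. - c * f x) C) = - ((cmod (ip f v C))\<^sup>2 / nsq f C)" by simp
  \<comment> \<open>Half of \<open>w\<close> is the optimal multiple, given that \<open>nsq w C \<le> 2 * S\<close>.\<close>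
  have "0 \<le> nsq (\<lambda>x. v x + (- c * f x + (- 1 / 2) * w x)) C" by (rule nsq_nonneg)
  also have "\<dots> = nsq v C + ((cmod c)\<^sup>2 * nsq f C + nsq w C / 4) + 2 * (Re (ip v (\<lambda>x. - c * f x) C) - S / 2)"
  proof -
    have "ip (\<lambda>x. - c * f x) (\<lambda>x. (- 1 / 2) * w x) C = 0"
      by (simp only: ip_scale_left ip_scale_right fw) simp
    moreover have "nsq (\<lambda>x. (- 1 / 2) * w x) C = nsq w C / 4"
      by (simp only: nsq_scale) (simp add: norm_divide power2_eq_square)
    moreover have "ip v (\<lambda>x. (- 1 / 2) * w x) C = - complex_of_real (S / 2)"
      by (simp only: ip_scale_right vw) simp
    ultimately show ?thesis
      by (simp only: nsq_add ip_add_right nsq_scale[of "- c"]) simp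
  qed
  also have "\<dots> = defect f v C + nsq w C / 4 - S"
    unfolding c vcf defect_def by simp
  finally show ?thesis using w_le unfolding S_def by simp
qed

text \<open>Cutting a block into two halves enlarges the span of f by one direction: p1 times f on
  the first half and - p0 times f on the second, which is orthogonal to f and has squared norm (p0 +
  p1) * p0 * p1. The last summand is the squared component along it. The implications for p0 = 0 and
  p1 = 0 make the default value of division by zero harmless.\<close>

lemma two_block_defect:
  fixes m0 m1 :: complex and p0 p1 :: real
  assumes "0 \<le> p0" "0 \<le> p1" "p0 = 0 \<Longrightarrow> m0 = 0" "p1 = 0 \<Longrightarrow> m1 = 0"
  shows "(cmod m0)\<^sup>2 / p0 + (cmod m1)\<^sup>2 / p1
    = (cmod (m0 + m1))\<^sup>2 / (p0 + p1) + (cmod (p1 * m0 - p0 * m1))\<^sup>2 / ((p0 + p1) * p0 * p1)"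
proof (cases "p0 = 0 \<or> p1 = 0")
  case True
  then show ?thesis using assms by auto
next
  case False
  then have p: "p0 > 0" "p1 > 0" using assms by auto
  define R where "R = Re (cnj m0 * m1)"
  have 1: "(cmod (m0 + m1))\<^sup>2 = (cmod m0)\<^sup>2 + (cmod m1)\<^sup>2 + 2 * R"
    by (simp add: cmod_add_sq R_def)
  have "(cmod (p1 * m0 - p0 * m1))\<^sup>2 = (cmod (p1 * m0 + (- p0) * m1))\<^sup>2" by simp
  also have "\<dots> = p1\<^sup>2 * (cmod m0)\<^sup>2 + p0\<^sup>2 * (cmod m1)\<^sup>2 - 2 * p0 * p1 * R"
    unfolding cmod_add_sq R_def by (simp add: norm_mult power_mult_distrib algebra_simps)
  finally have 2: "(cmod (p1 * m0 - p0 * m1))\<^sup>2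
      = p1\<^sup>2 * (cmod m0)\<^sup>2 + p0\<^sup>2 * (cmod m1)\<^sup>2 - 2 * p0 * p1 * R" .
  have "p0 + p1 \<noteq> 0" using p by simp
  then show ?thesis unfolding 1 2 using p
    by (simp add: divide_simps) (simp add: power2_eq_square algebra_simps)
qed

lemma of_bool_complex: "complex_of_real (of_bool P) = of_bool P"
  by (simp add: of_bool_def)

lemma cnj_of_bool: "cnj (of_bool P) = of_bool P"
  by (simp add: of_bool_def)

lemma sector_remove_out:
  assumes "j \<in> I" "\<tau> \<inter> I = {}"
  shows "sector (I - {j}) \<tau> = {x \<in> sector I \<tau>. j \<notin> x}"
  using assms by (auto simp: sector_def)

lemma sector_remove_in:
  assumes "j \<in> I" "\<tau> \<inter> I = {}"
  shows "sector (I - {j}) (insert j \<tau>) = {x \<in> sector I \<tau>. j \<in> x}"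
  using assms by (auto simp: sector_def)

text \<open>Conditioning on mode j removes from the defect exactly the squared component of v along
  \<open>u j\<close>. The sum of these losses over j is at most twice the defect by
  \<open>near_orthogonal_bessel\<close>, whence the 2 in the factor.\<close>

lemma defect_conditioning_step:
  assumes wick: "wick_relations d f" and I: "I \<subseteq> {..<d}" and \<tau>: "\<tau> \<subseteq> {..<d}" and disj: "\<tau> \<inter> I = {}"
  shows "(real (card I) - 2) * defect f v (sector I \<tau>)
    \<le> (\<Sum>j\<in>I. defect f v (sector (I - {j}) \<tau>) + defect f v (sector (I - {j}) (insert j \<tau>)))"
proof -
  define C where "C = sector I \<tau>"
  define C0 where "C0 j = {x \<in> C. j \<notin> x}" for j
  define C1 where "C1 j = {x \<in> C. j \<in> x}" for j
  have finI: "finite I" using I by (rule finite_subset) simp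
  have finC: "finite C" unfolding C_def by (rule finite_sector[OF finI])
  have finC': "finite (C0 j)" "finite (C1 j)" for j using finC by (auto simp: C0_def C1_def)
  have un: "C = C0 j \<union> C1 j" and dis: "C0 j \<inter> C1 j = {}" for j by (auto simp: C0_def C1_def)
  define \<pi> where "\<pi> x = (cmod (f x))\<^sup>2" for x
  define p where "p = nsq f C"
  define p0 where "p0 j = nsq f (C0 j)" for j
  define p1 where "p1 j = nsq f (C1 j)" for j
  define p11 where "p11 i j = nsq f {x \<in> C. i \<in> x \<and> j \<in> x}" for i j
  have p: "p = p0 j + p1 j" for j
    unfolding p_def p0_def p1_def by (subst un[of j]) (rule nsq_disjoint_union[OF finC' dis])
  have m: "ip f v C = ip f v (C0 j) + ip f v (C1 j)" for j
    by (subst un[of j]) (rule ip_disjoint_union[OF finC' dis])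
  \<comment> \<open>Up to the factor - p, this is f times the centred occupation number of j.
    Centring makes it orthogonal to f, its Gram matrix is a multiple of the covariance matrix, and
    on the two halves it equals p1 f and - p0 f, the direction found in
    \<open>two_block_defect\<close>.\<close>
  define u where "u j x = complex_of_real (p1 j - p * of_bool (j \<in> x)) * f x" for j x
  have sum_bool: "(\<Sum>x\<in>C. of_bool (P x) * h x) = sum h {x \<in> C. P x}"
    for P and h :: "_ \<Rightarrow> 'c::semiring_1"
    using finC by (auto simp: of_bool_def if_distrib[of "\<lambda>b. b * _"] sum.inter_filter cong: if_cong)
  have G: "ip (u i) (u j) C = complex_of_real (p * (p * p11 i j - p1 i * p1 j))" for i j
  proof -
    have "ip (u i) (u j) C
        = complex_of_real (\<Sum>x\<in>C. (p1 i - p * of_bool (i \<in> x)) * (p1 j - p * of_bool (j \<in> x)) * \<pi> x)"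
      by (simp add: ip_def u_def \<pi>_def complex_norm_square mult_ac del: of_real_power)
    also have "(\<Sum>x\<in>C. (p1 i - p * of_bool (i \<in> x)) * (p1 j - p * of_bool (j \<in> x)) * \<pi> x)
        = p1 i * p1 j * (\<Sum>x\<in>C. \<pi> x) - p * p1 i * (\<Sum>x\<in>C. of_bool (j \<in> x) * \<pi> x)
          - p * p1 j * (\<Sum>x\<in>C. of_bool (i \<in> x) * \<pi> x)
          + p * p * (\<Sum>x\<in>C. of_bool (i \<in> x \<and> j \<in> x) * \<pi> x)"
      by (simp add: sum_distrib_left of_bool_conj algebra_simps flip: sum.distrib sum_subtractf)
    also have "\<dots> = p * (p * p11 i j - p1 i * p1 j)"
      unfolding sum_bool by (simp add: p_def p1_def p11_def C1_def nsq_def \<pi>_def algebra_simps)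
    finally show ?thesis .
  qed
  have p11_self: "p11 j j = p1 j" for j by (simp add: p11_def p1_def C1_def)
  have Gjj: "nsq (u j) C = p * (p0 j * p1 j)" for j
  proof -
    have "complex_of_real (nsq (u j) C) = complex_of_real (p * (p * p11 j j - p1 j * p1 j))"
      unfolding ip_self[symmetric] by (rule G)
    then have "nsq (u j) C = p * (p * p11 j j - p1 j * p1 j)" by (simp only: of_real_eq_iff)
    then show ?thesis unfolding p11_self using p[of j] by (simp add: algebra_simps)
  qed
  \<comment> \<open>The Wick bound controls the off-diagonal part of the row by the diagonal entry;
    adding the diagonal entry itself gives the constant 2.\<close>
  have row: "(\<Sum>j\<in>I. cmod (ip (u i) (u j) C)) \<le> 2 * nsq (u i) C" if i: "i \<in> I" for i
  proof -
    let ?Z = "{(x, y) \<in> sector I \<tau> \<times> sector I \<tau>. i \<in> x \<and> i \<notin> y}"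
    have Z: "?Z = C1 i \<times> C0 i" by (auto simp: C_def C0_def C1_def)
    have var: "(\<Sum>(x, y)\<in>?Z. \<pi> x * \<pi> y) = p1 i * p0 i"
      unfolding Z by (simp add: sum.cartesian_product[symmetric] sum_product p1_def p0_def nsq_def \<pi>_def)
    have cov: "(\<Sum>(x, y)\<in>?Z. (of_bool (j \<in> x) - of_bool (j \<in> y)) * (\<pi> x * \<pi> y)) = p * p11 i j - p1 i * p1 j"
      for j
    proof -
      have 1: "(\<Sum>x\<in>C1 i. of_bool (j \<in> x) * \<pi> x) = p11 i j"
      proof -
        have "(\<Sum>x\<in>C1 i. of_bool (j \<in> x) * \<pi> x) = (\<Sum>x\<in>C. of_bool (i \<in> x) * (of_bool (j \<in> x) * \<pi> x))"
          by (simp add: sum_bool C1_def)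
        also have "\<dots> = (\<Sum>x\<in>C. of_bool (i \<in> x \<and> j \<in> x) * \<pi> x)" by (simp add: of_bool_conj mult.assoc)
        finally show ?thesis unfolding sum_bool by (simp add: p11_def nsq_def \<pi>_def)
      qed
      have "(\<Sum>x\<in>C1 i. of_bool (j \<in> x) * \<pi> x) + (\<Sum>x\<in>C0 i. of_bool (j \<in> x) * \<pi> x)
          = (\<Sum>x\<in>C. of_bool (j \<in> x) * \<pi> x)"
        by (subst un[of i], subst sum.union_disjoint) (use finC' dis in auto)
      then have 2: "(\<Sum>x\<in>C0 i. of_bool (j \<in> x) * \<pi> x) = p1 j - p11 i j"
        unfolding 1 sum_bool by (simp add: p1_def C1_def nsq_def \<pi>_def)
      have "(\<Sum>(x, y)\<in>?Z. (of_bool (j \<in> x) - of_bool (j \<in> y)) * (\<pi> x * \<pi> y))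
          = (\<Sum>x\<in>C1 i. \<Sum>y\<in>C0 i. (of_bool (j \<in> x) * \<pi> x) * \<pi> y - \<pi> x * (of_bool (j \<in> y) * \<pi> y))"
        unfolding Z by (simp add: sum.cartesian_product algebra_simps)
      also have "\<dots> = (\<Sum>x\<in>C1 i. of_bool (j \<in> x) * \<pi> x) * (\<Sum>y\<in>C0 i. \<pi> y)
          - (\<Sum>x\<in>C1 i. \<pi> x) * (\<Sum>y\<in>C0 i. of_bool (j \<in> y) * \<pi> y)"
        by (simp add: sum_product sum_subtractf)
      also have "\<dots> = p11 i j * p0 i - p1 i * (p1 j - p11 i j)"
        unfolding 1 2 by (simp add: p0_def p1_def nsq_def \<pi>_def)
      finally show ?thesis using p[of i] by (simp add: algebra_simps)
    qed
    have p_nonneg: "p \<ge> 0" by (simp add: p_def nsq_nonneg)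
    have "(\<Sum>j\<in>I - {i}. \<bar>p * p11 i j - p1 i * p1 j\<bar>) \<le> p1 i * p0 i"
      using wick_covariance_row_bound[OF wick I \<tau> i] unfolding \<pi>_def[symmetric] cov var .
    then have "p * (\<Sum>j\<in>I - {i}. \<bar>p * p11 i j - p1 i * p1 j\<bar>) \<le> p * (p1 i * p0 i)"
      using p_nonneg by (rule mult_left_mono)
    then have "(\<Sum>j\<in>I - {i}. cmod (ip (u i) (u j) C)) \<le> nsq (u i) C"
      unfolding G Gjj norm_of_real using p_nonneg by (simp add: abs_mult sum_distrib_left mult_ac)
    moreover have "cmod (ip (u i) (u i) C) = nsq (u i) C" by (simp add: ip_self nsq_nonneg)
    ultimately show ?thesis using finI i by (simp add: sum.remove)
  qed
  have orth: "ip f (u j) C = 0" for j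
  proof -
    have "ip f (u j) C = complex_of_real (\<Sum>x\<in>C. (p1 j - p * of_bool (j \<in> x)) * \<pi> x)"
      by (simp add: ip_def u_def \<pi>_def complex_norm_square mult_ac del: of_real_power)
    also have "(\<Sum>x\<in>C. (p1 j - p * of_bool (j \<in> x)) * \<pi> x)
        = p1 j * (\<Sum>x\<in>C. \<pi> x) - p * (\<Sum>x\<in>C. of_bool (j \<in> x) * \<pi> x)"
      by (simp add: sum_distrib_left algebra_simps flip: sum_subtractf)
    also have "\<dots> = 0" unfolding sum_bool by (simp add: p_def p1_def C1_def nsq_def \<pi>_def)
    finally show ?thesis by simp
  qed
  have bessel: "(\<Sum>j\<in>I. (cmod (ip (u j) v C))\<^sup>2 / nsq (u j) C) \<le> 2 * defect f v C"
    by (rule near_orthogonal_bessel) (use finC finI orth row in auto)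
  have step: "defect f v (C0 j) + defect f v (C1 j)
      = defect f v C - (cmod (ip (u j) v C))\<^sup>2 / nsq (u j) C" for j
  proof -
    have "ip (u j) v C = p1 j * ip f v C - p * (\<Sum>x\<in>C. of_bool (j \<in> x) * (cnj (f x) * v x))"
      by (simp add: ip_def u_def of_bool_complex cnj_of_bool sum_distrib_left algebra_simps flip: sum_subtractf)
    also have "\<dots> = p1 j * ip f v C - p * ip f v (C1 j)"
      unfolding sum_bool by (simp add: ip_def C1_def)
    also have "\<dots> = p1 j * ip f v (C0 j) - p0 j * ip f v (C1 j)"
      using p[of j] by (simp add: m[of j] algebra_simps)
    finally have ip: "ip (u j) v C = p1 j * ip f v (C0 j) - p0 j * ip f v (C1 j)" .
    have "(cmod (ip f v (C0 j)))\<^sup>2 / p0 j + (cmod (ip f v (C1 j)))\<^sup>2 / p1 j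
      = (cmod (ip f v (C0 j) + ip f v (C1 j)))\<^sup>2 / (p0 j + p1 j)
        + (cmod (p1 j * ip f v (C0 j) - p0 j * ip f v (C1 j)))\<^sup>2 / ((p0 j + p1 j) * p0 j * p1 j)"
      by (rule two_block_defect) (auto simp: p0_def p1_def nsq_nonneg ip_eq_0 finC')
    moreover have "nsq v C = nsq v (C0 j) + nsq v (C1 j)"
      by (subst un[of j]) (rule nsq_disjoint_union[OF finC' dis])
    ultimately show ?thesis
      unfolding defect_def ip Gjj m[of j] p_def[symmetric] p0_def[symmetric] p1_def[symmetric]
      by (simp add: p[of j, symmetric] mult.assoc)
  qed
  have "(real (card I) - 2) * defect f v C
      \<le> (\<Sum>j\<in>I. defect f v C - (cmod (ip (u j) v C))\<^sup>2 / nsq (u j) C)"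
    using bessel by (simp add: sum_subtractf algebra_simps)
  also have "\<dots> = (\<Sum>j\<in>I. defect f v (sector (I - {j}) \<tau>) + defect f v (sector (I - {j}) (insert j \<tau>)))"
    by (rule sum.cong) (simp_all only: sector_remove_in[OF _ disj] sector_remove_out[OF _ disj]
        C_def[symmetric] C0_def[symmetric] C1_def[symmetric] step)
  finally show ?thesis by (simp add: C_def)
qed

text \<open>The conditioning step is followed by the induction hypothesis for each
  \<open>I - {j}\<close>. After exchanging the sums, a pair k occurs once for every j outside k,
  that is \<open>card I - 2\<close> times, and this positive factor cancels against the one on the
  left once \<open>card I\<close> exceeds 2.\<close>

lemma defect_pair_tensorization:
  assumes wick: "wick_relations d f" and I: "I \<subseteq> {..<d}" and \<tau>: "\<tau> \<subseteq> {..<d}" and disj: "\<tau> \<inter> I = {}"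
    and card: "2 \<le> card I"
  shows "defect f v (sector I \<tau>)
    \<le> (\<Sum>k | k \<subseteq> I \<and> card k = 2. \<Sum>A\<in>Pow (I - k). defect f v (sector k (\<tau> \<union> A)))"
  using assms(2-)
proof (induction "card I" arbitrary: I \<tau>)
  case 0
  then show ?case by simp
next
  case (Suc n)
  have finI: "finite I" using Suc.prems(1) by (rule finite_subset) simp
  let ?W = "\<lambda>k I \<tau>. \<Sum>A\<in>Pow (I - k). defect f v (sector k (\<tau> \<union> A))"
  let ?P = "\<lambda>I. {k. k \<subseteq> I \<and> card k = 2}"
  have finP: "finite (?P I)" if "finite I" for I :: "nat set"
    using that by (auto intro: finite_subset[of _ "Pow I"])
  show ?case
  proof (cases "card I = 2")
    case True
    then have "?P I = {I}" using card_subset_eq[OF finI] by auto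
    then show ?thesis by simp
  next
    case False
    with Suc have n: "2 \<le> n" by simp
    \<comment> \<open>Outcomes outside k are sorted by the occupation of j; those containing j move
      it into the fixed configuration \<tau>.\<close>
    have split: "?W k I \<tau> = ?W k (I - {j}) \<tau> + ?W k (I - {j}) (insert j \<tau>)"
      if j: "j \<in> I - k" for j k
    proof -
      let ?J = "I - {j} - k"
      have J: "I - k = insert j ?J" "j \<notin> ?J" using j by auto
      have "?W k I \<tau> = (\<Sum>A\<in>Pow ?J \<union> insert j ` Pow ?J. defect f v (sector k (\<tau> \<union> A)))"
        by (subst J(1)) (simp only: Pow_insert)
      also have "\<dots> = (\<Sum>A\<in>Pow ?J. defect f v (sector k (\<tau> \<union> A)))
          + (\<Sum>A\<in>insert j ` Pow ?J. defect f v (sector k (\<tau> \<union> A)))"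
        by (rule sum.union_disjoint) (use finI in auto)
      also have "(\<Sum>A\<in>insert j ` Pow ?J. defect f v (sector k (\<tau> \<union> A)))
          = (\<Sum>A\<in>Pow ?J. defect f v (sector k (insert j \<tau> \<union> A)))"
        by (subst sum.reindex) (auto simp: inj_on_def)
      finally show ?thesis .
    qed
    have IH: "defect f v (sector (I - {j}) \<sigma>) \<le> (\<Sum>k\<in>?P (I - {j}). ?W k (I - {j}) \<sigma>)"
      if "j \<in> I" "\<sigma> \<in> {\<tau>, insert j \<tau>}" for j \<sigma>
      by (rule Suc.hyps(1)) (use that Suc.hyps(2) Suc.prems n finI in auto)
    have "(real (card I) - 2) * defect f v (sector I \<tau>)
        \<le> (\<Sum>j\<in>I. defect f v (sector (I - {j}) \<tau>) + defect f v (sector (I - {j}) (insert j \<tau>)))"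
      by (rule defect_conditioning_step[OF wick Suc.prems(1-3)])
    also have "\<dots> \<le> (\<Sum>j\<in>I. (\<Sum>k\<in>?P (I - {j}). ?W k (I - {j}) \<tau>) + (\<Sum>k\<in>?P (I - {j}). ?W k (I - {j}) (insert j \<tau>)))"
      by (intro sum_mono add_mono IH) auto
    also have "\<dots> = (\<Sum>j\<in>I. \<Sum>k\<in>?P (I - {j}). ?W k I \<tau>)"
    proof (rule sum.cong[OF refl])
      fix j
      have "(\<Sum>k\<in>?P (I - {j}). ?W k I \<tau>)
          = (\<Sum>k\<in>?P (I - {j}). ?W k (I - {j}) \<tau> + ?W k (I - {j}) (insert j \<tau>))"
        if "j \<in> I"
        by (rule sum.cong[OF refl], rule split) (use that in blast)
      then show "(\<Sum>k\<in>?P (I - {j}). ?W k (I - {j}) \<tau>)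
          + (\<Sum>k\<in>?P (I - {j}). ?W k (I - {j}) (insert j \<tau>)) = (\<Sum>k\<in>?P (I - {j}). ?W k I \<tau>)"
        if "j \<in> I"
        using that by (simp only: sum.distrib)
    qed
    also have "\<dots> = (\<Sum>j\<in>I. \<Sum>k | k \<in> ?P I \<and> j \<notin> k. ?W k I \<tau>)"
      by (intro sum.cong refl) auto
    also have "\<dots> = (\<Sum>k\<in>?P I. \<Sum>j | j \<in> I \<and> j \<notin> k. ?W k I \<tau>)"
      by (rule sum.swap_restrict[OF finI finP[OF finI]])
    also have "\<dots> = (\<Sum>k\<in>?P I. (real (card I) - 2) * ?W k I \<tau>)"
    proof (rule sum.cong[OF refl])
      fix k assume k: "k \<in> ?P I"
      have "{j. j \<in> I \<and> j \<notin> k} = I - k" by auto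
      moreover have "card (I - k) = card I - 2"
        using k finI by (auto simp: card_Diff_subset finite_subset)
      ultimately show "(\<Sum>j | j \<in> I \<and> j \<notin> k. ?W k I \<tau>) = (real (card I) - 2) * ?W k I \<tau>"
        using Suc.prems(4) by (simp add: of_nat_diff)
    qed
    also have "\<dots> = (real (card I) - 2) * (\<Sum>k\<in>?P I. ?W k I \<tau>)"
      by (rule sum_distrib_left[symmetric])
    finally show ?thesis
      using n Suc.hyps(2) by simp
  qed
qed

section \<open>Gaussian states satisfy the Wick relations\<close>

definition site :: "nat \<Rightarrow> nat \<Rightarrow> nat" where
  "site d l = (if l < d then l else l - d)"

text \<open>The nonzero entry of the Majorana matrix in row x. For l \<ge> d an empty mode in the
  row selects the annihilation operator with 1 / \<i> = - \<i>, an occupied one its adjoint with the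
  opposite sign.\<close>

definition maj_coeff :: "nat \<Rightarrow> nat \<Rightarrow> nat set \<Rightarrow> complex" where
  "maj_coeff d l x =
     (if l < d then 1 else if site d l \<in> x then \<i> else - \<i>) * jw_sign (site d l) x"

definition maj :: "nat \<Rightarrow> nat \<Rightarrow> (nat set \<Rightarrow> complex) \<Rightarrow> nat set \<Rightarrow> complex" where
  "maj d l F x = maj_coeff d l x * F (toggle (site d l) x)"

text \<open>The prefactor is \<open>(- \<i>) * (\<i> / 4) = 1 / 4\<close>, that is, \<open>quad\<close> acts as \<open>- \<i> H\<close>.\<close>

definition quad :: "nat \<Rightarrow> (nat \<Rightarrow> nat \<Rightarrow> real) \<Rightarrow> (nat set \<Rightarrow> complex) \<Rightarrow> nat set \<Rightarrow> complex" where
  "quad d h F x = (\<Sum>j<2 * d. \<Sum>k<2 * d. complex_of_real (h j k) / 4 * maj d j (maj d k F) x)"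

text \<open>The value at (x, y) of the sum of c_l (x) c_l applied to F (x) H. Two arguments are kept
  so that different terms of the exponential series can be paired.\<close>

definition bilinear_invariant ::
  "nat \<Rightarrow> (nat set \<Rightarrow> complex) \<Rightarrow> (nat set \<Rightarrow> complex) \<Rightarrow> nat set \<Rightarrow> nat set \<Rightarrow> complex" where
  "bilinear_invariant d F H x y = (\<Sum>l<2 * d. maj d l F x * maj d l H y)"

lemma maj_sum: "maj d l (\<lambda>x. \<Sum>s\<in>S. F s x) x = (\<Sum>s\<in>S. maj d l (F s) x)"
  by (simp add: maj_def sum_distrib_left)

lemma maj_scale: "maj d l (\<lambda>x. c * F x) x = c * maj d l F x"
  by (simp add: maj_def)

text \<open>At different modes, toggling the lower one flips the string sign of the higher one and
  not conversely. At the same mode, the toggle flips the coefficient \<i> or - \<i> of the second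
  kind of operator but not the coefficient of the first.\<close>

lemma maj_anticommute:
  assumes "l < 2 * d" "m < 2 * d"
  shows "maj d l (maj d m F) x = (if l = m then 2 * F x else 0) - maj d m (maj d l F) x"
proof (cases "site d l = site d m")
  case True
  then have "l = m \<or> (l < d \<and> \<not> m < d) \<or> (m < d \<and> \<not> l < d)"
    by (auto simp: site_def split: if_splits)
  then show ?thesis
    using True by (auto simp: maj_def maj_coeff_def jw_sign_toggle in_toggle_iff)
next
  case False
  then have "l \<noteq> m" by auto
  then show ?thesis
    using False
    by (cases "site d l < site d m")
      (auto simp: maj_def maj_coeff_def jw_sign_toggle in_toggle_iff toggle_commute[of "site d l"])
qed

text \<open>The commutator of a Majorana operator with a quadratic expression is linear. Moving c_l
  across c_j and c_k produces two terms with coefficient 2 * h / 4; antisymmetry of h makes them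
  equal, so together they have coefficient 1.\<close>

lemma maj_quad:
  assumes h: "\<And>j k. j < 2 * d \<Longrightarrow> k < 2 * d \<Longrightarrow> h j k = - h k j" and l: "l < 2 * d"
  shows "maj d l (quad d h F) x
    = quad d h (maj d l F) x - (\<Sum>j<2 * d. complex_of_real (h j l) * maj d j F x)"
proof -
  let ?H = "\<lambda>j k. complex_of_real (h j k) / 4"
  let ?n = "2 * d"
  have triple: "maj d l (maj d j (maj d k F)) x = maj d j (maj d k (maj d l F)) x
      + ((if j = l then 2 * maj d k F x else 0) - (if k = l then 2 * maj d j F x else 0))"
    if "j < ?n" "k < ?n" for j k
  proof -
    have "maj d l (maj d j (maj d k F)) x = (if l = j then 2 * maj d k F x else 0) - maj d j (maj d l (maj d k F)) x"
      by (rule maj_anticommute[OF l that(1)])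
    also have "maj d j (maj d l (maj d k F)) x
        = maj_coeff d j x * maj d l (maj d k F) (toggle (site d j) x)"
      by (simp only: maj_def[of d j])
    also have "\<dots> = maj_coeff d j x * ((if l = k then 2 * F (toggle (site d j) x) else 0)
        - maj d k (maj d l F) (toggle (site d j) x))"
      by (simp only: maj_anticommute[OF l that(2)])
    also have "\<dots> = (if l = k then 2 * maj d j F x else 0) - maj d j (maj d k (maj d l F)) x"
      by (simp add: maj_def[of d j] algebra_simps)
    finally show ?thesis by auto
  qed
  have "maj d l (quad d h F) x = (\<Sum>j<?n. \<Sum>k<?n. ?H j k * maj d l (maj d j (maj d k F)) x)"
    unfolding quad_def by (simp only: maj_sum maj_scale)
  also have "\<dots> = (\<Sum>j<?n. \<Sum>k<?n. ?H j k * maj d j (maj d k (maj d l F)) x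
      + ?H j k * (if j = l then 2 * maj d k F x else 0) - ?H j k * (if k = l then 2 * maj d j F x else 0))"
    by (intro sum.cong refl) (simp only: triple lessThan_iff, simp only: distrib_left right_diff_distrib add_diff_eq)
  also have "\<dots> = quad d h (maj d l F) x
      + (\<Sum>j<?n. \<Sum>k<?n. ?H j k * (if j = l then 2 * maj d k F x else 0))
      - (\<Sum>j<?n. \<Sum>k<?n. ?H j k * (if k = l then 2 * maj d j F x else 0))"
    by (simp only: sum.distrib sum_subtractf quad_def)
  also have "(\<Sum>j<?n. \<Sum>k<?n. ?H j k * (if j = l then 2 * maj d k F x else 0))
      = (\<Sum>k<?n. ?H l k * 2 * maj d k F x)"
    by (subst sum.swap) (use l in \<open>simp add: if_distrib cong: if_cong\<close>)
  also have "\<dots> = - (\<Sum>k<?n. ?H k l * 2 * maj d k F x)"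
    unfolding sum_negf[symmetric] by (rule sum.cong) (use h[OF l] in auto)
  also have "(\<Sum>j<?n. \<Sum>k<?n. ?H j k * (if k = l then 2 * maj d j F x else 0))
      = (\<Sum>k<?n. ?H k l * 2 * maj d k F x)"
    using l by (simp add: if_distrib cong: if_cong)
  also have "quad d h (maj d l F) x + - (\<Sum>k<?n. ?H k l * 2 * maj d k F x) - (\<Sum>k<?n. ?H k l * 2 * maj d k F x)
      = quad d h (maj d l F) x - (\<Sum>k<?n. ?H k l * 2 * maj d k F x + ?H k l * 2 * maj d k F x)"
    by (simp only: sum.distrib diff_conv_add_uminus minus_add_distrib add.assoc)
  also have "(\<Sum>k<?n. ?H k l * 2 * maj d k F x + ?H k l * 2 * maj d k F x)
      = (\<Sum>j<?n. complex_of_real (h j l) * maj d j F x)"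
    by (rule sum.cong) auto
  finally show ?thesis .
qed

lemma quad_sum: "quad d h (\<lambda>x. \<Sum>s\<in>S. c s * F s x) x = (\<Sum>s\<in>S. c s * quad d h (F s) x)"
proof -
  have "maj d j (maj d k (\<lambda>x. \<Sum>s\<in>S. c s * F s x)) x = (\<Sum>s\<in>S. c s * maj d j (maj d k (F s)) x)" for j k
    by (simp add: maj_def sum_distrib_left mult_ac)
  then have "quad d h (\<lambda>x. \<Sum>s\<in>S. c s * F s x) x
      = (\<Sum>j<2 * d. \<Sum>k<2 * d. \<Sum>s\<in>S. c s * (complex_of_real (h j k) / 4 * maj d j (maj d k (F s)) x))"
    by (simp add: quad_def sum_distrib_left mult_ac)
  also have "\<dots> = (\<Sum>j<2 * d. \<Sum>s\<in>S. \<Sum>k<2 * d. c s * (complex_of_real (h j k) / 4 * maj d j (maj d k (F s)) x))"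
    by (rule sum.cong[OF refl], rule sum.swap)
  also have "\<dots> = (\<Sum>s\<in>S. c s * quad d h (F s) x)"
    by (subst sum.swap) (simp add: quad_def sum_distrib_left)
  finally show ?thesis .
qed

text \<open>By \<open>maj_quad\<close> the commutators on the two factors leave the sums of h j l *
  (c_j (x) c_l) and of h j l * (c_l (x) c_j), which cancel by antisymmetry: infinitesimal rotations
  preserve the sum of c_l (x) c_l.\<close>

lemma bilinear_invariant_quad:
  assumes h: "\<And>j k. j < 2 * d \<Longrightarrow> k < 2 * d \<Longrightarrow> h j k = - h k j"
  shows "bilinear_invariant d (quad d h F) H x y + bilinear_invariant d F (quad d h H) x y
    = quad d h (\<lambda>x'. bilinear_invariant d F H x' y) x + quad d h (\<lambda>y'. bilinear_invariant d F H x y') y"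
proof -
  let ?n = "2 * d"
  have 1: "bilinear_invariant d (quad d h F) H x y = quad d h (\<lambda>x'. bilinear_invariant d F H x' y) x
      - (\<Sum>l<?n. \<Sum>j<?n. complex_of_real (h j l) * (maj d j F x * maj d l H y))"
  proof -
    have "quad d h (\<lambda>x'. bilinear_invariant d F H x' y) x = (\<Sum>l<?n. maj d l H y * quad d h (maj d l F) x)"
      unfolding bilinear_invariant_def by (subst quad_sum[symmetric]) (simp add: mult.commute)
    moreover have "bilinear_invariant d (quad d h F) H x y
        = (\<Sum>l<?n. maj d l H y * quad d h (maj d l F) x
            - (\<Sum>j<?n. complex_of_real (h j l) * (maj d j F x * maj d l H y)))"
      unfolding bilinear_invariant_def
      by (intro sum.cong refl) (simp only: maj_quad[OF h] lessThan_iff, simp add: right_diff_distrib sum_distrib_left mult_ac)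
    ultimately show ?thesis by (simp add: sum_subtractf)
  qed
  have 2: "bilinear_invariant d F (quad d h H) x y = quad d h (\<lambda>y'. bilinear_invariant d F H x y') y
      - (\<Sum>l<?n. \<Sum>j<?n. complex_of_real (h j l) * (maj d l F x * maj d j H y))"
  proof -
    have "quad d h (\<lambda>y'. bilinear_invariant d F H x y') y = (\<Sum>l<?n. maj d l F x * quad d h (maj d l H) y)"
      unfolding bilinear_invariant_def by (rule quad_sum)
    moreover have "bilinear_invariant d F (quad d h H) x y
        = (\<Sum>l<?n. maj d l F x * quad d h (maj d l H) y
            - (\<Sum>j<?n. complex_of_real (h j l) * (maj d l F x * maj d j H y)))"
      unfolding bilinear_invariant_def
      by (intro sum.cong refl) (simp only: maj_quad[OF h] lessThan_iff, simp add: right_diff_distrib sum_distrib_left mult_ac)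
    ultimately show ?thesis by (simp add: sum_subtractf)
  qed
  have "(\<Sum>l<?n. \<Sum>j<?n. complex_of_real (h j l) * (maj d l F x * maj d j H y))
      = (\<Sum>l<?n. \<Sum>j<?n. complex_of_real (h l j) * (maj d j F x * maj d l H y))"
    by (rule sum.swap)
  also have "\<dots> = - (\<Sum>l<?n. \<Sum>j<?n. complex_of_real (h j l) * (maj d j F x * maj d l H y))"
    unfolding sum_negf[symmetric] by (intro sum.cong refl) (subst h, auto)
  finally show ?thesis unfolding 1 2 by simp
qed

text \<open>The operators c_l and c_(d + l) act at the same mode. If x and y agree there, the
  product of the second coefficients is \<i> * \<i> and cancels the 1 of the first; if they differ,
  it is \<i> * (- \<i>) and the two contributions add up to 2.\<close>

lemma bilinear_invariant_self:
  assumes x: "x \<subseteq> {..<d}" and y: "y \<subseteq> {..<d}"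
  shows "bilinear_invariant d F F x y
    = 2 * (\<Sum>j\<in>sym_diff x y. jw_sign j x * jw_sign j y * F (toggle j x) * F (toggle j y))"
proof -
  let ?t = "\<lambda>j. jw_sign j x * jw_sign j y * F (toggle j x) * F (toggle j y)"
  have split: "(\<Sum>l<d + n. g l) = (\<Sum>l<d. g l) + (\<Sum>l<n. g (d + l))" for g :: "nat \<Rightarrow> complex" and n
    by (induction n) (simp_all add: add.assoc)
  have ii: "\<i> * a * b * (\<i> * a' * b') = - (a * b * (a' * b'))" for a b a' b'
    by (simp add: complex_eq_iff algebra_simps)
  have "bilinear_invariant d F F x y = (\<Sum>l<d. maj d l F x * maj d l F y + maj d (d + l) F x * maj d (d + l) F y)"
    unfolding bilinear_invariant_def mult_2 split by (simp add: sum.distrib)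
  also have "\<dots> = (\<Sum>l<d. if l \<in> sym_diff x y then 2 * ?t l else 0)"
    by (intro sum.cong refl) (auto simp: maj_def maj_coeff_def site_def ii)
  also have "\<dots> = (\<Sum>l\<in>sym_diff x y. 2 * ?t l)"
    using x y by (intro sum.mono_neutral_cong_right) auto
  finally show ?thesis by (simp add: sum_distrib_left)
qed

text \<open>Here \<phi> n is the term of degree n of an exponential series started at a basis state.
  Invariance is proved degree by degree: S N is the coefficient of degree N in the Cauchy product,
  and the Leibniz rule expresses Suc N times S (Suc N) by the quadratic operator applied to S N in
  either variable.\<close>

lemma exp_quad_wick:
  assumes h: "\<And>j k. j < 2 * d \<Longrightarrow> k < 2 * d \<Longrightarrow> h j k = - h k j"
    and step: "\<And>n x. of_nat (Suc n) * \<phi> (Suc n) x = quad d h (\<phi> n) x"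
    and init: "\<And>x. x \<noteq> x0 \<Longrightarrow> \<phi> 0 x = 0"
    and outside: "\<And>n x. \<not> x \<subseteq> {..<d} \<Longrightarrow> \<phi> n x = 0"
    and summable: "\<And>x. summable (\<lambda>n. cmod (\<phi> n x))"
  shows "wick_relations d (\<lambda>x. \<Sum>n. \<phi> n x)"
proof -
  define S where "S N x y = (\<Sum>m\<le>N. bilinear_invariant d (\<phi> m) (\<phi> (N - m)) x y)" for N x y
  \<comment> \<open>For x \<noteq> y the toggled sets cannot both equal x0, and for x = y the
    symmetric difference is empty. Outside \<open>{..<d}\<close> a toggle at a valid site stays
    outside, where \<phi> vanishes.\<close>
  have B0: "bilinear_invariant d (\<phi> 0) (\<phi> 0) x y = 0" for x y
  proof (cases "x \<subseteq> {..<d} \<and> y \<subseteq> {..<d}")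
    case True
    have "\<phi> 0 (toggle j x) = 0 \<or> \<phi> 0 (toggle j y) = 0" if "x \<noteq> y" for j
      using init that by (metis toggle_toggle)
    then show ?thesis
      using True by (cases "x = y") (auto simp: bilinear_invariant_self)
  next
    case False
    have "\<phi> 0 (toggle (site d l) x) = 0 \<or> \<phi> 0 (toggle (site d l) y) = 0" if "l < 2 * d" for l
    proof -
      have "site d l \<in> {..<d}" using that by (auto simp: site_def)
      then show ?thesis using False outside by (metis toggle_subset_iff)
    qed
    then show ?thesis unfolding bilinear_invariant_def maj_def by (intro sum.neutral) auto
  qed
  have S: "S N x y = 0" for N x y
  proof (induction N arbitrary: x y)
    case 0
    show ?case by (simp add: S_def B0)
  next
    case (Suc N)
    have maj_step: "of_nat (Suc n) * maj d l (\<phi> (Suc n)) x = maj d l (quad d h (\<phi> n)) x" for n l x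
      unfolding maj_def by (simp only: step[symmetric] mult.left_commute)
    have l: "of_nat (Suc n) * bilinear_invariant d (\<phi> (Suc n)) H x y = bilinear_invariant d (quad d h (\<phi> n)) H x y"
      and r: "of_nat (Suc n) * bilinear_invariant d H (\<phi> (Suc n)) x y = bilinear_invariant d H (quad d h (\<phi> n)) x y"
      for n H
      by (simp_all only: bilinear_invariant_def sum_distrib_left maj_step[symmetric] mult_ac)
    let ?b = "\<lambda>m. bilinear_invariant d (\<phi> m) (\<phi> (Suc N - m)) x y"
    \<comment> \<open>The weight Suc N is m + (Suc N - m), one part for each factor. Each part
      vanishes at one end of the range, so both sums reduce to degree N.\<close>
    have "of_nat (Suc N) * S (Suc N) x y = (\<Sum>m\<le>Suc N. of_nat m * ?b m + of_nat (Suc N - m) * ?b m)"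
      unfolding S_def sum_distrib_left
      by (intro sum.cong refl) (simp flip: distrib_right of_nat_add del: of_nat_Suc)
    also have "\<dots> = (\<Sum>m\<le>Suc N. of_nat m * ?b m) + (\<Sum>m\<le>Suc N. of_nat (Suc N - m) * ?b m)"
      by (rule sum.distrib)
    also have "(\<Sum>m\<le>Suc N. of_nat m * ?b m) = (\<Sum>m\<le>N. of_nat (Suc m) * ?b (Suc m))"
      by (simp only: sum.atMost_Suc_shift) simp
    also have "\<dots> = (\<Sum>m\<le>N. bilinear_invariant d (quad d h (\<phi> m)) (\<phi> (N - m)) x y)"
      by (simp only: l diff_Suc_Suc)
    also have "(\<Sum>m\<le>Suc N. of_nat (Suc N - m) * ?b m) = (\<Sum>m\<le>N. of_nat (Suc N - m) * ?b m)"
      by simp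
    also have "\<dots> = (\<Sum>m\<le>N. bilinear_invariant d (\<phi> m) (quad d h (\<phi> (N - m))) x y)"
      by (intro sum.cong refl) (simp only: Suc_diff_le atMost_iff r)
    also have "(\<Sum>m\<le>N. bilinear_invariant d (quad d h (\<phi> m)) (\<phi> (N - m)) x y)
        + (\<Sum>m\<le>N. bilinear_invariant d (\<phi> m) (quad d h (\<phi> (N - m))) x y)
        = (\<Sum>m\<le>N. quad d h (\<lambda>x'. bilinear_invariant d (\<phi> m) (\<phi> (N - m)) x' y) x)
          + (\<Sum>m\<le>N. quad d h (\<lambda>y'. bilinear_invariant d (\<phi> m) (\<phi> (N - m)) x y') y)"
      by (simp only: sum.distrib[symmetric] bilinear_invariant_quad[OF h])
    also have "\<dots> = quad d h (\<lambda>x'. S N x' y) x + quad d h (\<lambda>y'. S N x y') y"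
      by (simp only: S_def quad_sum[of d h "\<lambda>_. 1", simplified])
    also have "\<dots> = 0" by (simp add: Suc.IH quad_def maj_def)
    finally show ?case by (simp del: of_nat_Suc)
  qed
  define \<Psi> where "\<Psi> x = (\<Sum>n. \<phi> n x)" for x
  have "bilinear_invariant d \<Psi> \<Psi> x y = 0" for x y
  proof -
    have maj_sums: "summable (\<lambda>n. cmod (maj d l (\<phi> n) x))" "(\<Sum>n. maj d l (\<phi> n) x) = maj d l \<Psi> x" for l x
      using summable[of "toggle (site d l) x"]
      by (auto simp: maj_def \<Psi>_def norm_mult suminf_mult summable_norm_cancel intro: summable_mult)
    \<comment> \<open>Absolute convergence gives the Cauchy product for each l. Summed over l, its
      terms are the S N, all zero.\<close>
    have "(\<lambda>N. \<Sum>l<2 * d. \<Sum>m\<le>N. maj d l (\<phi> m) x * maj d l (\<phi> (N - m)) y)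
        sums (\<Sum>l<2 * d. maj d l \<Psi> x * maj d l \<Psi> y)"
    proof (rule sums_sum)
      fix l
      show "(\<lambda>N. \<Sum>m\<le>N. maj d l (\<phi> m) x * maj d l (\<phi> (N - m)) y) sums (maj d l \<Psi> x * maj d l \<Psi> y)"
        using Cauchy_product_sums[OF maj_sums(1)[of l x] maj_sums(1)[of l y]] by (simp only: maj_sums(2))
    qed
    moreover have "(\<Sum>l<2 * d. \<Sum>m\<le>N. maj d l (\<phi> m) x * maj d l (\<phi> (N - m)) y) = 0" for N
      using S[of N x y] unfolding S_def bilinear_invariant_def by (subst sum.swap)
    ultimately have "(\<lambda>N. 0 :: complex) sums (\<Sum>l<2 * d. maj d l \<Psi> x * maj d l \<Psi> y)" by simp
    then show ?thesis unfolding bilinear_invariant_def using sums_unique2 sums_zero by blast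
  qed
  then have "(\<Sum>j\<in>sym_diff x y. jw_sign j x * jw_sign j y * \<Psi> (toggle j x) * \<Psi> (toggle j y)) = 0"
    if "x \<subseteq> {..<d}" "y \<subseteq> {..<d}" for x y
    using bilinear_invariant_self[OF that, of \<Psi>] by simp
  then show ?thesis unfolding wick_relations_def \<Psi>_def by blast
qed

section \<open>From matrices and vectors to functions of sets\<close>

text \<open>The value 0 outside \<open>Pow {..<d}\<close> is preserved by toggles at modes below d.
  Thus operators can be translated by equalities of functions on all sets, which compose.\<close>

definition set_fun :: "nat \<Rightarrow> complex vec \<Rightarrow> nat set \<Rightarrow> complex" where
  "set_fun d v x = (if x \<subseteq> {..<d} then v $ set_encode x else 0)"

lemma set_encode_less: "x \<subseteq> {..<d} \<Longrightarrow> set_encode x < 2 ^ d"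
proof -
  assume x: "x \<subseteq> {..<d}"
  then have "set_encode x \<le> (\<Sum>i<d. 2 ^ i)"
    unfolding set_encode_def by (intro sum_mono2) auto
  also have "\<dots> < (2 :: nat) ^ d"
    by (induction d) auto
  finally show ?thesis .
qed

lemma set_decode_subset: "n < 2 ^ d \<Longrightarrow> set_decode n \<subseteq> {..<d}"
proof (rule ccontr)
  assume n: "n < 2 ^ d" and "\<not> set_decode n \<subseteq> {..<d}"
  then obtain i where i: "i \<in> set_decode n" "i \<notin> {..<d}" by blast
  then have "d \<le> i" by simp
  then have "n < 2 ^ i" using n by (meson less_le_trans one_le_numeral power_increasing)
  then show False using i by (simp add: set_decode_def)
qed

lemma bij_set_encode: "bij_betw set_encode (Pow {..<d}) {..<2 ^ d}"
  by (rule bij_betw_byWitness[where f' = set_decode])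
    (auto simp: set_encode_less finite_subset[of _ "{..<d}"] dest: set_decode_subset)

lemma qbit_set_decode: "qbit n j = of_bool (j \<in> set_decode n)"
  by (simp add: qbit_def set_decode_def mod_2_eq_odd)

lemma qbit_set_encode: "x \<subseteq> {..<d} \<Longrightarrow> qbit (set_encode x) j = of_bool (j \<in> x)"
  by (simp add: qbit_set_decode finite_subset[of _ "{..<d}"])

lemma sum_set_encode: "(\<Sum>b<2 ^ d. g b) = (\<Sum>y\<in>Pow {..<d}. g (set_encode y))"
  using sum.reindex_bij_betw[OF bij_set_encode, of g d] by simp

lemma mult_mat_vec_index:
  "A \<in> carrier_mat n n \<Longrightarrow> v \<in> carrier_vec n \<Longrightarrow> i < n
    \<Longrightarrow> (A *\<^sub>v v) $ i = (\<Sum>b<n. A $$ (i, b) * v $ b)"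
  by (auto simp: scalar_prod_def atLeast0LessThan)

lemma mat_adjoint_carrier: "A \<in> carrier_mat n n \<Longrightarrow> mat_adjoint A \<in> carrier_mat n n"
  by (auto simp: mat_adjoint_def)

lemma mult_mat_vec_set_encode:
  assumes "A \<in> carrier_mat (2 ^ d) (2 ^ d)" "v \<in> carrier_vec (2 ^ d)" "x \<subseteq> {..<d}"
  shows "(A *\<^sub>v v) $ set_encode x
    = (\<Sum>y\<in>Pow {..<d}. A $$ (set_encode x, set_encode y) * v $ set_encode y)"
  by (simp only: mult_mat_vec_index[OF assms(1,2) set_encode_less[OF assms(3)]] sum_set_encode)

lemma annihilation_carrier: "annihilation d j \<in> carrier_mat (2 ^ d) (2 ^ d)"
  by (simp add: annihilation_def tensor_op_def)

lemma majorana_carrier: "majorana d l \<in> carrier_mat (2 ^ d) (2 ^ d)"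
  by (auto simp: majorana_def intro!: add_carrier_mat smult_carrier_mat minus_carrier_mat
      mat_adjoint_carrier annihilation_carrier)

lemma pauli_Z_index: "a < 2 \<Longrightarrow> b < 2 \<Longrightarrow> pauli_Z $$ (a, b) = (if a = b then (- 1) ^ a else 0)"
  by (auto simp: pauli_Z_def mat_of_rows_list_def less_2_cases_iff)

text \<open>The operator leads from the column y to the row x, so mode j is filled in y and empty in
  x. The string sign can be read off from x because x and y agree below j.\<close>

lemma annihilation_index:
  assumes x: "x \<subseteq> {..<d}" and y: "y \<subseteq> {..<d}" and j: "j < d"
  shows "annihilation d j $$ (set_encode x, set_encode y)
    = (if j \<notin> x \<and> y = toggle j x then jw_sign j x else 0)"
proof -
  let ?F = "\<lambda>l. if l < j then (if l \<in> x \<longleftrightarrow> l \<in> y then (- 1) ^ of_bool (l \<in> x) else 0)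
    else if l = j then of_bool (l \<notin> x \<and> l \<in> y) else of_bool (l \<in> x \<longleftrightarrow> l \<in> y) :: complex"
  have "annihilation d j $$ (set_encode x, set_encode y) = (\<Prod>l<d. ?F l)"
    using set_encode_less[OF x] set_encode_less[OF y]
    by (simp add: annihilation_def tensor_op_def)
      (intro prod.cong refl, auto simp: qbit_set_encode[OF x] qbit_set_encode[OF y] pauli_Z_index ketbra_def)
  also have "\<dots> = (if j \<notin> x \<and> y = toggle j x then jw_sign j x else 0)"
  proof (cases "j \<notin> x \<and> y = toggle j x")
    case True
    then have "(\<Prod>l<d. ?F l) = (\<Prod>l<d. if l \<in> x \<inter> {..<j} then - 1 else 1)"
      by (intro prod.cong refl) (auto simp: in_toggle_iff)
    also have "\<dots> = (\<Prod>l\<in>x \<inter> {..<j}. - 1)"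
      using x j by (intro prod.mono_neutral_cong_right) auto
    finally show ?thesis using True by (simp add: jw_sign_def)
  next
    case False
    have "\<exists>l<d. ?F l = 0"
    proof (rule ccontr)
      assume "\<not> ?thesis"
      then have nz: "?F l \<noteq> 0" if "l < d" for l using that by blast
      have jx: "j \<notin> x" "j \<in> y" using nz[OF j] by auto
      have "l \<in> y \<longleftrightarrow> l \<in> toggle j x" for l
      proof (cases "l < d")
        case True
        then show ?thesis using nz[OF True] jx by (auto simp: in_toggle_iff split: if_splits)
      next
        case False
        then show ?thesis using x y j by (auto simp: in_toggle_iff)
      qed
      then show False using False jx by blast
    qed
    then have "(\<Prod>l<d. ?F l) = 0" 
      by (simp only: prod_zero_iff[OF finite_lessThan] lessThan_iff Bex_def)
    then show ?thesis by (simp only: False if_False)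
  qed
  finally show ?thesis .
qed

lemma mat_adjoint_index:
  "A \<in> carrier_mat n n \<Longrightarrow> i < n \<Longrightarrow> j < n \<Longrightarrow> mat_adjoint A $$ (i, j) = cnj (A $$ (j, i))"
  by (auto simp: mat_adjoint_def mat_of_rows_index)

lemma majorana_index:
  assumes x: "x \<subseteq> {..<d}" and y: "y \<subseteq> {..<d}" and l: "l < 2 * d"
  shows "majorana d l $$ (set_encode x, set_encode y)
    = (if y = toggle (site d l) x then maj_coeff d l x else 0)"
proof -
  let ?s = "site d l" and ?X = "set_encode x" and ?Y = "set_encode y"
  have s: "?s < d" using l by (auto simp: site_def)
  note X = set_encode_less[OF x] and Y = set_encode_less[OF y]
  have c: "annihilation d ?s \<in> carrier_mat (2 ^ d) (2 ^ d)"
    "mat_adjoint (annihilation d ?s) \<in> carrier_mat (2 ^ d) (2 ^ d)"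
    by (rule annihilation_carrier) (rule mat_adjoint_carrier[OF annihilation_carrier])
  have a: "annihilation d ?s $$ (?X, ?Y) = (if ?s \<notin> x \<and> y = toggle ?s x then jw_sign ?s x else 0)"
    by (rule annihilation_index[OF x y s])
  have "mat_adjoint (annihilation d ?s) $$ (?X, ?Y) = (if ?s \<notin> y \<and> x = toggle ?s y then jw_sign ?s y else 0)"
    by (simp add: mat_adjoint_index[OF annihilation_carrier X Y] annihilation_index[OF y x s])
  also have "\<dots> = (if ?s \<in> x \<and> y = toggle ?s x then jw_sign ?s x else 0)"
    by (auto simp: jw_sign_toggle in_toggle_iff)
  finally have a': "mat_adjoint (annihilation d ?s) $$ (?X, ?Y)
    = (if ?s \<in> x \<and> y = toggle ?s x then jw_sign ?s x else 0)" .
  show ?thesis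
  proof (cases "l < d")
    case True
    then have "majorana d l = annihilation d ?s + mat_adjoint (annihilation d ?s)"
      by (simp add: majorana_def site_def)
    then show ?thesis using True c X Y a a' by (auto simp: maj_coeff_def)
  next
    case False
    then have "majorana d l = (1 / \<i>) \<cdot>\<^sub>m (annihilation d ?s - mat_adjoint (annihilation d ?s))"
      by (simp add: majorana_def site_def)
    then show ?thesis using False c X Y a a' by (auto simp: maj_coeff_def)
  qed
qed

lemma set_fun_majorana:
  assumes v: "v \<in> carrier_vec (2 ^ d)" and l: "l < 2 * d"
  shows "set_fun d (majorana d l *\<^sub>v v) = maj d l (set_fun d v)"
proof
  fix x
  have s: "site d l \<in> {..<d}" using l by (auto simp: site_def)
  show "set_fun d (majorana d l *\<^sub>v v) x = maj d l (set_fun d v) x"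
  proof (cases "x \<subseteq> {..<d}")
    case True
    have "(majorana d l *\<^sub>v v) $ set_encode x
        = (\<Sum>y\<in>Pow {..<d}. if y = toggle (site d l) x then maj_coeff d l x * v $ set_encode y else 0)"
      unfolding mult_mat_vec_set_encode[OF majorana_carrier v True]
      by (intro sum.cong refl) (simp add: majorana_index[OF True _ l])
    then show ?thesis using True s
      by (simp add: set_fun_def maj_def toggle_subset_iff)
  next
    case False
    then show ?thesis using s by (simp add: set_fun_def maj_def toggle_subset_iff)
  qed
qed

lemma quadratic_hamiltonian_carrier: "quadratic_hamiltonian d h \<in> carrier_mat (2 ^ d) (2 ^ d)"
  by (simp add: quadratic_hamiltonian_def msum_def)

lemma set_fun_hamiltonian:
  assumes v: "v \<in> carrier_vec (2 ^ d)"
  shows "set_fun d (((- \<i>) \<cdot>\<^sub>m quadratic_hamiltonian d h) *\<^sub>v v) = quad d h (set_fun d v)"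
proof
  fix x
  let ?n = "2 ^ d :: nat" and ?S = "{..<2 * d} \<times> {..<2 * d}"
  let ?A = "(- \<i>) \<cdot>\<^sub>m quadratic_hamiltonian d h"
  have cA: "?A \<in> carrier_mat ?n ?n" using quadratic_hamiltonian_carrier by simp
  show "set_fun d (?A *\<^sub>v v) x = quad d h (set_fun d v) x"
  proof (cases "x \<subseteq> {..<d}")
    case True
    let ?X = "set_encode x"
    note X = set_encode_less[OF True]
    have A: "?A $$ (?X, b) = (\<Sum>(j, k)\<in>?S. complex_of_real (h j k) / 4 * (majorana d j * majorana d k) $$ (?X, b))"
      if "b < ?n" for b
    proof -
      have "?A $$ (?X, b) = (1 / 4) * (\<Sum>s\<in>?S. ((\<lambda>(j, k). complex_of_real (h j k) \<cdot>\<^sub>m (majorana d j * majorana d k)) s) $$ (?X, b))"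
        using X that by (simp add: quadratic_hamiltonian_def msum_def)
      also have "\<dots> = (\<Sum>(j, k)\<in>?S. complex_of_real (h j k) / 4 * (majorana d j * majorana d k) $$ (?X, b))"
        unfolding sum_distrib_left
      proof (rule sum.cong[OF refl], clarify)
        fix j k
        have "majorana d j * majorana d k \<in> carrier_mat ?n ?n"
          using majorana_carrier by (rule mult_carrier_mat) (rule majorana_carrier)
        then show "1 / 4 * (complex_of_real (h j k) \<cdot>\<^sub>m (majorana d j * majorana d k)) $$ (?X, b)
            = complex_of_real (h j k) / 4 * (majorana d j * majorana d k) $$ (?X, b)"
          using X that by (simp del: index_mult_mat)
      qed
      finally show ?thesis .
    qed
    have "(?A *\<^sub>v v) $ ?X = (\<Sum>b<?n. ?A $$ (?X, b) * v $ b)"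
      by (rule mult_mat_vec_index[OF cA v X])
    also have "\<dots> = (\<Sum>b<?n. \<Sum>(j, k)\<in>?S. complex_of_real (h j k) / 4 * ((majorana d j * majorana d k) $$ (?X, b) * v $ b))"
      by (rule sum.cong[OF refl]) (simp only: A lessThan_iff sum_distrib_right split_def mult.assoc)
    also have "\<dots> = (\<Sum>(j, k)\<in>?S. complex_of_real (h j k) / 4 * (\<Sum>b<?n. (majorana d j * majorana d k) $$ (?X, b) * v $ b))"
      by (subst sum.swap) (simp only: sum_distrib_left split_def)
    also have "\<dots> = (\<Sum>(j, k)\<in>?S. complex_of_real (h j k) / 4 * maj d j (maj d k (set_fun d v)) x)"
    proof (rule sum.cong[OF refl], clarify)
      fix j k assume jk: "j < 2 * d" "k < 2 * d"
      have cc: "majorana d j * majorana d k \<in> carrier_mat ?n ?n"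
        using majorana_carrier by (rule mult_carrier_mat) (rule majorana_carrier)
      have ck: "majorana d k *\<^sub>v v \<in> carrier_vec ?n"
        using majorana_carrier v by (rule mult_mat_vec_carrier)
      have "(\<Sum>b<?n. (majorana d j * majorana d k) $$ (?X, b) * v $ b)
          = ((majorana d j * majorana d k) *\<^sub>v v) $ ?X"
        by (rule mult_mat_vec_index[OF cc v X, symmetric])
      also have "(majorana d j * majorana d k) *\<^sub>v v = majorana d j *\<^sub>v (majorana d k *\<^sub>v v)"
        using majorana_carrier majorana_carrier v by (rule assoc_mult_mat_vec)
      also have "\<dots> $ ?X = set_fun d (majorana d j *\<^sub>v (majorana d k *\<^sub>v v)) x"
        using True by (simp add: set_fun_def)
      finally show "complex_of_real (h j k) / 4 * (\<Sum>b<?n. (majorana d j * majorana d k) $$ (?X, b) * v $ b)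
          = complex_of_real (h j k) / 4 * maj d j (maj d k (set_fun d v)) x"
        by (simp add: set_fun_majorana ck v jk)
    qed
    also have "\<dots> = quad d h (set_fun d v) x"
      by (simp add: quad_def sum.cartesian_product)
    finally show ?thesis using True by (simp add: set_fun_def)
  next
    case False
    have "quad d h (set_fun d v) x = (\<Sum>j<2 * d. \<Sum>k<2 * d. 0)"
      unfolding quad_def
    proof (intro sum.cong refl)
      fix j k assume "j \<in> {..<2 * d}" "k \<in> {..<2 * d}"
      then have "site d j \<in> {..<d}" "site d k \<in> {..<d}" by (auto simp: site_def)
      then show "complex_of_real (h j k) / 4 * maj d j (maj d k (set_fun d v)) x = 0"
        using False by (simp add: maj_def set_fun_def toggle_subset_iff)
    qed
    then show ?thesis using False by (simp add: set_fun_def)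
  qed
qed

section \<open>The matrix exponential and its convergence\<close>

lemma pow_mat_commute:
  assumes "A \<in> carrier_mat n n"
  shows "A * A ^\<^sub>m k = A ^\<^sub>m k * A"
proof (induction k)
  case 0
  then show ?case using assms by simp
next
  case (Suc k)
  have "A * A ^\<^sub>m Suc k = A * A ^\<^sub>m k * A"
    using assms by (simp add: assoc_mult_mat[of _ n n _ n _ n])
  then show ?case using Suc by simp
qed

text \<open>Provides the absolute convergence that the Cauchy product in
  \<open>exp_quad_wick\<close> requires. M is the sum of the moduli of all entries and so dominates
  every column sum, which is what the induction step uses.\<close>

lemma pow_mat_entry_bound:
  fixes A :: "complex mat"
  assumes A: "A \<in> carrier_mat n n"
  shows "\<exists>M. \<forall>k. \<forall>i<n. \<forall>j<n. cmod ((A ^\<^sub>m k) $$ (i, j)) \<le> M ^ k"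
proof (intro exI allI impI)
  define M where "M = (\<Sum>j<n. \<Sum>l<n. cmod (A $$ (l, j)))"
  have M0: "0 \<le> M" by (simp add: M_def sum_nonneg)
  fix k i j assume "i < n" "j < n"
  then show "cmod ((A ^\<^sub>m k) $$ (i, j)) \<le> M ^ k"
  proof (induction k arbitrary: j)
    case 0
    then show ?case using A by simp
  next
    case (Suc k)
    have "(A ^\<^sub>m Suc k) $$ (i, j) = (\<Sum>l<n. (A ^\<^sub>m k) $$ (i, l) * A $$ (l, j))"
      using A Suc.prems by (simp add: scalar_prod_def atLeast0LessThan)
    also have "cmod \<dots> \<le> (\<Sum>l<n. M ^ k * cmod (A $$ (l, j)))"
      by (rule order_trans[OF norm_sum], rule sum_mono)
        (use Suc in \<open>auto simp: norm_mult intro!: mult_right_mono\<close>)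
    also have "\<dots> = M ^ k * (\<Sum>l<n. cmod (A $$ (l, j)))" by (simp add: sum_distrib_left)
    also have "\<dots> \<le> M ^ k * M"
      unfolding M_def using Suc.prems
      by (intro mult_left_mono member_le_sum[of j "{..<n}" "\<lambda>j. \<Sum>l<n. cmod (A $$ (l, j))"])
        (auto simp: sum_nonneg)
    finally show ?case by (simp add: mult.commute)
  qed
qed

lemma gaussian_state_wick:
  assumes "gaussian_state d \<psi>"
  shows "wick_relations d (set_fun d \<psi>)"
proof -
  let ?n = "2 ^ d :: nat"
  obtain h c x0 where h: "\<forall>j<2 * d. \<forall>k<2 * d. h j k = - h k j" and x0: "x0 < ?n"
    and \<psi>: "\<psi> = c \<cdot>\<^sub>v (mat_exp ((- \<i>) \<cdot>\<^sub>m quadratic_hamiltonian d h) *\<^sub>v unit_vec ?n x0)"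
    using assms unfolding gaussian_state_def by blast
  define A where "A = (- \<i>) \<cdot>\<^sub>m quadratic_hamiltonian d h"
  have cA: "A \<in> carrier_mat ?n ?n" using quadratic_hamiltonian_carrier by (simp add: A_def)
  have cpow: "A ^\<^sub>m k \<in> carrier_mat ?n ?n" for k using cA by simp
  define w where "w k = A ^\<^sub>m k *\<^sub>v unit_vec ?n x0" for k
  have cw: "w k \<in> carrier_vec ?n" for k unfolding w_def by (rule mult_mat_vec_carrier[OF cpow]) simp
  have w_index: "w k $ i = (A ^\<^sub>m k) $$ (i, x0)" if "i < ?n" for k i
    using x0 by (simp add: w_def mult_mat_vec_index[OF cpow _ that] if_distrib cong: if_cong)
  have w_Suc: "w (Suc k) = A *\<^sub>v w k" for k
    unfolding w_def using cA cpow[of k]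
    by (simp add: pow_mat_commute[OF cA, symmetric] assoc_mult_mat_vec[of _ ?n ?n _ ?n])
  define \<phi> where "\<phi> k x = set_fun d (w k) x / fact k" for k x
  obtain M where M: "\<And>k i j. i < ?n \<Longrightarrow> j < ?n \<Longrightarrow> cmod ((A ^\<^sub>m k) $$ (i, j)) \<le> M ^ k"
    using pow_mat_entry_bound[OF cA] by blast
  have "wick_relations d (\<lambda>x. \<Sum>k. \<phi> k x)"
  proof (rule exp_quad_wick)
    show "h j k = - h k j" if "j < 2 * d" "k < 2 * d" for j k using h that by blast
    show "of_nat (Suc k) * \<phi> (Suc k) x = quad d h (\<phi> k) x" for k x
    proof -
      have "set_fun d (w (Suc k)) = quad d h (set_fun d (w k))"
        unfolding w_Suc A_def by (rule set_fun_hamiltonian[OF cw])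
      then have "of_nat (Suc k) * \<phi> (Suc k) x = (1 / fact k) * quad d h (set_fun d (w k)) x"
        by (simp add: \<phi>_def field_simps del: of_nat_Suc)
      \<comment> \<open>Homogeneity of \<open>quad\<close> is linearity for a sum over the one-point
        set \<open>{()}\<close>.\<close>
      also have "\<dots> = quad d h (\<phi> k) x"
        using quad_sum[of d h "\<lambda>_. 1 / fact k" "\<lambda>_. set_fun d (w k)" "{()}" x] by (simp add: \<phi>_def[abs_def])
      finally show ?thesis .
    qed
    show "\<phi> 0 x = 0" if "x \<noteq> set_decode x0" for x
    proof -
      have "set_encode x \<noteq> x0" if "x \<subseteq> {..<d}"
        using that \<open>x \<noteq> set_decode x0\<close> by (metis finite_lessThan finite_subset set_encode_inverse)
      then show ?thesis
        using x0 cA by (auto simp: \<phi>_def set_fun_def w_index set_encode_less)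
    qed
    show "\<phi> k x = 0" if "\<not> x \<subseteq> {..<d}" for k x using that by (simp add: \<phi>_def set_fun_def)
    show "summable (\<lambda>k. cmod (\<phi> k x))" for x
    proof (rule summable_comparison_test)
      show "summable (\<lambda>k. \<bar>M\<bar> ^ k / fact k)"
        using summable_exp[of "\<bar>M\<bar>"] by (simp add: field_simps)
      have "cmod (\<phi> k x) \<le> \<bar>M\<bar> ^ k / fact k" for k
      proof (cases "x \<subseteq> {..<d}")
        case True
        have "cmod ((A ^\<^sub>m k) $$ (set_encode x, x0)) \<le> \<bar>M\<bar> ^ k"
          using M[OF set_encode_less[OF True] x0, of k] by (rule order_trans) (simp add: power_abs[symmetric])
        then show ?thesis
          using True by (simp add: \<phi>_def set_fun_def w_index set_encode_less norm_divide divide_right_mono)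
      qed (simp add: \<phi>_def set_fun_def)
      then show "\<exists>N. \<forall>k\<ge>N. norm (cmod (\<phi> k x)) \<le> \<bar>M\<bar> ^ k / fact k" by simp
    qed
  qed
  moreover have "set_fun d \<psi> = (\<lambda>x. c * (\<Sum>k. \<phi> k x))"
  proof
    fix x
    show "set_fun d \<psi> x = c * (\<Sum>k. \<phi> k x)"
    proof (cases "x \<subseteq> {..<d}")
      case True
      note X = set_encode_less[OF True]
      have "\<psi> $ set_encode x = c * mat_exp A $$ (set_encode x, x0)"
        using X x0 cA unfolding \<psi> A_def[symmetric] by (simp add: mat_exp_def)
      also have "mat_exp A $$ (set_encode x, x0) = (\<Sum>k. \<phi> k x)"
        using X x0 cA True by (simp add: mat_exp_def \<phi>_def set_fun_def w_index)
      finally show ?thesis using True by (simp add: set_fun_def)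
    qed (simp add: set_fun_def \<phi>_def)
  qed
  \<comment> \<open>The relations are homogeneous of degree two, so the global phase factors out as
    c * c.\<close>
  ultimately show ?thesis
  proof -
    assume w: "wick_relations d (\<lambda>x. \<Sum>k. \<phi> k x)" and e: "set_fun d \<psi> = (\<lambda>x. c * (\<Sum>k. \<phi> k x))"
    define \<Phi> where "\<Phi> x = (\<Sum>k. \<phi> k x)" for x
    have "(\<Sum>j\<in>S. jw_sign j x * jw_sign j y * (c * \<Phi> (toggle j x)) * (c * \<Phi> (toggle j y)))
        = c * c * (\<Sum>j\<in>S. jw_sign j x * jw_sign j y * \<Phi> (toggle j x) * \<Phi> (toggle j y))" for S x y
      by (simp add: sum_distrib_left mult_ac)
    then show ?thesis using w unfolding wick_relations_def e \<Phi>_def[symmetric] by simp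
  qed
qed

section \<open>The second eigenvalue of a Hermitian matrix\<close>

definition mat_fun :: "complex mat \<Rightarrow> nat \<Rightarrow> (nat \<Rightarrow> complex) \<Rightarrow> nat \<Rightarrow> complex" where
  "mat_fun A n f i = (\<Sum>j<n. A $$ (i, j) * f j)"

definition hermitian_mat :: "nat \<Rightarrow> complex mat \<Rightarrow> bool" where
  "hermitian_mat n A \<longleftrightarrow> A \<in> carrier_mat n n \<and> (\<forall>i<n. \<forall>j<n. A $$ (i, j) = cnj (A $$ (j, i)))"

lemma ip_cong:
  "(\<And>x. x \<in> C \<Longrightarrow> f x = f' x) \<Longrightarrow> (\<And>x. x \<in> C \<Longrightarrow> g x = g' x) \<Longrightarrow> ip f g C = ip f' g' C"
  by (simp add: ip_def)

lemma ip_mat_fun_swap: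
  assumes "hermitian_mat n A"
  shows "ip f (mat_fun A n g) {..<n} = ip (mat_fun A n f) g {..<n}"
proof -
  have "ip f (mat_fun A n g) {..<n} = (\<Sum>i<n. \<Sum>j<n. cnj (f i) * A $$ (i, j) * g j)"
    by (simp add: ip_def mat_fun_def sum_distrib_left mult.assoc)
  also have "\<dots> = (\<Sum>j<n. \<Sum>i<n. cnj (f i) * A $$ (i, j) * g j)" by (rule sum.swap)
  also have "\<dots> = (\<Sum>j<n. \<Sum>i<n. cnj (f i) * cnj (A $$ (j, i)) * g j)"
  proof (intro sum.cong refl)
    fix i j assume "i \<in> {..<n}" "j \<in> {..<n}"
    then have "A $$ (i, j) = cnj (A $$ (j, i))" using assms unfolding hermitian_mat_def by blast
    then show "cnj (f i) * A $$ (i, j) * g j = cnj (f i) * cnj (A $$ (j, i)) * g j" by (simp only:)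
  qed
  also have "\<dots> = ip (mat_fun A n f) g {..<n}"
    by (simp add: ip_def mat_fun_def sum_distrib_left sum_distrib_right mult_ac)
  finally show ?thesis .
qed

lemma hermitian_eigenvalue_real:
  assumes A: "hermitian_mat n A" and a: "eigenvalue A a"
  shows "a = complex_of_real (Re a)"
proof -
  have cA: "A \<in> carrier_mat n n" using A by (simp add: hermitian_mat_def)
  obtain v where v: "v \<in> carrier_vec n" "v \<noteq> 0\<^sub>v n" "A *\<^sub>v v = a \<cdot>\<^sub>v v"
    using a cA by (auto simp: eigenvalue_def eigenvector_def)
  let ?f = "\<lambda>i. v $ i"
  have Af: "mat_fun A n ?f i = a * ?f i" if "i < n" for i
    unfolding mat_fun_def using mult_mat_vec_index[OF cA v(1) that] v that by simp
  have 1: "ip ?f (mat_fun A n ?f) {..<n} = a * nsq ?f {..<n}"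
    by (subst ip_cong[where f' = ?f and g' = "\<lambda>i. a * ?f i"]) (simp_all add: Af ip_scale_right ip_self)
  have "cnj (ip ?f (mat_fun A n ?f) {..<n}) = ip ?f (mat_fun A n ?f) {..<n}"
    by (simp add: cnj_ip ip_mat_fun_swap[OF A])
  then have "cnj a * nsq ?f {..<n} = a * nsq ?f {..<n}" unfolding 1 by simp
  moreover have "nsq ?f {..<n} \<noteq> 0"
  proof
    assume "nsq ?f {..<n} = 0"
    then have "\<And>i. i < n \<Longrightarrow> v $ i = 0" by (simp add: nsq_def sum_nonneg_eq_0_iff)
    then have "v = 0\<^sub>v n" using v(1) by (intro eq_vecI) auto
    then show False using v by simp
  qed
  ultimately show ?thesis by (simp add: complex_eq_iff)
qed

text \<open>The characteristic polynomial splits over the complex numbers and its roots are real, so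
  sorting them provides the list that the definite description of \<open>eigvals_desc\<close> asks
  for.\<close>

lemma hermitian_eigvals_desc:
  assumes A: "hermitian_mat n A"
  shows "char_poly A = (\<Prod>e\<leftarrow>eigvals_desc A. [:- complex_of_real e, 1:])"
    and "sorted_wrt (\<ge>) (eigvals_desc A)" and "length (eigvals_desc A) = n"
proof -
  have cA: "A \<in> carrier_mat n n" using A by (simp add: hermitian_mat_def)
  obtain as where as: "char_poly A = (\<Prod>a\<leftarrow>as. [:- a, 1:])" "length as = n"
    using char_poly_factorized[OF cA] by blast
  have real: "complex_of_real (Re a) = a" if "a \<in> set as" for a
  proof -
    have "poly (char_poly A) a = 0"
      unfolding as(1) using that by (auto simp: poly_prod_list prod_list_zero_iff)
    then have "eigenvalue A a" by (simp add: eigenvalue_root_char_poly[OF cA])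
    then show ?thesis by (rule hermitian_eigenvalue_real[OF A, symmetric])
  qed
  define es where "es = rev (sort (map Re as))"
  have "mset (map (\<lambda>e. [:- complex_of_real e, 1:]) es) = image_mset (\<lambda>a. [:- complex_of_real (Re a), 1:]) (mset as)"
    by (simp add: es_def image_mset.compositionality o_def)
  also have "\<dots> = mset (map (\<lambda>a. [:- a, 1:]) as)"
    by (auto simp: real intro!: image_mset_cong)
  finally have cp: "char_poly A = (\<Prod>e\<leftarrow>es. [:- complex_of_real e, 1:])"
    unfolding as(1) by (metis prod_mset_prod_list)
  have "sorted_wrt (\<ge>) es" by (simp add: es_def sorted_wrt_rev)
  moreover from this have "eigvals_desc A = es" using cp by (rule eigvals_desc_eqI)
  ultimately show "char_poly A = (\<Prod>e\<leftarrow>eigvals_desc A. [:- complex_of_real e, 1:])"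
    "sorted_wrt (\<ge>) (eigvals_desc A)" "length (eigvals_desc A) = n"
    using cp as(2) by (simp_all add: es_def)
qed

text \<open>Only the first two columns p0, p1 of a triangularizing similarity are needed: A p0 = e0
  p0 and A p1 = b p0 + e1 p1. Evaluating the inner product of p0 with A p1 in two ways relates b to
  the overlap of p0 and p1. If e0 = e1, this forces b = 0; otherwise a multiple of p0 added to p1
  gives an eigenvector orthogonal to p0. In the degenerate case orthogonality is not claimed,
  because there every combination of the two vectors is an eigenvector.\<close>

lemma hermitian_second_eigenvalue:
  assumes A: "hermitian_mat n A" and n: "2 \<le> n"
  shows "\<exists>u0 u1 e0. eigvals_desc A ! 1 \<le> e0
    \<and> (\<forall>i<n. mat_fun A n u0 i = complex_of_real e0 * u0 i)
    \<and> (\<forall>i<n. mat_fun A n u1 i = complex_of_real (eigvals_desc A ! 1) * u1 i)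
    \<and> (e0 = eigvals_desc A ! 1 \<or> ip u0 u1 {..<n} = 0)
    \<and> (\<forall>\<alpha> \<beta>. (\<forall>i<n. \<alpha> * u0 i + \<beta> * u1 i = 0) \<longrightarrow> \<alpha> = 0 \<and> \<beta> = 0)"
proof -
  define e0 where "e0 = eigvals_desc A ! 0"
  define e1 where "e1 = eigvals_desc A ! 1"
  let ?es = "map complex_of_real (eigvals_desc A)"
  note eig = hermitian_eigvals_desc[OF A]
  have le: "e1 \<le> e0"
    using eig(2,3) n by (simp add: e0_def e1_def sorted_wrt_iff_nth_less)
  have cA: "A \<in> carrier_mat n n" using A by (simp add: hermitian_mat_def)
  have cp: "char_poly A = (\<Prod>e\<leftarrow>?es. [:- e, 1:])" using eig(1) by (simp add: o_def)
  obtain B P Q where BPQ: "schur_decomposition A ?es = (B, P, Q)" by (cases "schur_decomposition A ?es")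
  have wit: "similar_mat_wit A B P Q" and ut: "upper_triangular B" and diag: "diag_mat B = ?es"
    using schur_decomposition[OF cA cp BPQ] by auto
  have c: "B \<in> carrier_mat n n" "P \<in> carrier_mat n n" "Q \<in> carrier_mat n n"
    and QP: "Q * P = 1\<^sub>m n" and APBQ: "A = P * B * Q"
    using similar_mat_witD2[OF cA wit] by auto
  have "A * P = P * B * (Q * P)" unfolding APBQ using c by (simp add: assoc_mult_mat[of _ n n _ n _ n])
  then have AP: "A * P = P * B" using c QP by simp
  have mult: "(M * N) $$ (i, j) = (\<Sum>l<n. M $$ (i, l) * N $$ (l, j))"
    if "M \<in> carrier_mat n n" "N \<in> carrier_mat n n" "i < n" "j < n" for M N :: "complex mat" and i j
    using that by (auto simp: scalar_prod_def atLeast0LessThan)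
  have Bdiag: "B $$ (i, i) = complex_of_real (eigvals_desc A ! i)" if "i < n" for i
  proof -
    have "B $$ (i, i) = diag_mat B ! i" using that c by (simp add: diag_mat_def)
    then show ?thesis using that eig(3) by (simp add: diag)
  qed
  have Blow: "B $$ (i, j) = 0" if "j < i" "i < n" for i j using ut c that by auto
  define p0 where "p0 i = P $$ (i, 0)" for i
  define p1 where "p1 i = P $$ (i, 1)" for i
  define b where "b = B $$ (0, 1)"
  have Ap0: "mat_fun A n p0 i = complex_of_real e0 * p0 i" if "i < n" for i
  proof -
    have "mat_fun A n p0 i = (A * P) $$ (i, 0)"
      using that n c cA by (simp add: mult mat_fun_def p0_def del: index_mult_mat)
    also have "\<dots> = (\<Sum>l<n. P $$ (i, l) * B $$ (l, 0))"
      unfolding AP using that n c by (simp add: mult del: index_mult_mat)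
    also have "\<dots> = (\<Sum>l\<in>{0}. P $$ (i, l) * B $$ (l, 0))"
      using n by (intro sum.mono_neutral_right) (auto simp: Blow)
    finally show ?thesis using n by (simp add: Bdiag e0_def p0_def)
  qed
  have Ap1: "mat_fun A n p1 i = b * p0 i + complex_of_real e1 * p1 i" if "i < n" for i
  proof -
    have "mat_fun A n p1 i = (A * P) $$ (i, 1)"
      using that n c cA by (simp add: mult mat_fun_def p1_def del: index_mult_mat)
    also have "\<dots> = (\<Sum>l<n. P $$ (i, l) * B $$ (l, 1))"
      unfolding AP using that n c by (simp add: mult del: index_mult_mat)
    also have "\<dots> = (\<Sum>l\<in>{0, 1}. P $$ (i, l) * B $$ (l, 1))"
      using n by (intro sum.mono_neutral_right) (auto simp: Blow)
    finally show ?thesis using n Bdiag[of 1] by (simp add: e1_def p0_def p1_def b_def)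
  qed
  have indep: "\<alpha> = 0 \<and> \<beta> = 0" if z: "\<forall>i<n. \<alpha> * p0 i + \<beta> * p1 i = 0" for \<alpha> \<beta>
  proof -
    have "\<alpha> * (Q * P) $$ (r, 0) + \<beta> * (Q * P) $$ (r, 1) = (\<Sum>i<n. Q $$ (r, i) * (\<alpha> * p0 i + \<beta> * p1 i))"
      if "r < n" for r
      using that n c by (simp add: mult p0_def p1_def sum_distrib_left distrib_left sum.distrib mult_ac del: index_mult_mat)
    then have "\<alpha> * (1\<^sub>m n) $$ (r, 0) + \<beta> * (1\<^sub>m n) $$ (r, 1) = 0" if "r < n" for r
      using that z unfolding QP by simp
    from this[of 0] this[of 1] show ?thesis using n by simp
  qed
  have swap: "ip f (mat_fun A n g) {..<n} = ip (mat_fun A n f) g {..<n}" for f g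
    by (rule ip_mat_fun_swap[OF A])
  have key: "(complex_of_real e0 - complex_of_real e1) * ip p0 p1 {..<n} = b * nsq p0 {..<n}"
  proof -
    have "ip p0 (mat_fun A n p1) {..<n} = b * nsq p0 {..<n} + e1 * ip p0 p1 {..<n}"
      by (subst ip_cong[where f' = p0 and g' = "\<lambda>i. b * p0 i + complex_of_real e1 * p1 i"])
        (simp_all add: Ap1 ip_add_right ip_scale_right ip_self)
    moreover have "ip (mat_fun A n p0) p1 {..<n} = e0 * ip p0 p1 {..<n}"
      by (subst ip_cong[where f' = "\<lambda>i. complex_of_real e0 * p0 i" and g' = p1])
        (simp_all add: Ap0 ip_scale_left)
    ultimately show ?thesis using swap[of p0 p1] by (simp add: algebra_simps)
  qed
  show ?thesis
  proof (cases "e0 = e1")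
    case True
    have "nsq p0 {..<n} \<noteq> 0"
    proof
      assume "nsq p0 {..<n} = 0"
      then have "\<forall>i<n. 1 * p0 i + 0 * p1 i = 0" by (simp add: nsq_def sum_nonneg_eq_0_iff)
      then have "(1 :: complex) = 0 \<and> (0 :: complex) = 0" by (rule indep)
      then show False by simp
    qed
    then have b: "b = 0" using key True by simp
    show ?thesis
    proof (unfold e1_def[symmetric], rule exI[of _ p0], rule exI[of _ p1], rule exI[of _ e0], intro conjI)
      show "\<forall>i<n. mat_fun A n p1 i = complex_of_real e1 * p1 i" using Ap1 b by simp
    qed (use le Ap0 indep True in blast)+
  next
    case False
    \<comment> \<open>The solution of b + t * e0 = t * e1, which makes p1 + t p0 an eigenvector for
      e1.\<close>
    define t where "t = b / (complex_of_real e1 - complex_of_real e0)"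
    have ne: "complex_of_real e1 - complex_of_real e0 \<noteq> 0" using False by simp
    then have b: "b = t * (complex_of_real e1 - complex_of_real e0)" by (simp add: t_def)
    define u1 where "u1 i = p1 i + t * p0 i" for i
    have "mat_fun A n u1 i = mat_fun A n p1 i + t * mat_fun A n p0 i" for i
      by (simp add: mat_fun_def u1_def sum_distrib_left sum.distrib algebra_simps)
    then have Au1: "mat_fun A n u1 i = complex_of_real e1 * u1 i" if "i < n" for i
      using that by (simp add: Ap0 Ap1 u1_def b algebra_simps)
    have "ip p0 u1 {..<n} = ip p0 p1 {..<n} + t * nsq p0 {..<n}"
      unfolding u1_def by (simp add: ip_add_right ip_scale_right ip_self)
    then have "(complex_of_real e0 - complex_of_real e1) * ip p0 u1 {..<n} = 0"
      using key by (simp add: b algebra_simps)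
    then have orth: "ip p0 u1 {..<n} = 0" using ne by auto
    have "\<alpha> = 0 \<and> \<beta> = 0" if z: "\<forall>i<n. \<alpha> * p0 i + \<beta> * u1 i = 0" for \<alpha> \<beta>
    proof -
      have "\<forall>i<n. (\<alpha> + \<beta> * t) * p0 i + \<beta> * p1 i = 0"
        using z by (simp add: u1_def algebra_simps)
      then have "\<alpha> + \<beta> * t = 0 \<and> \<beta> = 0" by (rule indep)
      then show ?thesis by auto
    qed
    then show ?thesis
      unfolding e1_def[symmetric] using le Ap0 Au1 orth
      by - (rule exI[of _ p0], rule exI[of _ u1], rule exI[of _ e0], intro conjI, blast+)
  qed
qed

text \<open>The upper bound is one half of Courant-Fischer: the plane spanned by u0 and u1 contains
  a nonzero vector orthogonal to \<psi>, and on this plane the form is at least e1 times the squared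
  norm. The lower bound evaluates the form at u1; it later keeps the gap of the protocol at most
  1.\<close>

lemma second_eigenvalue_bounds:
  assumes A: "hermitian_mat n A" and n: "2 \<le> n"
    and upper: "\<And>f. ip \<psi> f {..<n} = 0 \<Longrightarrow> Re (ip f (mat_fun A n f) {..<n}) \<le> c * nsq f {..<n}"
    and psd: "\<And>f. 0 \<le> Re (ip f (mat_fun A n f) {..<n})"
  shows "eigvals_desc A ! 1 \<le> c" "0 \<le> eigvals_desc A ! 1"
proof -
  define e1 where "e1 = eigvals_desc A ! 1"
  obtain u0 u1 e0 where le: "e1 \<le> e0"
    and A0: "\<And>i. i < n \<Longrightarrow> mat_fun A n u0 i = complex_of_real e0 * u0 i"
    and A1: "\<And>i. i < n \<Longrightarrow> mat_fun A n u1 i = complex_of_real e1 * u1 i"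
    and orth: "e0 = e1 \<or> ip u0 u1 {..<n} = 0"
    and indep: "\<And>\<alpha> \<beta>. \<forall>i<n. \<alpha> * u0 i + \<beta> * u1 i = 0 \<Longrightarrow> \<alpha> = 0 \<and> \<beta> = 0"
    using hermitian_second_eigenvalue[OF A n] unfolding e1_def by blast
  have pos: "0 < nsq (\<lambda>i. \<alpha> * u0 i + \<beta> * u1 i) {..<n}" if "\<alpha> \<noteq> 0 \<or> \<beta> \<noteq> 0" for \<alpha> \<beta>
  proof (rule ccontr)
    assume "\<not> ?thesis"
    then have "nsq (\<lambda>i. \<alpha> * u0 i + \<beta> * u1 i) {..<n} = 0"
      using nsq_nonneg[of "\<lambda>i. \<alpha> * u0 i + \<beta> * u1 i" "{..<n}"] by linarith
    then have "\<forall>i<n. \<alpha> * u0 i + \<beta> * u1 i = 0" by (simp add: nsq_def sum_nonneg_eq_0_iff)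
    then show False using indep that by blast
  qed
  \<comment> \<open>The cross term carries the factor (e0 - e1) * ip u0 u1, which is zero in either
    case of the disjunction.\<close>
  have ray: "Re (ip v (mat_fun A n v) {..<n})
      = e1 * nsq v {..<n} + (e0 - e1) * ((cmod \<alpha>)\<^sup>2 * nsq u0 {..<n})"
    if v: "v = (\<lambda>i. \<alpha> * u0 i + \<beta> * u1 i)" for v \<alpha> \<beta>
  proof -
    have Av: "mat_fun A n v i = complex_of_real e1 * v i + (complex_of_real (e0 - e1) * \<alpha>) * u0 i" if "i < n" for i
    proof -
      have "mat_fun A n v i = \<alpha> * mat_fun A n u0 i + \<beta> * mat_fun A n u1 i"
        by (simp add: mat_fun_def v sum_distrib_left sum.distrib algebra_simps)
      then show ?thesis using that by (simp add: A0 A1 v algebra_simps)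
    qed
    have "ip v (mat_fun A n v) {..<n} = ip v (\<lambda>i. complex_of_real e1 * v i + (complex_of_real (e0 - e1) * \<alpha>) * u0 i) {..<n}"
      by (rule ip_cong) (simp_all add: Av)
    also have "\<dots> = complex_of_real e1 * nsq v {..<n} + complex_of_real (e0 - e1) * (\<alpha> * ip v u0 {..<n})"
      by (simp add: ip_add_right ip_scale_right ip_self)
    also have "ip v u0 {..<n} = cnj (ip u0 v {..<n})" by (rule cnj_ip[symmetric])
    also have "ip u0 v {..<n} = \<alpha> * nsq u0 {..<n} + \<beta> * ip u0 u1 {..<n}"
      by (simp add: v ip_add_right ip_scale_right ip_self)
    also have "complex_of_real (e0 - e1) * (\<alpha> * cnj (\<alpha> * nsq u0 {..<n} + \<beta> * ip u0 u1 {..<n}))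
        = complex_of_real (e0 - e1) * (\<alpha> * cnj \<alpha> * nsq u0 {..<n})"
      using orth by (auto simp: algebra_simps)
    also have "\<alpha> * cnj \<alpha> = complex_of_real ((cmod \<alpha>)\<^sup>2)" by (rule complex_norm_square[symmetric])
    finally show ?thesis by simp
  qed
  show "eigvals_desc A ! 1 \<le> c"
  proof -
    obtain \<alpha> \<beta> where ab: "\<alpha> \<noteq> 0 \<or> \<beta> \<noteq> 0" "\<alpha> * ip \<psi> u0 {..<n} + \<beta> * ip \<psi> u1 {..<n} = 0"
    proof (cases "ip \<psi> u0 {..<n} = 0")
      case True
      then show ?thesis using that[of 1 0] by simp
    next
      case False
      then show ?thesis using that[of "- ip \<psi> u1 {..<n}" "ip \<psi> u0 {..<n}"] by simp
    qed
    define v where "v = (\<lambda>i. \<alpha> * u0 i + \<beta> * u1 i)"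
    have "ip \<psi> v {..<n} = 0" using ab(2) by (simp add: v_def ip_add_right ip_scale_right)
    then have "e1 * nsq v {..<n} + (e0 - e1) * ((cmod \<alpha>)\<^sup>2 * nsq u0 {..<n}) \<le> c * nsq v {..<n}"
      using upper ray[OF v_def] by metis
    moreover have "0 \<le> (e0 - e1) * ((cmod \<alpha>)\<^sup>2 * nsq u0 {..<n})" using le by (simp add: nsq_nonneg)
    ultimately have "e1 * nsq v {..<n} \<le> c * nsq v {..<n}" by linarith
    then show ?thesis using pos[OF ab(1)] unfolding e1_def v_def by simp
  qed
  show "0 \<le> eigvals_desc A ! 1"
  proof -
    let ?v = "\<lambda>i. 0 * u0 i + 1 * u1 i"
    have "Re (ip ?v (mat_fun A n ?v) {..<n}) = e1 * nsq ?v {..<n}"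
      using ray[of ?v 0 1] by simp
    then have "0 \<le> e1 * nsq ?v {..<n}" using psd[of ?v] by simp
    then show ?thesis using pos[of 0 1] unfolding e1_def by (simp add: zero_le_mult_iff)
  qed
qed

section \<open>Matrix entries of the tests\<close>

definition pair_set :: "nat \<times> nat \<Rightarrow> nat set" where
  "pair_set k = {fst k, snd k}"

text \<open>The division by zero yields 0 exactly on the branches of probability zero, which the
  protocol rejects.\<close>

definition pair_kernel :: "(nat set \<Rightarrow> complex) \<Rightarrow> nat set \<Rightarrow> nat set \<Rightarrow> nat set \<Rightarrow> complex" where
  "pair_kernel g K x y =
     (if x - K = y - K then g x * cnj (g y) / complex_of_real (nsq g (sector K (x - K))) else 0)"

text \<open>The quadratic form of the projector onto the branches of the pair K: the squared
  overlaps of F with the normalized conditional states, summed over the outcomes A outside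
  K.\<close>

definition pair_form :: "nat \<Rightarrow> (nat set \<Rightarrow> complex) \<Rightarrow> nat set \<Rightarrow> (nat set \<Rightarrow> complex) \<Rightarrow> real" where
  "pair_form d g K F = (\<Sum>A\<in>Pow ({..<d} - K). (cmod (ip g F (sector K A)))\<^sup>2 / nsq g (sector K A))"

lemma bij_pair_set: "bij_betw pair_set (qubit_pairs d) {K. K \<subseteq> {..<d} \<and> card K = 2}"
proof (rule bij_betw_imageI)
  show "inj_on pair_set (qubit_pairs d)"
    by (auto simp: inj_on_def qubit_pairs_def pair_set_def doubleton_eq_iff)
  show "pair_set ` qubit_pairs d = {K. K \<subseteq> {..<d} \<and> card K = 2}"
  proof (intro equalityI subsetI)
    fix K assume K: "K \<in> {K. K \<subseteq> {..<d} \<and> card K = 2}"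
    then obtain a b where ab: "K = {a, b}" "a \<noteq> b" by (auto simp: card_2_iff)
    then have "K = pair_set (min a b, max a b)" "(min a b, max a b) \<in> qubit_pairs d"
      using K by (auto simp: pair_set_def qubit_pairs_def min_def max_def)
    then show "K \<in> pair_set ` qubit_pairs d" by blast
  qed (auto simp: qubit_pairs_def pair_set_def)
qed

lemma card_qubit_pairs: "card (qubit_pairs d) = d choose 2"
  using bij_betw_same_card[OF bij_pair_set, of d] n_subsets[of "{..<d}" 2] by simp

lemma sum_Pow_sectors:
  assumes K: "K \<subseteq> {..<d}"
  shows "(\<Sum>x\<in>Pow {..<d}. h x) = (\<Sum>A\<in>Pow ({..<d} - K). \<Sum>x\<in>sector K A. h x)"
proof -
  have sec: "sector K A = {x \<in> Pow {..<d}. x - K = A}" if "A \<in> Pow ({..<d} - K)" for A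
    using that K by (auto simp: sector_def)
  have "(\<Sum>A\<in>Pow ({..<d} - K). \<Sum>x\<in>sector K A. h x)
      = (\<Sum>A\<in>Pow ({..<d} - K). \<Sum>x | x \<in> Pow {..<d} \<and> x - K = A. h x)"
    by (rule sum.cong) (auto simp: sec)
  also have "\<dots> = (\<Sum>x\<in>Pow {..<d}. h x)"
    by (rule sum.group) auto
  finally show ?thesis by simp
qed

lemma sector_full: "sector {..<d} {} = Pow {..<d}"
  by (auto simp: sector_def)

text \<open>The kernel is block diagonal over the sectors of K, and each block is the rank-one
  projector onto the restriction of g, or zero if that restriction vanishes.\<close>

lemma pair_kernel_form:
  assumes K: "K \<subseteq> {..<d}"
  shows "(\<Sum>x\<in>Pow {..<d}. \<Sum>y\<in>Pow {..<d}. cnj (F x) * pair_kernel g K x y * F y)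
    = complex_of_real (pair_form d g K F)"
proof -
  have inner: "(\<Sum>y\<in>Pow {..<d}. cnj (F x) * pair_kernel g K x y * F y)
      = cnj (F x) * g x * ip g F (sector K A) / complex_of_real (nsq g (sector K A))"
    if A: "A \<in> Pow ({..<d} - K)" and x: "x \<in> sector K A" for x A
  proof -
    have xA: "x - K = A" using x by (simp add: sector_def)
    have "(\<Sum>y\<in>Pow {..<d}. cnj (F x) * pair_kernel g K x y * F y)
        = (\<Sum>y\<in>sector K A. cnj (F x) * (g x * cnj (g y) / complex_of_real (nsq g (sector K A))) * F y)"
    proof (rule sum.mono_neutral_cong_right)
      show "sector K A \<subseteq> Pow {..<d}" using A K by (auto simp: sector_def)
    qed (use xA in \<open>auto simp: pair_kernel_def sector_def\<close>)
    then show ?thesis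
      by (simp add: ip_def sum_distrib_left sum_divide_distrib mult_ac)
  qed
  have "(\<Sum>x\<in>Pow {..<d}. \<Sum>y\<in>Pow {..<d}. cnj (F x) * pair_kernel g K x y * F y)
      = (\<Sum>A\<in>Pow ({..<d} - K). \<Sum>x\<in>sector K A. cnj (F x) * g x * ip g F (sector K A) / complex_of_real (nsq g (sector K A)))"
    unfolding sum_Pow_sectors[OF K, of "\<lambda>x. \<Sum>y\<in>Pow {..<d}. cnj (F x) * pair_kernel g K x y * F y"]
    by (intro sum.cong refl) (simp only: inner)
  also have "\<dots> = (\<Sum>A\<in>Pow ({..<d} - K). ip F g (sector K A) * ip g F (sector K A) / complex_of_real (nsq g (sector K A)))"
    unfolding ip_def[of F] by (simp add: sum_distrib_right sum_divide_distrib)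
  also have "\<dots> = complex_of_real (pair_form d g K F)"
    unfolding pair_form_def of_real_sum
    by (intro sum.cong refl) (simp add: cnj_ip[of g F, symmetric] complex_norm_square mult.commute del: of_real_power)
  finally show ?thesis .
qed

lemma pair_form_nonneg: "0 \<le> pair_form d g K F"
  by (simp add: pair_form_def sum_nonneg nsq_nonneg)

text \<open>The bridge to the tensorization: the defects over the sectors of K add up to the form of
  the complementary projector.\<close>

lemma pair_form_defect:
  assumes K: "K \<subseteq> {..<d}"
  shows "pair_form d g K F = nsq F (Pow {..<d}) - (\<Sum>A\<in>Pow ({..<d} - K). defect g F (sector K A))"
  using sum_Pow_sectors[OF K, of "\<lambda>x. (cmod (F x))\<^sup>2"]
  by (simp add: pair_form_def defect_def nsq_def sum_subtractf)

lemma pair_form_le: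
  assumes K: "K \<subseteq> {..<d}"
  shows "pair_form d g K F \<le> nsq F (Pow {..<d})"
proof -
  have "finite K" using K by (rule finite_subset) simp
  \<comment> \<open>With the empty family, the Bessel inequality is Cauchy-Schwarz: 0 is at most
    twice the defect.\<close>
  then have "0 \<le> defect g F (sector K A)" for A
    using near_orthogonal_bessel[of "sector K A" "{}" g "\<lambda>_. g" F] by (simp add: finite_sector)
  then show ?thesis by (simp add: pair_form_defect[OF K] sum_nonneg)
qed

text \<open>For F orthogonal to g, the defect over the full cube is the whole squared norm, so
  tensorization bounds the sum of the complementary forms from below by one squared norm.
  Subtracting from the number of pairs gives the factor.\<close>

lemma sum_pair_form_le:
  assumes wick: "wick_relations d g" and d: "2 \<le> d" and orth: "ip g F (Pow {..<d}) = 0"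
  shows "(\<Sum>k\<in>qubit_pairs d. pair_form d g (pair_set k) F) \<le> (real (d choose 2) - 1) * nsq F (Pow {..<d})"
proof -
  have "nsq F (Pow {..<d}) = defect g F (sector {..<d} {})"
    by (simp add: defect_def sector_full orth)
  also have "\<dots> \<le> (\<Sum>K | K \<subseteq> {..<d} \<and> card K = 2. \<Sum>A\<in>Pow ({..<d} - K). defect g F (sector K ({} \<union> A)))"
    by (rule defect_pair_tensorization[OF wick]) (use d in auto)
  also have "\<dots> = (\<Sum>K | K \<subseteq> {..<d} \<and> card K = 2. nsq F (Pow {..<d}) - pair_form d g K F)"
    by (intro sum.cong refl) (simp add: pair_form_defect)
  also have "\<dots> = (\<Sum>k\<in>qubit_pairs d. nsq F (Pow {..<d}) - pair_form d g (pair_set k) F)"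
    by (rule sum.reindex_bij_betw[OF bij_pair_set, symmetric])
  also have "\<dots> = real (d choose 2) * nsq F (Pow {..<d}) - (\<Sum>k\<in>qubit_pairs d. pair_form d g (pair_set k) F)"
    by (simp add: sum_subtractf card_qubit_pairs)
  finally show ?thesis by (simp add: algebra_simps)
qed

lemma pair_kernel_hermitian: "pair_kernel g K x y = cnj (pair_kernel g K y x)"
  by (auto simp: pair_kernel_def)

section \<open>Measurement outcomes and conditional amplitudes in terms of sets\<close>

definition outcome_of :: "nat \<Rightarrow> nat \<times> nat \<Rightarrow> nat set \<Rightarrow> nat \<Rightarrow> nat" where
  "outcome_of d k x = restrict (\<lambda>j. of_bool (j \<in> x)) ({..<d} - pair_set k)"

lemma outcome_of_in_outcomes: "outcome_of d k x \<in> outcomes d k"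
  by (cases k) (auto simp: outcome_of_def outcomes_def pair_set_def restrict_def PiE_def extensional_def)

lemma outcome_of_eq_iff:
  assumes "x \<subseteq> {..<d}" "y \<subseteq> {..<d}"
  shows "outcome_of d k x = outcome_of d k y \<longleftrightarrow> x - pair_set k = y - pair_set k"
proof
  assume e: "outcome_of d k x = outcome_of d k y"
  have "j \<in> x \<longleftrightarrow> j \<in> y" if "j \<in> {..<d} - pair_set k" for j
    using fun_cong[OF e, of j] that by (simp add: outcome_of_def of_bool_eq_iff)
  then show "x - pair_set k = y - pair_set k" using assms by blast
next
  assume "x - pair_set k = y - pair_set k"
  then have "j \<in> x \<longleftrightarrow> j \<in> y" if "j \<in> {..<d} - pair_set k" for j using that by blast
  then show "outcome_of d k x = outcome_of d k y" by (auto simp: outcome_of_def restrict_def fun_eq_iff)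
qed

lemma matches_outcome_iff:
  assumes "z \<in> outcomes d k" "x \<subseteq> {..<d}"
  shows "(\<forall>j\<in>{..<d} - pair_set k. qbit (set_encode x) j = z j) \<longleftrightarrow> z = outcome_of d k x"
  using assms by (cases k)
    (auto simp: outcome_of_def outcomes_def pair_set_def restrict_def fun_eq_iff PiE_def extensional_def qbit_set_encode)

definition put_bit :: "nat \<Rightarrow> nat \<Rightarrow> nat set \<Rightarrow> nat set" where
  "put_bit j b x = (if b = 0 then x - {j} else insert j x)"

lemma basis_index_set: "x \<subseteq> {..<d} \<Longrightarrow> basis_index d (\<lambda>j. of_bool (j \<in> x)) = set_encode x"
  unfolding basis_index_def set_encode_def
  by (rule sum.mono_neutral_cong_right) auto

lemma amplitude_outcome:
  assumes k: "k \<in> qubit_pairs d" and x: "x \<subseteq> {..<d}" and b: "b1 \<in> {0, 1}" "b2 \<in> {0, 1}"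
  shows "amplitude d \<psi> k (outcome_of d k x) b1 b2 = set_fun d \<psi> (put_bit (fst k) b1 (put_bit (snd k) b2 x))"
proof -
  obtain k1 k2 where kk: "k = (k1, k2)" "k1 < k2" "k2 < d" using k by (auto simp: qubit_pairs_def)
  let ?y = "put_bit k1 b1 (put_bit k2 b2 x)"
  have y: "?y \<subseteq> {..<d}" using x kk by (auto simp: put_bit_def)
  have "basis_index d ((outcome_of d k x)(k1 := b1, k2 := b2)) = basis_index d (\<lambda>j. of_bool (j \<in> ?y))"
    unfolding basis_index_def using kk b
    by (intro sum.cong refl) (auto simp: outcome_of_def pair_set_def put_bit_def)
  then show ?thesis using y kk by (simp add: amplitude_def basis_index_set set_fun_def)
qed

lemma branch_prob_outcome:
  assumes k: "k \<in> qubit_pairs d" and x: "x \<subseteq> {..<d}"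
  shows "branch_prob d \<psi> k (outcome_of d k x) = nsq (set_fun d \<psi>) (sector (pair_set k) (x - pair_set k))"
proof -
  obtain k1 k2 where kk: "k = (k1, k2)" "k1 < k2" "k2 < d" using k by (auto simp: qubit_pairs_def)
  then have fs: "fst k = k1" "snd k = k2" by auto
  let ?r = "x - {k1, k2}" and ?g = "\<lambda>y. (cmod (set_fun d \<psi> y))\<^sup>2"
  have sec: "sector (pair_set k) (x - pair_set k) = {?r, insert k1 ?r, insert k2 ?r, insert k1 (insert k2 ?r)}"
    (is "?S = ?T")
  proof (intro equalityI subsetI)
    fix y assume "y \<in> ?S"
    then have "y - {k1, k2} = ?r" by (simp add: sector_def pair_set_def kk)
    then have "y = ?r \<union> (y \<inter> {k1, k2})" by blast
    moreover have "y \<inter> {k1, k2} \<in> {{}, {k1}, {k2}, {k1, k2}}" by blast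
    ultimately obtain B where "y = ?r \<union> B" "B \<in> {{}, {k1}, {k2}, {k1, k2}}" by blast
    then show "y \<in> ?T" by auto
  qed (auto simp: sector_def pair_set_def kk)
  have sb: "put_bit k1 0 (put_bit k2 0 x) = ?r" "put_bit k1 1 (put_bit k2 0 x) = insert k1 ?r"
    "put_bit k1 0 (put_bit k2 1 x) = insert k2 ?r" "put_bit k1 1 (put_bit k2 1 x) = insert k1 (insert k2 ?r)"
    using kk by (auto simp: put_bit_def)
  have ne: "?r \<noteq> insert k1 ?r" "?r \<noteq> insert k2 ?r" "?r \<noteq> insert k1 (insert k2 ?r)"
    "insert k1 ?r \<noteq> insert k2 ?r" "insert k1 ?r \<noteq> insert k1 (insert k2 ?r)"
    "insert k2 ?r \<noteq> insert k1 (insert k2 ?r)"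
    using kk by auto
  have "branch_prob d \<psi> k (outcome_of d k x) = ?g ?r + ?g (insert k2 ?r) + (?g (insert k1 ?r) + ?g (insert k1 (insert k2 ?r)))"
    using sb by (simp add: branch_prob_def amplitude_outcome[OF k x] fs add_ac)
  also have "\<dots> = nsq (set_fun d \<psi>) ?T"
    using ne by (simp add: nsq_def)
  finally show ?thesis unfolding sec .
qed

lemma cond_pair_outcome:
  assumes k: "k \<in> qubit_pairs d" and x: "x \<subseteq> {..<d}" and b: "b1 \<in> {0, 1}" "b2 \<in> {0, 1}"
  shows "cond_pair d \<psi> k (outcome_of d k x) b1 b2
    = set_fun d \<psi> (put_bit (fst k) b1 (put_bit (snd k) b2 x))
      / complex_of_real (sqrt (nsq (set_fun d \<psi>) (sector (pair_set k) (x - pair_set k))))"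
  by (simp only: cond_pair_def amplitude_outcome[OF assms] branch_prob_outcome[OF k x])

lemma put_bit_self: "put_bit j (of_bool (j \<in> x)) x = x"
  by (auto simp: put_bit_def)

lemma finite_branches: "finite (branches d \<psi> k)"
proof -
  have "finite (outcomes d k)" by (cases k) (auto simp: outcomes_def intro!: finite_PiE)
  then show ?thesis by (simp add: branches_def)
qed

text \<open>An entry in row x involves only the outcome read off from x. If that outcome is a
  rejected branch, it is missing from the sum, and \<open>h0\<close> says that its term would have
  been 0 anyway.\<close>

lemma sum_branches_outcome:
  fixes h :: "_ \<Rightarrow> complex"
  assumes k: "k \<in> qubit_pairs d" and x: "x \<subseteq> {..<d}"
    and h: "\<And>z. z \<in> outcomes d k \<Longrightarrow> z \<noteq> outcome_of d k x \<Longrightarrow> h z = 0"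
    and h0: "nsq (set_fun d \<psi>) (sector (pair_set k) (x - pair_set k)) = 0 \<Longrightarrow> h (outcome_of d k x) = 0"
  shows "(\<Sum>z\<in>branches d \<psi> k. h z) = h (outcome_of d k x)"
proof (cases "outcome_of d k x \<in> branches d \<psi> k")
  case True
  have "(\<Sum>z\<in>branches d \<psi> k. h z) = (\<Sum>z\<in>{outcome_of d k x}. h z)"
    by (rule sum.mono_neutral_right[OF finite_branches]) (use True h in \<open>auto simp: branches_def\<close>)
  then show ?thesis by simp
next
  case False
  then have "nsq (set_fun d \<psi>) (sector (pair_set k) (x - pair_set k)) = 0"
    using branch_prob_outcome[OF k x] outcome_of_in_outcomes by (simp add: branches_def)
  moreover have "(\<Sum>z\<in>branches d \<psi> k. h z) = 0"
    by (rule sum.neutral) (use False h in \<open>auto simp: branches_def\<close>)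
  ultimately show ?thesis using h0 by simp
qed

lemma branch_projectors_index:
  assumes k: "k \<in> qubit_pairs d" and x: "x \<subseteq> {..<d}" and y: "y \<subseteq> {..<d}"
  shows "(\<Sum>z\<in>branches d \<psi> k. ketbra (branch_vec d \<psi> k z) (branch_vec d \<psi> k z) $$ (set_encode x, set_encode y))
    = pair_kernel (set_fun d \<psi>) (pair_set k) x y"
proof -
  let ?g = "set_fun d \<psi>" and ?K = "pair_set k"
  let ?p = "\<lambda>x. nsq ?g (sector ?K (x - ?K))"
  have bv: "branch_vec d \<psi> k z $ set_encode x = (if z = outcome_of d k x then ?g x / complex_of_real (sqrt (?p x)) else 0)"
    if z: "z \<in> outcomes d k" and x: "x \<subseteq> {..<d}" for z x
  proof -
    have "branch_vec d \<psi> k z $ set_encode x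
      = (if z = outcome_of d k x then cond_pair d \<psi> k z (of_bool (fst k \<in> x)) (of_bool (snd k \<in> x)) else 0)"
      using set_encode_less[OF x] matches_outcome_iff[OF z x]
      by (simp add: branch_vec_def qbit_set_encode[OF x] pair_set_def)
    then show ?thesis
      by (auto simp: cond_pair_outcome[OF k x] put_bit_self)
  qed
  let ?h = "\<lambda>z. ketbra (branch_vec d \<psi> k z) (branch_vec d \<psi> k z) $$ (set_encode x, set_encode y)"
  have h: "?h z = (if z = outcome_of d k x \<and> z = outcome_of d k y
      then ?g x * cnj (?g y) / (complex_of_real (sqrt (?p x)) * complex_of_real (sqrt (?p y))) else 0)"
    if "z \<in> outcomes d k" for z
  proof -
    have "dim_vec (branch_vec d \<psi> k z) = 2 ^ d" by (simp add: branch_vec_def)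
    then have "?h z = branch_vec d \<psi> k z $ set_encode x * cnj (branch_vec d \<psi> k z $ set_encode y)"
      using set_encode_less[OF x] set_encode_less[OF y] by (simp add: ketbra_def)
    then show ?thesis by (simp add: bv[OF that x] bv[OF that y])
  qed
  have "(\<Sum>z\<in>branches d \<psi> k. ?h z) = ?h (outcome_of d k x)"
    by (rule sum_branches_outcome[OF k x]) (auto simp: h outcome_of_in_outcomes)
  also have "\<dots> = pair_kernel ?g ?K x y"
  proof (cases "x - ?K = y - ?K")
    case True
    then have "complex_of_real (sqrt (?p x)) * complex_of_real (sqrt (?p y)) = complex_of_real (?p x)"
      by (simp add: nsq_nonneg flip: of_real_mult)
    then show ?thesis
      using True h[OF outcome_of_in_outcomes, of x] outcome_of_eq_iff[OF x y, of k]
      by (simp add: pair_kernel_def)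
  next
    case False
    then show ?thesis
      using h[OF outcome_of_in_outcomes, of x] outcome_of_eq_iff[OF x y, of k]
      by (simp add: pair_kernel_def)
  qed
  finally show ?thesis .
qed

text \<open>The cross terms cancel in the sum over the two X-outcomes; for \<open>\<psi>\<close> of definite parity, the
  second kernel lives on the opposite parity sector.\<close>

lemma E_test_index:
  assumes k: "k \<in> qubit_pairs d" and x: "x \<subseteq> {..<d}" and y: "y \<subseteq> {..<d}"
  shows "E_test d \<psi> k $$ (set_encode x, set_encode y)
    = pair_kernel (set_fun d \<psi>) (pair_set k) x y
      + pair_kernel (set_fun d \<psi>) (pair_set k) (toggle (fst k) x) (toggle (fst k) y)"
proof -
  obtain k1 k2 where kk: "k = (k1, k2)" "k1 < k2" "k2 < d" using k by (auto simp: qubit_pairs_def)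
  let ?g = "set_fun d \<psi>" and ?K = "pair_set k" and ?t = "toggle k1"
  let ?p = "\<lambda>x. nsq ?g (sector ?K (x - ?K))"
  define F where "F z s j = (if j = fst k then ketbra (x_ket s) (x_ket s)
      else if j = snd k then ketbra (cond_single d \<psi> k z s) (cond_single d \<psi> k z s)
      else ketbra (unit_vec 2 (z j)) (unit_vec 2 (z j)))" for z :: "nat \<Rightarrow> nat" and s j
  \<comment> \<open>The component at x of the product vector tested in the branch of x with
    X-outcome s, times sqrt 2. For k1 in x, the extra factor s from the X-eigenstate and s * s = 1
    bring both cases into this common form.\<close>
  define a where "a s x = (?g x + s * ?g (?t x)) / complex_of_real (sqrt (?p x))" for s x
  let ?e = "\<lambda>z s. tensor_op d (F z s) $$ (set_encode x, set_encode y)"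
  have lt: "(of_bool P :: nat) < 2" for P by simp
  have xk: "x_ket s $ of_bool P = (if P then s else 1) / complex_of_real (sqrt 2)" for s P
    by (simp add: x_ket_def)
  have cs: "(if k1 \<in> x then s else 1) * cond_single d \<psi> k (outcome_of d k x) s $ of_bool (k2 \<in> x) = a s x"
    if "s \<in> {1, - 1}" "x \<subseteq> {..<d}" for s x
  proof -
    have b: "put_bit k1 b (put_bit k2 (of_bool (k2 \<in> x)) x) = put_bit k1 b x" for b
      by (simp only: put_bit_self)
    have c: "cond_pair d \<psi> k (outcome_of d k x) b (of_bool (k2 \<in> x))
        = ?g (put_bit k1 b x) / complex_of_real (sqrt (?p x))" if "b \<in> {0, 1}" for b
    proof -
      have "of_bool (k2 \<in> x) \<in> {0, 1 :: nat}" by simp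
      from cond_pair_outcome[OF k \<open>x \<subseteq> {..<d}\<close> that this] show ?thesis
        by (simp only: kk fst_conv snd_conv b)
    qed
    have "cond_single d \<psi> k (outcome_of d k x) s $ of_bool (k2 \<in> x)
        = (?g (x - {k1}) + s * ?g (insert k1 x)) / complex_of_real (sqrt (?p x))"
      unfolding cond_single_def index_vec[OF lt]
      by (subst (1 2) c) (simp_all add: put_bit_def add_divide_distrib)
    moreover have "x - {k1} = (if k1 \<in> x then ?t x else x)" "insert k1 x = (if k1 \<in> x then x else ?t x)"
      by (auto simp: toggle_def)
    ultimately show ?thesis using that(1) by (auto simp: a_def)
  qed
  have e: "?e z s = (if z = outcome_of d k x \<and> z = outcome_of d k y then a s x * cnj (a s y) / 2 else 0)"
    if z: "z \<in> outcomes d k" and s: "s \<in> {1, - 1}" for z s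
  proof -
    have rest: "F z s j $$ (qbit (set_encode x) j, qbit (set_encode y) j)
        = of_bool (qbit (set_encode x) j = z j \<and> qbit (set_encode y) j = z j)"
      if "j \<in> {..<d} - ?K" for j
    proof -
      have "z j \<in> {0, 1}" using z that by (cases k) (auto simp: outcomes_def pair_set_def)
      then show ?thesis
        using that by (auto simp: F_def pair_set_def ketbra_def qbit_set_encode[OF x] qbit_set_encode[OF y])
    qed
    have "?e z s = (\<Prod>j<d. F z s j $$ (qbit (set_encode x) j, qbit (set_encode y) j))"
      using set_encode_less[OF x] set_encode_less[OF y] by (simp add: tensor_op_def)
    also have "{..<d} = insert k1 (insert k2 ({..<d} - ?K))" using kk by (auto simp: pair_set_def)
    also have "(\<Prod>j\<in>\<dots>. F z s j $$ (qbit (set_encode x) j, qbit (set_encode y) j))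
        = F z s k1 $$ (of_bool (k1 \<in> x), of_bool (k1 \<in> y)) * (F z s k2 $$ (of_bool (k2 \<in> x), of_bool (k2 \<in> y))
          * (\<Prod>j\<in>{..<d} - ?K. F z s j $$ (qbit (set_encode x) j, qbit (set_encode y) j)))"
      using kk by (simp add: pair_set_def qbit_set_encode[OF x] qbit_set_encode[OF y])
    also have "(\<Prod>j\<in>{..<d} - ?K. F z s j $$ (qbit (set_encode x) j, qbit (set_encode y) j))
        = (\<Prod>j\<in>{..<d} - ?K. of_bool (qbit (set_encode x) j = z j \<and> qbit (set_encode y) j = z j))"
      by (rule prod.cong[OF refl rest])
    also have "\<dots> = of_bool (z = outcome_of d k x \<and> z = outcome_of d k y)"
      unfolding matches_outcome_iff[OF z x, symmetric] matches_outcome_iff[OF z y, symmetric]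
      by (auto simp: of_bool_def prod_zero_iff intro!: prod.neutral)
    also have "F z s k1 $$ (of_bool (k1 \<in> x), of_bool (k1 \<in> y))
        = (if k1 \<in> x then s else 1) * cnj (if k1 \<in> y then s else 1) / 2"
    proof -
      have "dim_vec (x_ket s) = 2" by (simp add: x_ket_def)
      then have "F z s k1 $$ (of_bool (k1 \<in> x), of_bool (k1 \<in> y))
          = x_ket s $ of_bool (k1 \<in> x) * cnj (x_ket s $ of_bool (k1 \<in> y))"
        by (simp add: F_def kk ketbra_def)
      moreover have "complex_of_real (sqrt 2) * complex_of_real (sqrt 2) = 2"
        by (simp flip: of_real_mult)
      ultimately show ?thesis by (simp add: xk)
    qed
    also have "F z s k2 $$ (of_bool (k2 \<in> x), of_bool (k2 \<in> y))
        = cond_single d \<psi> k z s $ of_bool (k2 \<in> x) * cnj (cond_single d \<psi> k z s $ of_bool (k2 \<in> y))"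
      using kk by (simp add: F_def ketbra_def cond_single_def)
    finally have e: "?e z s = (if k1 \<in> x then s else 1) * cnj (if k1 \<in> y then s else 1) / 2
      * (cond_single d \<psi> k z s $ of_bool (k2 \<in> x) * cnj (cond_single d \<psi> k z s $ of_bool (k2 \<in> y))
        * of_bool (z = outcome_of d k x \<and> z = outcome_of d k y))" .
    show ?thesis
    proof (cases "z = outcome_of d k x \<and> z = outcome_of d k y")
      case True
      then have "a s x = (if k1 \<in> x then s else 1) * cond_single d \<psi> k z s $ of_bool (k2 \<in> x)"
        and "a s y = (if k1 \<in> y then s else 1) * cond_single d \<psi> k z s $ of_bool (k2 \<in> y)"
        using cs[OF s x] cs[OF s y] by auto
      then have "?e z s = (a s x * cnj (a s y)) / 2 * of_bool (z = outcome_of d k x \<and> z = outcome_of d k y)"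
        unfolding e
        by (simp only: complex_cnj_mult mult_ac times_divide_eq_left times_divide_eq_right)
      moreover have "(z = outcome_of d k x \<and> z = outcome_of d k y) = True" using True by blast
      ultimately show ?thesis by (simp only: if_True of_bool_eq mult_1_right)
    next
      case False
      then show ?thesis unfolding e by auto
    qed
  qed
  have "E_test d \<psi> k $$ (set_encode x, set_encode y) = (\<Sum>(z, s)\<in>branches d \<psi> k \<times> {1, - 1}. ?e z s)"
    using set_encode_less[OF x] set_encode_less[OF y]
    by (simp add: E_test_def msum_def F_def[abs_def] split_def)
  also have "\<dots> = (\<Sum>z\<in>branches d \<psi> k. ?e z 1 + ?e z (- 1))"
    by (subst sum.cartesian_product[symmetric]) simp
  also have "\<dots> = ?e (outcome_of d k x) 1 + ?e (outcome_of d k x) (- 1)"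
    by (rule sum_branches_outcome[OF k x]) (auto simp: e outcome_of_in_outcomes a_def)
  also have "\<dots> = pair_kernel ?g ?K x y + pair_kernel ?g ?K (?t x) (?t y)"
  proof -
    have tK: "?t x - ?K = x - ?K" for x using kk by (auto simp: toggle_def pair_set_def)
    show ?thesis
    proof (cases "x - ?K = y - ?K")
      case True
      have sq: "complex_of_real (sqrt (?p y)) * complex_of_real (sqrt (?p y)) = complex_of_real (?p y)"
        by (simp add: nsq_nonneg flip: of_real_mult)
      have "a 1 x * cnj (a 1 y) / 2 + a (- 1) x * cnj (a (- 1) y) / 2
          = (?g x * cnj (?g y) + ?g (?t x) * cnj (?g (?t y))) / (complex_of_real (sqrt (?p y)) * complex_of_real (sqrt (?p y)))"
        unfolding a_def True
        by (simp add: algebra_simps add_divide_distrib[symmetric] diff_divide_distrib[symmetric])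
          (simp only: distrib_left[symmetric] mult_divide_mult_cancel_left_if, simp)
      then show ?thesis
        using True outcome_of_eq_iff[OF x y, of k] unfolding sq
        by (simp add: e outcome_of_in_outcomes pair_kernel_def tK add_divide_distrib)
    next
      case False
      then show ?thesis
        using outcome_of_eq_iff[OF x y, of k] by (simp add: e outcome_of_in_outcomes pair_kernel_def tK)
    qed
  qed
  finally show ?thesis by (simp add: kk)
qed

section \<open>Spectral bounds\<close>

lemma parity_set_encode:
  "x \<subseteq> {..<d} \<Longrightarrow> (\<Prod>j<d. (- 1) ^ qbit (set_encode x) j) = jw_sign d x"
proof -
  assume x: "x \<subseteq> {..<d}"
  have "(\<Prod>j<d. (- 1) ^ qbit (set_encode x) j) = (\<Prod>j<d. if j \<in> x \<inter> {..<d} then - 1 else (1 :: complex))"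
    by (intro prod.cong refl) (auto simp: qbit_set_encode[OF x])
  also have "\<dots> = (\<Prod>j\<in>x \<inter> {..<d}. - 1)"
    by (intro prod.mono_neutral_cong_right) auto
  finally show ?thesis by (simp add: jw_sign_def)
qed

lemma set_encode_inject:
  "x \<subseteq> {..<d} \<Longrightarrow> y \<subseteq> {..<d} \<Longrightarrow> set_encode x = set_encode y \<longleftrightarrow> x = y"
  by (intro set_encode_eq) (auto intro: finite_subset)

lemma parity_projector_index:
  assumes "\<sigma> \<in> {1, - 1}" "x \<subseteq> {..<d}" "y \<subseteq> {..<d}"
  shows "parity_projector d \<sigma> $$ (set_encode x, set_encode y) = of_bool (x = y \<and> jw_sign d x = \<sigma>)"
  using assms
  by (auto simp: parity_projector_eq(1)[OF assms(1)] set_encode_less parity_set_encode set_encode_inject)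

lemma has_parity_support:
  assumes "has_parity d \<sigma> \<psi>" "x \<subseteq> {..<d}" "jw_sign d x \<noteq> \<sigma>"
  shows "set_fun d \<psi> x = 0"
proof -
  have cP: "parity_op d \<in> carrier_mat (2 ^ d) (2 ^ d)" by (simp add: parity_op_def tensor_op_def)
  have v: "\<psi> \<in> carrier_vec (2 ^ d)" "parity_op d *\<^sub>v \<psi> = \<sigma> \<cdot>\<^sub>v \<psi>"
    using assms(1) cP by (auto simp: has_parity_def eigenvector_def)
  note X = set_encode_less[OF assms(2)]
  have "\<sigma> * \<psi> $ set_encode x = (parity_op d *\<^sub>v \<psi>) $ set_encode x" using v X by simp
  also have "\<dots> = (\<Sum>y\<in>Pow {..<d}. if y = x then jw_sign d x * \<psi> $ set_encode y else 0)"
    unfolding mult_mat_vec_set_encode[OF cP v(1) assms(2)]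
    by (intro sum.cong refl)
      (use assms(2) X in \<open>auto simp: parity_op_diag set_encode_less parity_set_encode set_encode_inject\<close>)
  also have "\<dots> = jw_sign d x * \<psi> $ set_encode x" using assms(2) by simp
  finally show ?thesis using assms(2,3) by (simp add: set_fun_def)
qed

lemma Omega0_carrier: "Omega0 d \<psi> \<in> carrier_mat (2 ^ d) (2 ^ d)"
  by (simp add: Omega0_def msum_def)

lemma parity_projector_carrier: "\<sigma> \<in> {1, - 1} \<Longrightarrow> parity_projector d \<sigma> \<in> carrier_mat (2 ^ d) (2 ^ d)"
  by (simp add: parity_projector_eq(1))

lemma Omega0_index:
  assumes x: "x \<subseteq> {..<d}" and y: "y \<subseteq> {..<d}"
  shows "Omega0 d \<psi> $$ (set_encode x, set_encode y)
    = (\<Sum>k\<in>qubit_pairs d. pair_kernel (set_fun d \<psi>) (pair_set k) x y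
        + pair_kernel (set_fun d \<psi>) (pair_set k) (toggle (fst k) x) (toggle (fst k) y)) / of_nat (d choose 2)"
  using set_encode_less[OF x] set_encode_less[OF y]
  by (simp add: Omega0_def msum_def E_test_index[OF _ x y])

lemma mult_mat_set_encode:
  assumes "A \<in> carrier_mat (2 ^ d) (2 ^ d)" "B \<in> carrier_mat (2 ^ d) (2 ^ d)" "x \<subseteq> {..<d}" "y \<subseteq> {..<d}"
  shows "(A * B) $$ (set_encode x, set_encode y)
    = (\<Sum>w\<in>Pow {..<d}. A $$ (set_encode x, set_encode w) * B $$ (set_encode w, set_encode y))"
proof -
  have "(A * B) $$ (set_encode x, set_encode y)
      = (\<Sum>b<2 ^ d. A $$ (set_encode x, b) * B $$ (b, set_encode y))"
    using assms(1,2) set_encode_less[OF assms(3)] set_encode_less[OF assms(4)]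
    by (auto simp: scalar_prod_def atLeast0LessThan)
  then show ?thesis by (simp only: sum_set_encode)
qed

text \<open>Toggling one mode flips the parity. Between two sets of parity \<sigma> the second
  kernel of the test therefore evaluates \<psi> at the wrong parity and vanishes. If x or y has the
  wrong parity, the projector gives 0 on the left and the support of \<psi> gives 0 on the
  right.\<close>

lemma L_op_index:
  assumes par: "has_parity d \<sigma> \<psi>" and x: "x \<subseteq> {..<d}" and y: "y \<subseteq> {..<d}"
  shows "L_op d \<sigma> \<psi> $$ (set_encode x, set_encode y)
    = (\<Sum>k\<in>qubit_pairs d. pair_kernel (set_fun d \<psi>) (pair_set k) x y) / of_nat (d choose 2)"
proof -
  have s: "\<sigma> \<in> {1, - 1}" using par by (simp add: has_parity_def)
  let ?P = "parity_projector d \<sigma>" and ?M = "Omega0 d \<psi>"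
  note cP = parity_projector_carrier[OF s, of d] and cM = Omega0_carrier[of d \<psi>]
  have PM: "(?P * ?M) $$ (set_encode x, set_encode w) = of_bool (jw_sign d x = \<sigma>) * ?M $$ (set_encode x, set_encode w)"
    if w: "w \<subseteq> {..<d}" for w
  proof -
    have "(?P * ?M) $$ (set_encode x, set_encode w)
        = (\<Sum>u\<in>Pow {..<d}. if u = x then of_bool (jw_sign d x = \<sigma>) * ?M $$ (set_encode u, set_encode w) else 0)"
      unfolding mult_mat_set_encode[OF cP cM x w]
      by (intro sum.cong refl) (auto simp: parity_projector_index[OF s x])
    then show ?thesis using x by simp
  qed
  have "L_op d \<sigma> \<psi> $$ (set_encode x, set_encode y)
      = (\<Sum>u\<in>Pow {..<d}. if u = y then of_bool (jw_sign d x = \<sigma>) * ?M $$ (set_encode x, set_encode u)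
          * of_bool (jw_sign d y = \<sigma>) else 0)"
    unfolding L_op_def mult_mat_set_encode[OF mult_carrier_mat[OF cP cM] cP x y]
    by (intro sum.cong refl) (auto simp: parity_projector_index[OF s _ y] PM)
  also have "\<dots> = of_bool (jw_sign d x = \<sigma>) * ?M $$ (set_encode x, set_encode y) * of_bool (jw_sign d y = \<sigma>)"
    using y by simp
  also have "\<dots> = (\<Sum>k\<in>qubit_pairs d. pair_kernel (set_fun d \<psi>) (pair_set k) x y) / of_nat (d choose 2)"
  proof (cases "jw_sign d x = \<sigma> \<and> jw_sign d y = \<sigma>")
    case True
    have "pair_kernel (set_fun d \<psi>) (pair_set k) (toggle (fst k) x) (toggle (fst k) y) = 0"
      if k: "k \<in> qubit_pairs d" for k
    proof -
      have f: "fst k < d" using k by (auto simp: qubit_pairs_def)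
      have "toggle (fst k) x \<subseteq> {..<d}" using f x by (simp add: toggle_subset_iff)
      moreover have "jw_sign d (toggle (fst k) x) \<noteq> \<sigma>" using f True s by (auto simp: jw_sign_toggle)
      ultimately show ?thesis using has_parity_support[OF par] by (simp add: pair_kernel_def)
    qed
    then show ?thesis using True by (simp add: Omega0_index[OF x y])
  next
    case False
    then have "set_fun d \<psi> x = 0 \<or> set_fun d \<psi> y = 0"
      using has_parity_support[OF par x] has_parity_support[OF par y] by blast
    then have "pair_kernel (set_fun d \<psi>) K x y = 0" for K by (auto simp: pair_kernel_def)
    then show ?thesis using False by auto
  qed
  finally show ?thesis .
qed

lemma L_op_carrier: "\<sigma> \<in> {1, - 1} \<Longrightarrow> L_op d \<sigma> \<psi> \<in> carrier_mat (2 ^ d) (2 ^ d)"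
  unfolding L_op_def by (intro mult_carrier_mat[where n = "2 ^ d"] parity_projector_carrier Omega0_carrier)

lemma eq_mat_set_encode:
  assumes "A \<in> carrier_mat (2 ^ d) (2 ^ d)" "B \<in> carrier_mat (2 ^ d) (2 ^ d)"
    and "\<And>x y. x \<subseteq> {..<d} \<Longrightarrow> y \<subseteq> {..<d}
      \<Longrightarrow> A $$ (set_encode x, set_encode y) = B $$ (set_encode x, set_encode y)"
  shows "A = B"
proof (rule eq_matI)
  fix i j assume "i < dim_row B" "j < dim_col B"
  then have "i < 2 ^ d" "j < 2 ^ d" using assms(2) by auto
  then show "A $$ (i, j) = B $$ (i, j)"
    using assms(3)[OF set_decode_subset set_decode_subset, of i j] by simp
qed (use assms in auto)

lemma L_op_eq_branch_projectors:
  assumes par: "has_parity d \<sigma> \<psi>"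
  shows "L_op d \<sigma> \<psi> =
    (1 / of_nat (d choose 2)) \<cdot>\<^sub>m
      msum (2 ^ d) (qubit_pairs d) (\<lambda>k.
        msum (2 ^ d) (branches d \<psi> k) (\<lambda>z.
          ketbra (branch_vec d \<psi> k z) (branch_vec d \<psi> k z)))" (is "_ = ?R")
proof (rule eq_mat_set_encode)
  show "L_op d \<sigma> \<psi> \<in> carrier_mat (2 ^ d) (2 ^ d)"
    using par by (intro L_op_carrier) (simp add: has_parity_def)
  show "?R \<in> carrier_mat (2 ^ d) (2 ^ d)" by (simp add: msum_def)
  fix x y assume xy: "x \<subseteq> {..<d}" "y \<subseteq> {..<d}"
  have "?R $$ (set_encode x, set_encode y) = (\<Sum>k\<in>qubit_pairs d. \<Sum>z\<in>branches d \<psi> k.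
      ketbra (branch_vec d \<psi> k z) (branch_vec d \<psi> k z) $$ (set_encode x, set_encode y)) / of_nat (d choose 2)"
    using xy by (simp add: msum_def set_encode_less)
  then show "L_op d \<sigma> \<psi> $$ (set_encode x, set_encode y) = ?R $$ (set_encode x, set_encode y)"
    using xy by (simp add: L_op_index[OF par] branch_projectors_index)
qed

lemma hermitian_mat_set_encodeI:
  assumes "A \<in> carrier_mat (2 ^ d) (2 ^ d)"
    and "\<And>x y. x \<subseteq> {..<d} \<Longrightarrow> y \<subseteq> {..<d}
      \<Longrightarrow> A $$ (set_encode x, set_encode y) = cnj (A $$ (set_encode y, set_encode x))"
  shows "hermitian_mat (2 ^ d) A"
  unfolding hermitian_mat_def
proof (intro conjI allI impI)
  fix i j :: nat assume "i < 2 ^ d" "j < 2 ^ d"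
  then show "A $$ (i, j) = cnj (A $$ (j, i))"
    using assms(2)[OF set_decode_subset set_decode_subset, of i j] by simp
qed (rule assms(1))

lemma mat_form_set_encode:
  "ip f (mat_fun A (2 ^ d) f) {..<2 ^ d}
    = (\<Sum>x\<in>Pow {..<d}. \<Sum>y\<in>Pow {..<d}.
        cnj (f (set_encode x)) * A $$ (set_encode x, set_encode y) * f (set_encode y))"
  by (simp only: ip_def mat_fun_def sum_set_encode sum_distrib_left mult.assoc)

lemma L_op_form:
  assumes par: "has_parity d \<sigma> \<psi>"
  shows "ip f (mat_fun (L_op d \<sigma> \<psi>) (2 ^ d) f) {..<2 ^ d}
    = complex_of_real ((\<Sum>k\<in>qubit_pairs d. pair_form d (set_fun d \<psi>) (pair_set k) (\<lambda>x. f (set_encode x)))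
        / real (d choose 2))"
proof -
  let ?F = "\<lambda>x. f (set_encode x)" and ?g = "set_fun d \<psi>" and ?N = "of_nat (d choose 2) :: complex"
  have K: "pair_set k \<subseteq> {..<d}" if "k \<in> qubit_pairs d" for k
    using that by (auto simp: qubit_pairs_def pair_set_def)
  have "ip f (mat_fun (L_op d \<sigma> \<psi>) (2 ^ d) f) {..<2 ^ d}
      = (\<Sum>x\<in>Pow {..<d}. \<Sum>y\<in>Pow {..<d}. \<Sum>k\<in>qubit_pairs d.
          cnj (?F x) * pair_kernel ?g (pair_set k) x y * ?F y / ?N)"
    unfolding mat_form_set_encode
    by (intro sum.cong refl)
      (simp add: L_op_index[OF par] sum_distrib_left sum_distrib_right sum_divide_distrib)
  also have "\<dots> = (\<Sum>x\<in>Pow {..<d}. \<Sum>k\<in>qubit_pairs d. \<Sum>y\<in>Pow {..<d}.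
          cnj (?F x) * pair_kernel ?g (pair_set k) x y * ?F y / ?N)"
    by (rule sum.cong[OF refl], rule sum.swap)
  also have "\<dots> = (\<Sum>k\<in>qubit_pairs d. \<Sum>x\<in>Pow {..<d}. \<Sum>y\<in>Pow {..<d}.
          cnj (?F x) * pair_kernel ?g (pair_set k) x y * ?F y / ?N)"
    by (rule sum.swap)
  also have "\<dots> = (\<Sum>k\<in>qubit_pairs d. complex_of_real (pair_form d ?g (pair_set k) ?F)) / ?N"
    unfolding sum_divide_distrib
    by (intro sum.cong refl) (simp only: pair_kernel_form[OF K, symmetric] sum_divide_distrib)
  finally show ?thesis by simp
qed

lemma qubit_count: "2 \<le> d \<Longrightarrow> 2 \<le> (2 :: nat) ^ d"
  using power_increasing[of 1 d "2 :: nat"] by simp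

lemma real_choose_two: "real (d choose 2) = real d * (real d - 1) / 2"
proof -
  have "2 * (d choose 2) = d * (d - 1)"
  proof -
    have "even (d * (d - 1))" by (cases d) auto
    then show ?thesis by (simp add: choose_two)
  qed
  then have "2 * real (d choose 2) = real (d * (d - 1))"
    by (metis of_nat_mult of_nat_numeral)
  then show ?thesis by (cases d) (simp_all add: field_simps)
qed

lemma ip_set_fun:
  "ip (\<lambda>i. \<psi> $ i) f {..<2 ^ d} = ip (set_fun d \<psi>) (\<lambda>x. f (set_encode x)) (Pow {..<d})"
  by (simp add: ip_def sum_set_encode set_fun_def)

lemma nsq_set_encode: "nsq f {..<2 ^ d} = nsq (\<lambda>x. f (set_encode x)) (Pow {..<d})"
  using sum.reindex_bij_betw[OF bij_set_encode, of "\<lambda>i. (cmod (f i))\<^sup>2" d] by (simp add: nsq_def)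

lemma L_op_second_eigenvalue:
  assumes d: "2 \<le> d" and wick: "wick_relations d (set_fun d \<psi>)" and par: "has_parity d \<sigma> \<psi>"
  shows "eigvals_desc (L_op d \<sigma> \<psi>) ! 1 \<le> 1 - 1 / real (d choose 2)"
proof (rule second_eigenvalue_bounds(1)[OF _ qubit_count[OF d], where \<psi> = "\<lambda>i. \<psi> $ i"])
  have s: "\<sigma> \<in> {1, - 1}" using par by (simp add: has_parity_def)
  have N: "real (d choose 2) > 0" using d by (simp add: zero_less_binomial)
  show "hermitian_mat (2 ^ d) (L_op d \<sigma> \<psi>)"
  proof (rule hermitian_mat_set_encodeI[OF L_op_carrier[OF s]])
    fix x y assume "x \<subseteq> {..<d}" "y \<subseteq> {..<d}"
    then show "L_op d \<sigma> \<psi> $$ (set_encode x, set_encode y) = cnj (L_op d \<sigma> \<psi> $$ (set_encode y, set_encode x))"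
      by (simp add: L_op_index[OF par] pair_kernel_hermitian[of _ _ y x])
  qed
  show "0 \<le> Re (ip f (mat_fun (L_op d \<sigma> \<psi>) (2 ^ d) f) {..<2 ^ d})" for f
    unfolding L_op_form[OF par] Re_complex_of_real by (intro divide_nonneg_nonneg sum_nonneg pair_form_nonneg) simp
  fix f assume orth: "ip (\<lambda>i. \<psi> $ i) f {..<2 ^ d} = 0"
  have "(\<Sum>k\<in>qubit_pairs d. pair_form d (set_fun d \<psi>) (pair_set k) (\<lambda>x. f (set_encode x)))
      \<le> (real (d choose 2) - 1) * nsq (\<lambda>x. f (set_encode x)) (Pow {..<d})"
    by (rule sum_pair_form_le[OF wick d]) (use orth in \<open>simp add: ip_set_fun\<close>)
  then show "Re (ip f (mat_fun (L_op d \<sigma> \<psi>) (2 ^ d) f) {..<2 ^ d}) \<le> (1 - 1 / real (d choose 2)) * nsq f {..<2 ^ d}"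
    unfolding L_op_form[OF par] Re_complex_of_real nsq_set_encode using N by (simp add: field_simps)
qed

section \<open>The full verification operator\<close>

text \<open>The form sees F only on the support of g. This permits replacing F by its component of
  the parity that is probed.\<close>

lemma pair_form_cong:
  assumes K: "K \<subseteq> {..<d}" and eq: "\<And>x. x \<subseteq> {..<d} \<Longrightarrow> g x \<noteq> 0 \<Longrightarrow> F x = F' x"
  shows "pair_form d g K F = pair_form d g K F'"
proof -
  have "ip g F (sector K A) = ip g F' (sector K A)" if A: "A \<in> Pow ({..<d} - K)" for A
    unfolding ip_def
  proof (rule sum.cong[OF refl])
    fix x assume "x \<in> sector K A"
    then have "x \<subseteq> {..<d}" using K A by (auto simp: sector_def)
    then show "cnj (g x) * F x = cnj (g x) * F' x" using eq by (cases "g x = 0") auto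
  qed
  then show ?thesis by (simp add: pair_form_def)
qed

lemma sum_toggle:
  assumes "j < d"
  shows "(\<Sum>x\<in>Pow {..<d}. h (toggle j x)) = (\<Sum>x\<in>Pow {..<d}. h x)"
  by (rule sum.reindex_bij_witness[where i = "toggle j" and j = "toggle j"])
    (use assms in \<open>auto simp: toggle_subset_iff subset_iff in_toggle_iff\<close>)

lemma Omega_index:
  assumes s: "\<sigma> \<in> {1, - 1}" and x: "x \<subseteq> {..<d}" and y: "y \<subseteq> {..<d}"
  shows "Omega d \<sigma> \<psi> $$ (set_encode x, set_encode y)
    = (of_bool (x = y \<and> jw_sign d x = \<sigma>)
        + (\<Sum>k\<in>qubit_pairs d. pair_kernel (set_fun d \<psi>) (pair_set k) x y
            + pair_kernel (set_fun d \<psi>) (pair_set k) (toggle (fst k) x) (toggle (fst k) y)) / of_nat (d choose 2)) / 2"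
  using parity_projector_carrier[OF s, of d] Omega0_carrier[of d \<psi>] set_encode_less[OF x] set_encode_less[OF y]
  by (simp add: Omega_def Omega0_index[OF x y] parity_projector_index[OF s x y] add_divide_distrib)

text \<open>Substituting toggled sets for x and y moves the toggles of the second kernel onto f, so
  that it becomes a form of the same kind as the first.\<close>

lemma Omega_form:
  assumes s: "\<sigma> \<in> {1, - 1}"
  shows "ip f (mat_fun (Omega d \<sigma> \<psi>) (2 ^ d) f) {..<2 ^ d}
    = complex_of_real
        ((nsq (\<lambda>x. of_bool (jw_sign d x = \<sigma>) * f (set_encode x)) (Pow {..<d})
          + (\<Sum>k\<in>qubit_pairs d. pair_form d (set_fun d \<psi>) (pair_set k) (\<lambda>x. f (set_encode x))
              + pair_form d (set_fun d \<psi>) (pair_set k) (\<lambda>x. f (set_encode (toggle (fst k) x))))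
            / real (d choose 2)) / 2)"
proof -
  let ?F = "\<lambda>x. f (set_encode x)" and ?g = "set_fun d \<psi>" and ?N = "of_nat (d choose 2) :: complex"
  let ?D = "Pow {..<d}"
  let ?q = "\<lambda>k x y. cnj (?F x) * pair_kernel ?g (pair_set k) x y * ?F y"
  let ?q' = "\<lambda>k x y. cnj (?F x) * pair_kernel ?g (pair_set k) (toggle (fst k) x) (toggle (fst k) y) * ?F y"
  have K: "pair_set k \<subseteq> {..<d}" and f: "fst k < d" if "k \<in> qubit_pairs d" for k
    using that by (auto simp: qubit_pairs_def pair_set_def)
  have proj: "(\<Sum>x\<in>?D. \<Sum>y\<in>?D. cnj (?F x) * of_bool (x = y \<and> jw_sign d x = \<sigma>) * ?F y)
      = complex_of_real (nsq (\<lambda>x. of_bool (jw_sign d x = \<sigma>) * ?F x) ?D)"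
  proof -
    have "(\<Sum>y\<in>?D. cnj (?F x) * of_bool (x = y \<and> jw_sign d x = \<sigma>) * ?F y)
        = complex_of_real ((cmod (of_bool (jw_sign d x = \<sigma>) * ?F x))\<^sup>2)" if x: "x \<in> ?D" for x
    proof -
      have "(\<Sum>y\<in>?D. cnj (?F x) * of_bool (x = y \<and> jw_sign d x = \<sigma>) * ?F y)
          = (\<Sum>y\<in>?D. if y = x then cnj (?F x) * of_bool (jw_sign d x = \<sigma>) * ?F x else 0)"
        by (intro sum.cong refl) auto
      also have "\<dots> = cnj (?F x) * of_bool (jw_sign d x = \<sigma>) * ?F x" using x by simp
      also have "\<dots> = complex_of_real ((cmod (of_bool (jw_sign d x = \<sigma>) * ?F x))\<^sup>2)"
        by (simp add: complex_norm_square mult.commute del: of_real_power)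
      finally show ?thesis .
    qed
    then show ?thesis by (simp add: nsq_def)
  qed
  have q': "(\<Sum>x\<in>?D. \<Sum>y\<in>?D. ?q' k x y)
      = complex_of_real (pair_form d ?g (pair_set k) (\<lambda>x. ?F (toggle (fst k) x)))"
    if k: "k \<in> qubit_pairs d" for k
  proof -
    let ?t = "toggle (fst k)"
    have "(\<Sum>x\<in>?D. \<Sum>y\<in>?D. ?q' k x y) = (\<Sum>x\<in>?D. \<Sum>y\<in>?D. ?q' k (?t x) y)"
      by (rule sum_toggle[OF f[OF k], symmetric])
    also have "\<dots> = (\<Sum>x\<in>?D. \<Sum>y\<in>?D. ?q' k (?t x) (?t y))"
      by (rule sum.cong[OF refl], rule sum_toggle[OF f[OF k], symmetric])
    finally show ?thesis by (simp add: pair_kernel_form[OF K[OF k], of "\<lambda>x. ?F (?t x)", symmetric])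
  qed
  have "ip f (mat_fun (Omega d \<sigma> \<psi>) (2 ^ d) f) {..<2 ^ d}
      = (\<Sum>x\<in>?D. \<Sum>y\<in>?D. (cnj (?F x) * of_bool (x = y \<and> jw_sign d x = \<sigma>) * ?F y
          + (\<Sum>k\<in>qubit_pairs d. ?q k x y + ?q' k x y) / ?N) / 2)"
    unfolding mat_form_set_encode
  proof (intro sum.cong refl)
    fix x y assume "x \<in> ?D" "y \<in> ?D"
    then have xy: "x \<subseteq> {..<d}" "y \<subseteq> {..<d}" by auto
    have "(\<Sum>k\<in>qubit_pairs d. ?q k x y + ?q' k x y)
        = cnj (?F x) * (\<Sum>k\<in>qubit_pairs d. pair_kernel ?g (pair_set k) x y
            + pair_kernel ?g (pair_set k) (toggle (fst k) x) (toggle (fst k) y)) * ?F y"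
      by (simp add: sum_distrib_left sum_distrib_right distrib_left distrib_right)
    then show "cnj (?F x) * Omega d \<sigma> \<psi> $$ (set_encode x, set_encode y) * ?F y
        = (cnj (?F x) * of_bool (x = y \<and> jw_sign d x = \<sigma>) * ?F y
          + (\<Sum>k\<in>qubit_pairs d. ?q k x y + ?q' k x y) / ?N) / 2"
      unfolding Omega_index[OF s xy] by (simp only: distrib_left distrib_right times_divide_eq_left times_divide_eq_right)
  qed
  also have "\<dots> = ((\<Sum>x\<in>?D. \<Sum>y\<in>?D. cnj (?F x) * of_bool (x = y \<and> jw_sign d x = \<sigma>) * ?F y)
      + (\<Sum>x\<in>?D. \<Sum>y\<in>?D. \<Sum>k\<in>qubit_pairs d. ?q k x y + ?q' k x y) / ?N) / 2"
    by (simp only: sum_divide_distrib sum.distrib add_divide_distrib)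
  also have "(\<Sum>x\<in>?D. \<Sum>y\<in>?D. \<Sum>k\<in>qubit_pairs d. ?q k x y + ?q' k x y)
      = (\<Sum>x\<in>?D. \<Sum>k\<in>qubit_pairs d. \<Sum>y\<in>?D. ?q k x y + ?q' k x y)"
    by (rule sum.cong[OF refl], rule sum.swap)
  also have "\<dots> = (\<Sum>k\<in>qubit_pairs d. \<Sum>x\<in>?D. \<Sum>y\<in>?D. ?q k x y + ?q' k x y)"
    by (rule sum.swap)
  also have "\<dots> = (\<Sum>k\<in>qubit_pairs d. complex_of_real (pair_form d ?g (pair_set k) ?F
      + pair_form d ?g (pair_set k) (\<lambda>x. ?F (toggle (fst k) x))))"
    by (intro sum.cong refl) (simp only: sum.distrib q' pair_kernel_form[OF K] of_real_add)
  finally show ?thesis unfolding proj by simp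
qed

text \<open>The vector splits by parity as U + W, and the forms have no cross terms. On U the parity
  test accepts fully and the correlation test at most with 1 - 1 / N, where N is the number of
  pairs, which averages to 1 - 1 / (2 N). On W the parity test rejects and the correlation test
  contributes at most 1, which averages to 1 / 2; this is no larger, as N \<ge> 1.\<close>

lemma Omega_second_eigenvalue:
  assumes d: "2 \<le> d" and wick: "wick_relations d (set_fun d \<psi>)" and par: "has_parity d \<sigma> \<psi>"
  shows "eigvals_desc (Omega d \<sigma> \<psi>) ! 1 \<le> 1 - 1 / (2 * real (d choose 2))"
    and "0 \<le> eigvals_desc (Omega d \<sigma> \<psi>) ! 1"
proof -
  let ?N = "real (d choose 2)" and ?g = "set_fun d \<psi>" and ?D = "Pow {..<d}"
  have s: "\<sigma> \<in> {1, - 1}" using par by (simp add: has_parity_def)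
  have "0 < d choose 2" using d by (simp add: zero_less_binomial)
  then have N: "1 \<le> ?N" by linarith
  have K: "pair_set k \<subseteq> {..<d}" and f: "fst k < d" if "k \<in> qubit_pairs d" for k
    using that by (auto simp: qubit_pairs_def pair_set_def)
  have herm: "hermitian_mat (2 ^ d) (Omega d \<sigma> \<psi>)"
  proof (rule hermitian_mat_set_encodeI)
    show "Omega d \<sigma> \<psi> \<in> carrier_mat (2 ^ d) (2 ^ d)"
      unfolding Omega_def by (intro smult_carrier_mat add_carrier_mat Omega0_carrier)
    fix x y assume xy: "x \<subseteq> {..<d}" "y \<subseteq> {..<d}"
    show "Omega d \<sigma> \<psi> $$ (set_encode x, set_encode y) = cnj (Omega d \<sigma> \<psi> $$ (set_encode y, set_encode x))"
      unfolding Omega_index[OF s xy] Omega_index[OF s xy(2,1)]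
      by (auto simp: pair_kernel_hermitian[of _ _ y x]
          pair_kernel_hermitian[of _ _ "toggle k y" "toggle k x" for k] of_bool_def)
  qed
  have psd: "0 \<le> Re (ip f (mat_fun (Omega d \<sigma> \<psi>) (2 ^ d) f) {..<2 ^ d})" for f
    unfolding Omega_form[OF s] Re_complex_of_real
    by (intro divide_nonneg_nonneg sum_nonneg add_nonneg_nonneg pair_form_nonneg nsq_nonneg) simp_all
  have upper: "Re (ip f (mat_fun (Omega d \<sigma> \<psi>) (2 ^ d) f) {..<2 ^ d}) \<le> (1 - 1 / (2 * ?N)) * nsq f {..<2 ^ d}"
    if orth: "ip (\<lambda>i. \<psi> $ i) f {..<2 ^ d} = 0" for f
  proof -
    define F where "F x = f (set_encode x)" for x
    define U where "U x = of_bool (jw_sign d x = \<sigma>) * F x" for x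
    define W where "W x = of_bool (jw_sign d x \<noteq> \<sigma>) * F x" for x
    have supp: "jw_sign d x = \<sigma>" if "x \<subseteq> {..<d}" "?g x \<noteq> 0" for x
      using has_parity_support[OF par] that by blast
    have split: "nsq F ?D = nsq U ?D + nsq W ?D"
      unfolding nsq_def sum.distrib[symmetric] by (intro sum.cong refl) (auto simp: U_def W_def)
    have "ip ?g U ?D = ip ?g F ?D"
      unfolding ip_def
    proof (rule sum.cong[OF refl])
      fix x assume "x \<in> ?D"
      then show "cnj (?g x) * U x = cnj (?g x) * F x" using supp[of x] by (cases "?g x = 0") (auto simp: U_def)
    qed
    then have "ip ?g U ?D = 0" using orth by (simp add: ip_set_fun F_def[abs_def])
    then have "(\<Sum>k\<in>qubit_pairs d. pair_form d ?g (pair_set k) U) \<le> (?N - 1) * nsq U ?D"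
      by (rule sum_pair_form_le[OF wick d])
    moreover have "pair_form d ?g (pair_set k) F = pair_form d ?g (pair_set k) U" if "k \<in> qubit_pairs d" for k
      by (rule pair_form_cong[OF K[OF that]]) (use supp in \<open>simp add: U_def\<close>)
    ultimately have 1: "(\<Sum>k\<in>qubit_pairs d. pair_form d ?g (pair_set k) F) \<le> (?N - 1) * nsq U ?D" by simp
    \<comment> \<open>The support of \<psi> has parity \<sigma>, so after the toggle F is probed
      only at the opposite parity, where it coincides with W.\<close>
    have "pair_form d ?g (pair_set k) (\<lambda>x. F (toggle (fst k) x)) \<le> nsq W ?D" if k: "k \<in> qubit_pairs d" for k
    proof -
      have "pair_form d ?g (pair_set k) (\<lambda>x. F (toggle (fst k) x))
          = pair_form d ?g (pair_set k) (\<lambda>x. W (toggle (fst k) x))"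
      proof (rule pair_form_cong[OF K[OF k]])
        fix x assume "x \<subseteq> {..<d}" "?g x \<noteq> 0"
        then have "jw_sign d (toggle (fst k) x) \<noteq> \<sigma>"
          using supp[of x] s f[OF k] by (auto simp: jw_sign_toggle)
        then show "F (toggle (fst k) x) = W (toggle (fst k) x)" by (simp add: W_def)
      qed
      also have "\<dots> \<le> nsq (\<lambda>x. W (toggle (fst k) x)) ?D" by (rule pair_form_le[OF K[OF k]])
      also have "\<dots> = nsq W ?D" unfolding nsq_def by (rule sum_toggle[OF f[OF k]])
      finally show ?thesis .
    qed
    then have 2: "(\<Sum>k\<in>qubit_pairs d. pair_form d ?g (pair_set k) (\<lambda>x. F (toggle (fst k) x))) \<le> ?N * nsq W ?D"
      using sum_bounded_above[of "qubit_pairs d" _ "nsq W ?D"] by (simp add: card_qubit_pairs)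
    have "Re (ip f (mat_fun (Omega d \<sigma> \<psi>) (2 ^ d) f) {..<2 ^ d})
        = (nsq U ?D + ((\<Sum>k\<in>qubit_pairs d. pair_form d ?g (pair_set k) F)
            + (\<Sum>k\<in>qubit_pairs d. pair_form d ?g (pair_set k) (\<lambda>x. F (toggle (fst k) x)))) / ?N) / 2"
      unfolding Omega_form[OF s] Re_complex_of_real U_def F_def by (simp only: sum.distrib)
    also have "\<dots> \<le> (nsq U ?D + ((?N - 1) * nsq U ?D + ?N * nsq W ?D) / ?N) / 2"
      using 1 2 N by (intro divide_right_mono add_left_mono add_mono) auto
    also have "\<dots> = (1 - 1 / (2 * ?N)) * nsq U ?D + (1 / 2) * nsq W ?D"
    proof -
      have "(u + ((N - 1) * u + N * w) / N) / 2 = (1 - 1 / (2 * N)) * u + (1 / 2) * w"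
        if "1 \<le> N" for N u w :: real
        using that by (simp add: field_simps)
      from this[OF N] show ?thesis .
    qed
    also have "\<dots> \<le> (1 - 1 / (2 * ?N)) * nsq U ?D + (1 - 1 / (2 * ?N)) * nsq W ?D"
    proof -
      have "1 / 2 \<le> 1 - 1 / (2 * N)" if "1 \<le> N" for N :: real
        using that by (simp add: field_simps)
      from this[OF N] show ?thesis by (intro add_left_mono mult_right_mono nsq_nonneg)
    qed
    also have "\<dots> = (1 - 1 / (2 * ?N)) * nsq f {..<2 ^ d}"
      by (simp add: nsq_set_encode F_def[symmetric] split distrib_left)
    finally show ?thesis .
  qed
  show "eigvals_desc (Omega d \<sigma> \<psi>) ! 1 \<le> 1 - 1 / (2 * ?N)"
    by (rule second_eigenvalue_bounds(1)[OF herm qubit_count[OF d] upper psd])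
  show "0 \<le> eigvals_desc (Omega d \<sigma> \<psi>) ! 1"
    by (rule second_eigenvalue_bounds(2)[OF herm qubit_count[OF d] upper psd])
qed

text \<open>The bound \<open>\<gamma> \<le> 1\<close> keeps the argument of the logarithm positive; on negative reals \<open>ln\<close> is
  \<open>ln \<bar>x\<bar>\<close>.\<close>

lemma sample_complexity_le:
  assumes "0 < g" "g \<le> \<gamma>" "\<gamma> \<le> 1" "0 < \<epsilon>" "\<epsilon> < 1" "0 < \<delta>" "\<delta> < 1"
  shows "sample_complexity \<gamma> \<epsilon> \<delta> \<le> \<lceil>1 / (g * \<epsilon>) * ln (1 / \<delta>)\<rceil>"
  unfolding sample_complexity_def
proof (rule ceiling_mono)
  have "\<gamma> * \<epsilon> \<le> 1 * \<epsilon>" using assms by (intro mult_right_mono) auto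
  then have lt: "\<gamma> * \<epsilon> < 1" using assms by linarith
  have ge: "g * \<epsilon> \<le> \<gamma> * \<epsilon>" using assms by (intro mult_right_mono) auto
  have pos: "0 < g * \<epsilon>" using assms by simp
  have "ln (1 - \<gamma> * \<epsilon>) \<le> - (\<gamma> * \<epsilon>)" using ln_le_minus_one[of "1 - \<gamma> * \<epsilon>"] lt by simp
  then have L: "g * \<epsilon> \<le> - ln (1 - \<gamma> * \<epsilon>)" using ge by linarith
  have D: "0 \<le> ln (1 / \<delta>)" using assms by simp
  have "ln \<delta> / ln (1 - \<gamma> * \<epsilon>) = ln (1 / \<delta>) / (- ln (1 - \<gamma> * \<epsilon>))"
    using assms by (simp add: ln_div)
  also have "\<dots> \<le> ln (1 / \<delta>) / (g * \<epsilon>)"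
    by (rule divide_left_mono[OF L D mult_pos_pos]) (use L pos in linarith)+
  finally show "ln \<delta> / ln (1 - \<gamma> * \<epsilon>) \<le> 1 / (g * \<epsilon>) * ln (1 / \<delta>)" by simp
qed

theorem theorem1:
  fixes d :: nat and \<psi> :: "complex vec" and \<sigma> :: complex
  assumes "d \<ge> 2"
    and "gaussian_state d \<psi>"
    and "has_parity d \<sigma> \<psi>"
  shows "L_op d \<sigma> \<psi> =
           (1 / of_nat (d choose 2)) \<cdot>\<^sub>m
             msum (2 ^ d) (qubit_pairs d) (\<lambda>k.
               msum (2 ^ d) (branches d \<psi> k) (\<lambda>z.
                 ketbra (branch_vec d \<psi> k z) (branch_vec d \<psi> k z)))
         \<and> spectral_gap (L_op d \<sigma> \<psi>) \<ge> 2 / (real d * (real d - 1))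
         \<and> (\<forall>\<epsilon> \<delta> :: real. 0 < \<epsilon> \<and> \<epsilon> < 1 \<and> 0 < \<delta> \<and> \<delta> < 1 \<longrightarrow>
              sample_complexity (spectral_gap (Omega d \<sigma> \<psi>)) \<epsilon> \<delta>
                \<le> \<lceil>real d * (real d - 1) / \<epsilon> * ln (1 / \<delta>)\<rceil>)"
proof (intro conjI allI impI)
  have d: "2 \<le> d" using assms(1) .
  note wick = gaussian_state_wick[OF assms(2)] and par = assms(3)
  show "L_op d \<sigma> \<psi> =
           (1 / of_nat (d choose 2)) \<cdot>\<^sub>m
             msum (2 ^ d) (qubit_pairs d) (\<lambda>k.
               msum (2 ^ d) (branches d \<psi> k) (\<lambda>z.
                 ketbra (branch_vec d \<psi> k z) (branch_vec d \<psi> k z)))"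
    by (rule L_op_eq_branch_projectors[OF par])
  show "spectral_gap (L_op d \<sigma> \<psi>) \<ge> 2 / (real d * (real d - 1))"
    using L_op_second_eigenvalue[OF d wick par] by (simp add: spectral_gap_def real_choose_two)
  fix \<epsilon> \<delta> :: real assume h: "0 < \<epsilon> \<and> \<epsilon> < 1 \<and> 0 < \<delta> \<and> \<delta> < 1"
  \<comment> \<open>This is 1 / (2 * (d choose 2)), half the gap bound of \<open>L_op\<close>, as
    the correlation test is applied with probability 1 / 2.\<close>
  let ?g = "1 / (real d * (real d - 1))"
  have "sample_complexity (spectral_gap (Omega d \<sigma> \<psi>)) \<epsilon> \<delta> \<le> \<lceil>1 / (?g * \<epsilon>) * ln (1 / \<delta>)\<rceil>"
    by (rule sample_complexity_le)
      (use d h Omega_second_eigenvalue[OF d wick par] in \<open>simp_all add: spectral_gap_def real_choose_two\<close>)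
  then show "sample_complexity (spectral_gap (Omega d \<sigma> \<psi>)) \<epsilon> \<delta>
      \<le> \<lceil>real d * (real d - 1) / \<epsilon> * ln (1 / \<delta>)\<rceil>" by simp
qed

end
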